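(* Let $(A(n))_{n\ge1}$ be an i.i.d. sequence of random $(\max,+)$ operators on $\mathbb R^d$ with the memory loss property, and let $X^0$ be any $\mathbb R^d$-valued random variable independent of $(A(n))$. If $\max_{i,j}A(1)_{ij}$ and $\min_j\max_iA(1)_{ij}$ have finite second moments, then there exists $\sigma^2\ge0$ (not depending on $X^0$) such that (i) $\frac{x(n,X^0)-n\gamma\mathbf 1}{\sqrt n}$ converges weakly to a random vector whose coordinates are all equal and have law $\mathcal N(0,\sigma^2)$; (ii) $\sigma^2=\lim_n\frac1n\int\big(\max_{i,j}(A(n)\cdots A(1))_{ij}-n\gamma\big)^2d\mathbb P$.
   Context: $\mathbb R_{\max}=\mathbb R\cup\{-\infty\}$. A $d\times d$ matrix $A$ with entries in $\mathbb R_{\max}$ and no row identically $-\infty$ defines a $(\max,+)$ operator on $\mathbb R^d$ by $(Ax)_i=\max_j(A_{ij}+x_j)$; composition corresponds to the $(\max,+)$ matrix product $(AB)_{ij}=\max_p(A_{ip}+B_{pj})$. Such operators are topical: isotone and $A(x+a\mathbf 1)=Ax+a\mathbf 1$, $\mathbf 1=(1,\dots,1)'$. Let $\bar x$ be the class of $x$ modulo $\mathbb R\mathbf 1$. An operator $A$ has rank 1 if $\overline{Ax}$ does not depend on $x\in\mathbb R^d$; the sequence has the memory loss property if some $A(N)\cdots A(1)$ has rank 1 with positive probability. $x(0,X^0)=X^0$, $x(n,X^0)=A(n)x(n-1,X^0)$; $\gamma$ is the Lyapunov exponent ($x(n,X^0)/n\to\gamma\mathbf 1$ a.s.). *)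

theory Defs
  imports "HOL-Probability.Probability"
begin

text \<open>(max,+) matrices over R_max = R \<union> {-\<infinity>}, represented as ereal matrices with no +\<infinity>
  entry; dimension d is the finite index type 'd.\<close>

definition mp_valid :: "ereal^'d^'d \<Rightarrow> bool" where
  "mp_valid A \<longleftrightarrow> (\<forall>i j. A$i$j \<noteq> \<infinity>) \<and> (\<forall>i. \<exists>j. A$i$j \<noteq> -\<infinity>)"

definition mp_apply :: "ereal^'d^'d \<Rightarrow> real^'d \<Rightarrow> real^'d" where
  "mp_apply A x = (\<chi> i. real_of_ereal (Max (range (\<lambda>j. A$i$j + ereal (x$j)))))"

definition mp_mult :: "ereal^'d^'d \<Rightarrow> ereal^'d^'d \<Rightarrow> ereal^'d^'d" where
  "mp_mult A B = (\<chi> i j. Max (range (\<lambda>p. A$i$p + B$p$j)))"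

definition mp_id :: "ereal^'d^'d" where
  "mp_id = (\<chi> i j. if i = j then 0 else -\<infinity>)"

definition mp_rank1 :: "ereal^'d^'d \<Rightarrow> bool" where
  "mp_rank1 A \<longleftrightarrow> (\<forall>x y. \<exists>c::real. \<forall>i. (mp_apply A x)$i = (mp_apply A y)$i + c)"

fun mp_prod :: "(nat \<Rightarrow> ereal^'d^'d) \<Rightarrow> nat \<Rightarrow> ereal^'d^'d" where
  "mp_prod B 0 = mp_id"
| "mp_prod B (Suc n) = mp_mult (B (Suc n)) (mp_prod B n)"

fun mp_traj :: "(nat \<Rightarrow> ereal^'d^'d) \<Rightarrow> real^'d \<Rightarrow> nat \<Rightarrow> real^'d" where
  "mp_traj B x0 0 = x0"
| "mp_traj B x0 (Suc n) = mp_apply (B (Suc n)) (mp_traj B x0 n)"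

definition mp_maxentry :: "ereal^'d^'d \<Rightarrow> ereal" where
  "mp_maxentry A = Max (range (\<lambda>(i,j). A$i$j))"

definition mp_minmax :: "ereal^'d^'d \<Rightarrow> ereal" where
  "mp_minmax A = Min (range (\<lambda>j. Max (range (\<lambda>i. A$i$j))))"

definition finite_second_moment :: "'a measure \<Rightarrow> ('a \<Rightarrow> ereal) \<Rightarrow> bool" where
  "finite_second_moment M f \<longleftrightarrow>
     f \<in> borel_measurable M \<and> (AE \<omega> in M. \<bar>f \<omega>\<bar> \<noteq> \<infinity>) \<and>
     integrable M (\<lambda>\<omega>. (real_of_ereal (f \<omega>))\<^sup>2)"

definition weak_conv_vec :: "(nat \<Rightarrow> (real^'d) measure) \<Rightarrow> (real^'d) measure \<Rightarrow> bool" where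
  "weak_conv_vec \<mu>s \<mu> \<longleftrightarrow>
     (\<forall>f :: real^'d \<Rightarrow> real. continuous_on UNIV f \<longrightarrow> bounded (range f) \<longrightarrow>
        (\<lambda>n. integral\<^sup>L (\<mu>s n) f) \<longlonglongrightarrow> integral\<^sup>L \<mu> f)"

definition diag_normal :: "real \<Rightarrow> (real^'d) measure" where
  "diag_normal s2 = (if s2 = 0 then return borel 0
     else distr (density lborel (normal_density 0 (sqrt s2))) borel (\<lambda>z. (\<chi> i. z)))"

definition indep_rv :: "'a measure \<Rightarrow> 'b measure \<Rightarrow> ('a \<Rightarrow> 'b) \<Rightarrow> 'c measure \<Rightarrow> ('a \<Rightarrow> 'c) \<Rightarrow> bool" where
  "indep_rv M MX X MY Y \<longleftrightarrow>
     X \<in> measurable M MX \<and> Y \<in> measurable M MY \<and>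
     prob_space.indep_set M {X -` B \<inter> space M |B. B \<in> sets MX} {Y -` C \<inter> space M |C. C \<in> sets MY}"

end

theory Submission
  imports Defs
begin

text \<open>Let \<open>S(s,t)\<close> be the largest coordinate of \<open>A(t)\<cdots>A(s+1) 0\<close>. It is subadditive, and the defect
  \<open>S(s,t) + S(t,u) - S(s,u) \<ge> 0\<close> stops changing as soon as a block of matrices after \<open>t\<close> has rank one.
  Hence it is dominated by a sum of i.i.d. terms \<open>max A - min max A\<close> up to a geometric time, so it is
  bounded in \<open>L\<^sup>2\<close>, and it forgets the starting point \<open>s\<close> exponentially fast as \<open>t - s\<close> grows.
  For fixed \<open>m\<close>, \<open>S(0,km)\<close> is a sum of \<open>k\<close> i.i.d. blocks minus \<open>k\<close> defects with summable covariances,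
  whose centered sum has \<open>L\<^sup>2\<close> norm at most \<open>c \<surd>k\<close> with \<open>c\<close> independent of \<open>m\<close>. After division by
  \<open>\<surd>(km)\<close> the error is at most \<open>c / \<surd>m\<close>, uniformly in \<open>k\<close>, so the classical central limit theorem for
  the blocks gives both the Gaussian limit and the convergence of the variances as \<open>m \<rightarrow> \<infinity>\<close>.\<close>

section \<open>Square-integrable random variables\<close>

text \<open>The obstacle is that a defect depends on the whole past, so the corrections to an i.i.d.
  sum are neither independent nor bounded. The blocks have a deterministic length m instead of being
  cut at random times of memory loss: they are then exactly i.i.d. and the classical theorem applies
  to them unchanged. Limits are taken in n for fixed m first and in m afterwards. One number
  \<sigma> comes out of both the L2 norms and the characteristic functions, so (i) and (ii) are
  obtained together. Second moments of exactly these two quantities enter because one matrix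
  \<open>A\<close> changes the largest coordinate by at least min max A and at most max A, whatever
  the vector. Three facts lead from the scalar process back to the statement. The slope of the means
  is identified with \<gamma>. Replacing the initial vector by 0 moves a trajectory by at most the
  norm of that vector, because the operators are nonexpansive. The other coordinates stay near the
  largest one, since after a loss of memory their relative position is a function of a few recent
  matrices. The last two errors are tight and disappear after division by the square root of
  n.\<close>

definition sq_int :: "'a measure \<Rightarrow> ('a \<Rightarrow> real) \<Rightarrow> bool" where
  "sq_int M X \<longleftrightarrow> X \<in> borel_measurable M \<and> integrable M (\<lambda>\<omega>. (X \<omega>)\<^sup>2)"

definition l2norm :: "'a measure \<Rightarrow> ('a \<Rightarrow> real) \<Rightarrow> real" where
  "l2norm M X = sqrt (\<integral>\<omega>. (X \<omega>)\<^sup>2 \<partial>M)"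

lemma sq_int_integrable_square: "sq_int M X \<Longrightarrow> integrable M (\<lambda>\<omega>. (X \<omega>)\<^sup>2)"
  by (simp add: sq_int_def)

lemma l2norm_nonneg [simp]: "0 \<le> l2norm M X"
  by (simp add: l2norm_def)

lemma l2norm_square: "(l2norm M X)\<^sup>2 = (\<integral>\<omega>. (X \<omega>)\<^sup>2 \<partial>M)"
  by (simp add: l2norm_def)

lemma sq_int_AE_mono:
  assumes "sq_int M Y" "X \<in> borel_measurable M" "AE \<omega> in M. \<bar>X \<omega>\<bar> \<le> \<bar>Y \<omega>\<bar>"
  shows "sq_int M X" "l2norm M X \<le> l2norm M Y"
proof -
  have le: "AE \<omega> in M. (X \<omega>)\<^sup>2 \<le> (Y \<omega>)\<^sup>2"
    using assms(3) by eventually_elim (simp add: abs_le_square_iff)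
  have "integrable M (\<lambda>\<omega>. (X \<omega>)\<^sup>2)"
    by (rule Bochner_Integration.integrable_bound[OF sq_int_integrable_square[OF assms(1)]])
       (use assms(2) le in auto)
  then show "sq_int M X" using assms(2) by (simp add: sq_int_def)
  then show "l2norm M X \<le> l2norm M Y"
    unfolding l2norm_def using le assms(1)
    by (intro real_sqrt_le_mono integral_mono_AE) (auto simp: sq_int_def)
qed

lemma sq_int_mult_integrable:
  assumes "sq_int M X" "sq_int M Y"
  shows "integrable M (\<lambda>\<omega>. X \<omega> * Y \<omega>)"
proof -
  have [measurable]: "X \<in> borel_measurable M" "Y \<in> borel_measurable M"
    using assms by (auto simp: sq_int_def)
  have i: "integrable M (\<lambda>\<omega>. (X \<omega>)\<^sup>2 + (Y \<omega>)\<^sup>2)"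
    using assms by (auto simp: sq_int_def)
  show ?thesis
  proof (rule Bochner_Integration.integrable_bound[OF i])
    have "\<bar>x * y\<bar> \<le> x\<^sup>2 + y\<^sup>2" for x y :: real
    proof -
      have "2 * (\<bar>x\<bar> * \<bar>y\<bar>) \<le> x\<^sup>2 + y\<^sup>2"
        using sum_squares_bound[of "\<bar>x\<bar>" "\<bar>y\<bar>"] by simp
      moreover have "0 \<le> \<bar>x\<bar> * \<bar>y\<bar>" by simp
      ultimately show ?thesis by (simp only: abs_mult)
    qed
    then show "AE \<omega> in M. norm (X \<omega> * Y \<omega>) \<le> norm ((X \<omega>)\<^sup>2 + (Y \<omega>)\<^sup>2)"
      by (auto simp: sum_power2_ge_zero)
  qed measurable
qed

lemma sq_int_abs: "sq_int M Z \<Longrightarrow> sq_int M (\<lambda>\<omega>. \<bar>Z \<omega>\<bar>)"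
  by (auto simp: sq_int_def)

lemma sq_int_add:
  assumes "sq_int M X" "sq_int M Y"
  shows "sq_int M (\<lambda>\<omega>. X \<omega> + Y \<omega>)"
  using assms sq_int_mult_integrable[OF assms]
  by (auto simp: sq_int_def power2_sum mult.assoc)

lemma sq_int_cmult:
  assumes "sq_int M X"
  shows "sq_int M (\<lambda>\<omega>. c * X \<omega>)"
  using assms by (auto simp: sq_int_def power_mult_distrib)

lemma sq_int_uminus: "sq_int M X \<Longrightarrow> sq_int M (\<lambda>\<omega>. - X \<omega>)"
  by (auto simp: sq_int_def)

lemma sq_int_diff:
  assumes "sq_int M X" "sq_int M Y"
  shows "sq_int M (\<lambda>\<omega>. X \<omega> - Y \<omega>)"
  using sq_int_add[OF assms(1) sq_int_uminus[OF assms(2)]] by simp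

lemma (in finite_measure) sq_int_const: "sq_int M (\<lambda>_. c)"
  by (simp add: sq_int_def)

lemma (in finite_measure) sq_int_integrable: "sq_int M X \<Longrightarrow> integrable M X"
  by (auto simp: sq_int_def intro: square_integrable_imp_integrable)

lemma (in finite_measure) sq_int_sum:
  "(\<And>i. i \<in> I \<Longrightarrow> sq_int M (X i)) \<Longrightarrow> sq_int M (\<lambda>\<omega>. \<Sum>i\<in>I. X i \<omega>)"
  by (induction I rule: infinite_finite_induct) (auto intro: sq_int_add sq_int_const)

lemma l2norm_cmult: "l2norm M (\<lambda>\<omega>. c * X \<omega>) = \<bar>c\<bar> * l2norm M X"
  by (simp add: l2norm_def power_mult_distrib real_sqrt_mult)

lemma l2norm_uminus [simp]: "l2norm M (\<lambda>\<omega>. - X \<omega>) = l2norm M X"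
  by (simp add: l2norm_def)

lemma l2norm_minus_commute: "l2norm M (\<lambda>\<omega>. X \<omega> - Y \<omega>) = l2norm M (\<lambda>\<omega>. Y \<omega> - X \<omega>)"
  by (simp add: l2norm_def power2_commute)

section \<open>The Cauchy-Schwarz and Minkowski inequalities\<close>

lemma l2norm_Cauchy_Schwarz:
  assumes "sq_int M X" "sq_int M Y"
  shows "\<bar>\<integral>\<omega>. X \<omega> * Y \<omega> \<partial>M\<bar> \<le> l2norm M X * l2norm M Y"
proof -
  define a b c where "a = (\<integral>\<omega>. (X \<omega>)\<^sup>2 \<partial>M)" and "b = (\<integral>\<omega>. X \<omega> * Y \<omega> \<partial>M)"
    and "c = (\<integral>\<omega>. (Y \<omega>)\<^sup>2 \<partial>M)"
  have iX: "integrable M (\<lambda>\<omega>. (X \<omega>)\<^sup>2)" and iY: "integrable M (\<lambda>\<omega>. (Y \<omega>)\<^sup>2)"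
    using assms by (auto simp: sq_int_def)
  have iXY: "integrable M (\<lambda>\<omega>. X \<omega> * Y \<omega>)" by (rule sq_int_mult_integrable[OF assms])
  have *: "0 \<le> s\<^sup>2 * a + 2 * s * t * b + t\<^sup>2 * c" for s t :: real
  proof -
    have "0 \<le> (\<integral>\<omega>. (s * X \<omega> + t * Y \<omega>)\<^sup>2 \<partial>M)" by simp
    also have "\<dots> = (\<integral>\<omega>. s\<^sup>2 * (X \<omega>)\<^sup>2 + (2 * s * t) * (X \<omega> * Y \<omega>) + t\<^sup>2 * (Y \<omega>)\<^sup>2 \<partial>M)"
      by (intro Bochner_Integration.integral_cong) (auto simp: power2_eq_square algebra_simps)
    also have "\<dots> = s\<^sup>2 * a + 2 * s * t * b + t\<^sup>2 * c"
      using iX iY iXY by (simp add: a_def b_def c_def)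
    finally show ?thesis .
  qed
  have a0: "0 \<le> a" and c0: "0 \<le> c" by (simp_all add: a_def c_def)
  have "b\<^sup>2 \<le> a * c"
  proof (cases "c = 0")
    case True
    have "b = 0"
    proof (rule ccontr)
      assume "b \<noteq> 0"
      \<comment> \<open>For c = 0 and s = 1 the form is affine in t; this t makes its linear term
        equal to -(a + 1).\<close>
      have "0 \<le> a - (a + 1)" using *[of 1 "- (a + 1) / (2 * b)"] True \<open>b \<noteq> 0\<close>
        by (simp add: field_simps)
      then show False by simp
    qed
    then show ?thesis using True by simp
  next
    case False
    with c0 have "c > 0" by simp
    \<comment> \<open>For s = c the form is minimal at t = -b, where its value is c (c a - b
      b).\<close>
    have "0 \<le> c * (c * a - b\<^sup>2)"
      using *[of c "- b"] by (simp add: power2_eq_square algebra_simps)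
    then show ?thesis using \<open>c > 0\<close> by (simp add: zero_le_mult_iff mult.commute)
  qed
  then have "sqrt (b\<^sup>2) \<le> sqrt (a * c)" by (rule real_sqrt_le_mono)
  then show ?thesis by (simp add: l2norm_def real_sqrt_mult a_def b_def c_def)
qed

lemma l2norm_triangle:
  assumes "sq_int M X" "sq_int M Y"
  shows "l2norm M (\<lambda>\<omega>. X \<omega> + Y \<omega>) \<le> l2norm M X + l2norm M Y"
proof (rule power2_le_imp_le)
  have iX: "integrable M (\<lambda>\<omega>. (X \<omega>)\<^sup>2)" and iY: "integrable M (\<lambda>\<omega>. (Y \<omega>)\<^sup>2)"
    using assms by (auto simp: sq_int_def)
  have iXY: "integrable M (\<lambda>\<omega>. X \<omega> * Y \<omega>)" by (rule sq_int_mult_integrable[OF assms])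
  have "(l2norm M (\<lambda>\<omega>. X \<omega> + Y \<omega>))\<^sup>2 = (\<integral>\<omega>. (X \<omega>)\<^sup>2 + 2 * (X \<omega> * Y \<omega>) + (Y \<omega>)\<^sup>2 \<partial>M)"
    unfolding l2norm_square
    by (intro Bochner_Integration.integral_cong) (auto simp: power2_eq_square algebra_simps)
  also have "\<dots> = (l2norm M X)\<^sup>2 + 2 * (\<integral>\<omega>. X \<omega> * Y \<omega> \<partial>M) + (l2norm M Y)\<^sup>2"
    using iX iY iXY by (simp add: l2norm_square)
  also have "\<dots> \<le> (l2norm M X + l2norm M Y)\<^sup>2"
    using l2norm_Cauchy_Schwarz[OF assms] by (simp add: power2_sum)
  finally show "(l2norm M (\<lambda>\<omega>. X \<omega> + Y \<omega>))\<^sup>2 \<le> (l2norm M X + l2norm M Y)\<^sup>2" .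
qed simp

lemma l2norm_triangle_diff:
  assumes "sq_int M X" "sq_int M Y"
  shows "l2norm M (\<lambda>\<omega>. X \<omega> - Y \<omega>) \<le> l2norm M X + l2norm M Y"
  using l2norm_triangle[OF assms(1) sq_int_uminus[OF assms(2)]] by simp

lemma l2norm_reverse_triangle:
  assumes "sq_int M X" "sq_int M Y"
  shows "\<bar>l2norm M X - l2norm M Y\<bar> \<le> l2norm M (\<lambda>\<omega>. X \<omega> - Y \<omega>)"
proof -
  have "l2norm M X \<le> l2norm M (\<lambda>\<omega>. X \<omega> - Y \<omega>) + l2norm M Y"
    using l2norm_triangle[OF sq_int_diff[OF assms] assms(2)] by simp
  moreover have "l2norm M Y \<le> l2norm M (\<lambda>\<omega>. X \<omega> - Y \<omega>) + l2norm M X"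
    using l2norm_triangle[OF sq_int_diff[OF assms(2,1)] assms(1)]
    by (simp add: l2norm_minus_commute[of M X Y])
  ultimately show ?thesis by simp
qed

lemma (in finite_measure) l2norm_sum:
  assumes "\<And>i. i \<in> I \<Longrightarrow> sq_int M (X i)"
  shows "l2norm M (\<lambda>\<omega>. \<Sum>i\<in>I. X i \<omega>) \<le> (\<Sum>i\<in>I. l2norm M (X i))"
  using assms
proof (induction I rule: infinite_finite_induct)
  case (insert i I)
  have "l2norm M (\<lambda>\<omega>. X i \<omega> + (\<Sum>i\<in>I. X i \<omega>)) \<le> l2norm M (X i) + l2norm M (\<lambda>\<omega>. \<Sum>i\<in>I. X i \<omega>)"
    using insert.prems by (intro l2norm_triangle sq_int_sum) auto
  then show ?case using insert by fastforce
qed (auto simp: l2norm_def)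

section \<open>Second moments and characteristic functions under a probability measure\<close>

context prob_space
begin

lemma l2norm_const: "l2norm M (\<lambda>_. c) = \<bar>c\<bar>"
  by (simp add: l2norm_def prob_space)

lemma abs_expectation_le_l2norm:
  assumes "sq_int M X" shows "\<bar>expectation X\<bar> \<le> l2norm M X"
  using l2norm_Cauchy_Schwarz[OF assms sq_int_const[of 1]] by (simp add: l2norm_def prob_space)

lemma expectation_abs_le_l2norm:
  assumes "sq_int M X" shows "expectation (\<lambda>\<omega>. \<bar>X \<omega>\<bar>) \<le> l2norm M X"
proof -
  have "sq_int M (\<lambda>\<omega>. \<bar>X \<omega>\<bar>)" using assms by (auto simp: sq_int_def)
  from abs_expectation_le_l2norm[OF this] show ?thesis by (simp add: l2norm_def)
qed

lemma l2norm_centered_square: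
  assumes "sq_int M X"
  shows "(l2norm M (\<lambda>\<omega>. X \<omega> - expectation X))\<^sup>2 = (l2norm M X)\<^sup>2 - (expectation X)\<^sup>2"
  using variance_eq[OF sq_int_integrable[OF assms] sq_int_integrable_square[OF assms]]
  by (simp add: l2norm_square)

lemma l2norm_centered_le:
  assumes "sq_int M X"
  shows "l2norm M (\<lambda>\<omega>. X \<omega> - expectation X) \<le> l2norm M X"
proof (rule power2_le_imp_le)
  show "(l2norm M (\<lambda>\<omega>. X \<omega> - expectation X))\<^sup>2 \<le> (l2norm M X)\<^sup>2"
    unfolding l2norm_centered_square[OF assms] by simp
qed simp

lemma prob_abs_ge_le_l2norm:
  assumes "sq_int M X" "c > 0"
  shows "prob {\<omega>\<in>space M. c \<le> \<bar>X \<omega>\<bar>} \<le> (l2norm M X)\<^sup>2 / c\<^sup>2"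
proof -
  have "prob {\<omega>\<in>space M. c\<^sup>2 \<le> (X \<omega>)\<^sup>2} \<le> (\<integral>\<omega>. (X \<omega>)\<^sup>2 \<partial>M) / c\<^sup>2"
    using assms by (intro integral_Markov_inequality_measure[where A="{}"]) (auto simp: sq_int_def)
  moreover have "{\<omega>\<in>space M. c\<^sup>2 \<le> (X \<omega>)\<^sup>2} = {\<omega>\<in>space M. c \<le> \<bar>X \<omega>\<bar>}"
    using assms(2) by (auto simp: abs_le_square_iff[of c, symmetric])
  ultimately show ?thesis by (simp add: l2norm_square)
qed

text \<open>The map from x to \<open>iexp (t * x)\<close> is Lipschitz with constant |t|, and the L1
  norm is at most the L2 norm. This carries L2 approximations over to characteristic functions, with
  an error that does not depend on the laws.\<close>

lemma char_distr_diff_le: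
  assumes "sq_int M X" "sq_int M Y"
  shows "cmod (char (distr M borel X) t - char (distr M borel Y) t) \<le> \<bar>t\<bar> * l2norm M (\<lambda>\<omega>. X \<omega> - Y \<omega>)"
proof -
  have [measurable]: "X \<in> borel_measurable M" "Y \<in> borel_measurable M"
    using assms by (auto simp: sq_int_def)
  have int: "integrable M (\<lambda>\<omega>. iexp (t * X \<omega>))" "integrable M (\<lambda>\<omega>. iexp (t * Y \<omega>))"
    by (auto intro!: integrable_const_bound[where B=1])
  have "char (distr M borel X) t - char (distr M borel Y) t
      = (CLINT \<omega>|M. iexp (t * X \<omega>) - iexp (t * Y \<omega>))"
    using int by (simp add: char_def integral_distr)
  also have "cmod \<dots> \<le> (\<integral>\<omega>. cmod (iexp (t * X \<omega>) - iexp (t * Y \<omega>)) \<partial>M)"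
    by (rule integral_norm_bound)
  also have "\<dots> \<le> (\<integral>\<omega>. \<bar>t\<bar> * \<bar>X \<omega> - Y \<omega>\<bar> \<partial>M)"
  proof (rule integral_mono)
    fix \<omega>
    have "cmod (iexp (t * X \<omega>) - iexp (t * Y \<omega>))
       = cmod (iexp (t * Y \<omega>) * (iexp (t * X \<omega> - t * Y \<omega>) - 1))"
      by (simp add: algebra_simps exp_add[symmetric])
    also have "\<dots> \<le> \<bar>t * X \<omega> - t * Y \<omega>\<bar>"
      using iexp_approx1[of "t * X \<omega> - t * Y \<omega>" 0] by (simp add: norm_mult)
    finally show "cmod (iexp (t * X \<omega>) - iexp (t * Y \<omega>)) \<le> \<bar>t\<bar> * \<bar>X \<omega> - Y \<omega>\<bar>"
      by (simp add: abs_mult[symmetric] right_diff_distrib)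
  next
    show "integrable M (\<lambda>\<omega>. \<bar>t\<bar> * \<bar>X \<omega> - Y \<omega>\<bar>)"
      using sq_int_integrable[OF sq_int_diff[OF assms]] by simp
  qed (use int in auto)
  also have "\<dots> \<le> \<bar>t\<bar> * l2norm M (\<lambda>\<omega>. X \<omega> - Y \<omega>)"
    using expectation_abs_le_l2norm[OF sq_int_diff[OF assms]]
    by (simp add: mult_left_mono)
  finally show ?thesis .
qed

end

section \<open>Real sequences\<close>

text \<open>Splitting k n into k pieces costs at most k K, so \<open>e (k * n) / (k * n)\<close> and
  \<open>e n / n\<close> differ by at most K / n. Hence the quotients are Cauchy, and letting k grow
  keeps the same bound for their limit. The point is the error K, uniform in n: a mean can be
  replaced by a linear function at a cost that is negligible against the square root of n.\<close>

lemma quasi_additive_limit: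
  fixes e :: "nat \<Rightarrow> real"
  assumes qa: "\<And>m n. \<bar>e m + e n - e (m + n)\<bar> \<le> K"
  obtains \<mu> where "\<And>n. \<bar>e n - real n * \<mu>\<bar> \<le> K"
proof -
  have K0: "K \<ge> 0" using qa[of 0 0] by linarith
  have mult: "\<bar>e (Suc k * n) - real (Suc k) * e n\<bar> \<le> real k * K" for k n
  proof (induction k)
    case (Suc k)
    have "\<bar>e (Suc (Suc k) * n) - real (Suc (Suc k)) * e n\<bar>
        \<le> \<bar>e (Suc k * n) - real (Suc k) * e n\<bar> + \<bar>e n + e (Suc k * n) - e (n + Suc k * n)\<bar>"
      by (simp add: algebra_simps)
    then show ?case using Suc qa[of n "Suc k * n"] by (simp add: algebra_simps)
  qed simp
  have mult': "\<bar>e (k * n) - real k * e n\<bar> \<le> real k * K" if "k \<ge> 1" for k n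
  proof -
    obtain j where k: "k = Suc j" using \<open>k \<ge> 1\<close> by (cases k) auto
    have "real j * K \<le> real k * K" using K0 k by (intro mult_right_mono) auto
    then show ?thesis using mult[of j n] k by simp
  qed
  define f where "f n = e n / real n" for n
  have f: "\<bar>f (k * n) - f n\<bar> \<le> K / real n" if "k \<ge> 1" "n \<ge> 1" for k n
  proof -
    have "f (k * n) - f n = (e (k * n) - real k * e n) / (real k * real n)"
      using that by (simp add: f_def field_simps)
    then have "\<bar>f (k * n) - f n\<bar> = \<bar>e (k * n) - real k * e n\<bar> / (real k * real n)"
      by (simp add: abs_divide)
    also have "\<dots> \<le> (real k * K) / (real k * real n)"
      by (intro divide_right_mono mult' that) simp
    finally show ?thesis using that by simp
  qed
  \<comment> \<open>Both quotients are compared with the one at \<open>m * n\<close>.\<close>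
  have f2: "\<bar>f m - f n\<bar> \<le> K / real m + K / real n" if "m \<ge> 1" "n \<ge> 1" for m n
    using f[of n m] f[of m n] that by (simp add: mult.commute)
  have lim0: "(\<lambda>n. K / real n) \<longlonglongrightarrow> 0" by (rule lim_const_over_n)
  have "Cauchy f"
  proof (rule CauchyI)
    fix \<epsilon> :: real assume "\<epsilon> > 0"
    then obtain n0 where n0: "\<And>n. n \<ge> n0 \<Longrightarrow> \<bar>K / real n\<bar> < \<epsilon> / 2"
      using LIMSEQ_D[OF lim0, of "\<epsilon> / 2"] by auto
    show "\<exists>M. \<forall>m\<ge>M. \<forall>n\<ge>M. norm (f m - f n) < \<epsilon>"
    proof (intro exI[of _ "max 1 n0"] allI impI)
      fix m n assume "max 1 n0 \<le> m" "max 1 n0 \<le> n"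
      then have "\<bar>f m - f n\<bar> \<le> K / real m + K / real n" "\<bar>K / real m\<bar> < \<epsilon> / 2" "\<bar>K / real n\<bar> < \<epsilon> / 2"
        using f2[of m n] n0[of m] n0[of n] by simp_all
      then show "norm (f m - f n) < \<epsilon>" unfolding real_norm_def by linarith
    qed
  qed
  then obtain \<mu> where \<mu>: "f \<longlonglongrightarrow> \<mu>" using Cauchy_convergent_iff convergent_def by blast
  have "\<bar>e n - real n * \<mu>\<bar> \<le> K" for n
  proof (cases "n = 0")
    case True
    then show ?thesis using qa[of 0 0] by simp
  next
    case False
    have "(\<lambda>m. \<bar>f m - f n\<bar>) \<longlonglongrightarrow> \<bar>\<mu> - f n\<bar>" by (intro tendsto_intros \<mu>)
    moreover have "(\<lambda>m. K / real m + K / real n) \<longlonglongrightarrow> 0 + K / real n"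
      by (intro tendsto_intros lim0)
    ultimately have "\<bar>\<mu> - f n\<bar> \<le> 0 + K / real n"
      using f2[of _ n] False by (intro LIMSEQ_le) (auto intro!: exI[of _ 1])
    then have "real n * \<bar>\<mu> - f n\<bar> \<le> K" using False by (simp add: field_simps)
    moreover have "real n * \<bar>\<mu> - f n\<bar> = \<bar>real n * (\<mu> - f n)\<bar>" by (simp add: abs_mult)
    moreover have "real n * (\<mu> - f n) = real n * \<mu> - e n" using False by (simp add: f_def algebra_simps)
    ultimately show ?thesis by simp
  qed
  then show ?thesis by (rule that)
qed

text \<open>Any two late values of \<open>v\<close> are close to the same \<open>g m\<close>, so
  \<open>v\<close> is Cauchy although nothing is known about \<open>g\<close> in advance; the
  convergence of \<open>g\<close> is then a consequence. It will be applied to the L2 norms of the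
  normalised process and to the normalised standard deviations of blocks of length m.\<close>

lemma approximate_limit:
  fixes v g c :: "nat \<Rightarrow> real"
  assumes approx: "\<And>m \<epsilon>. m \<ge> 1 \<Longrightarrow> \<epsilon> > 0 \<Longrightarrow> \<forall>\<^sub>F n in sequentially. \<bar>v n - g m\<bar> \<le> c m + \<epsilon>"
    and c: "c \<longlonglongrightarrow> 0"
  obtains \<sigma> where "v \<longlonglongrightarrow> \<sigma>" "g \<longlonglongrightarrow> \<sigma>"
proof -
  have "Cauchy v"
  proof (rule CauchyI)
    fix \<epsilon> :: real assume \<epsilon>: "\<epsilon> > 0"
    obtain m0 where "\<And>m. m \<ge> m0 \<Longrightarrow> \<bar>c m\<bar> < \<epsilon> / 8"
      using LIMSEQ_D[OF c, of "\<epsilon> / 8"] \<epsilon> by auto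
    then have cm: "\<bar>c (max 1 m0)\<bar> < \<epsilon> / 8" by simp
    obtain n0 where n0: "\<And>n. n \<ge> n0 \<Longrightarrow> \<bar>v n - g (max 1 m0)\<bar> \<le> c (max 1 m0) + \<epsilon> / 8"
      using approx[of "max 1 m0" "\<epsilon> / 8"] \<epsilon> by (auto simp: eventually_sequentially)
    show "\<exists>M. \<forall>m\<ge>M. \<forall>n\<ge>M. norm (v m - v n) < \<epsilon>"
    proof (intro exI[of _ n0] allI impI)
      fix m n assume "n0 \<le> m" "n0 \<le> n"
      then show "norm (v m - v n) < \<epsilon>" using n0[of m] n0[of n] cm \<epsilon>
        unfolding real_norm_def by linarith
    qed
  qed
  then obtain \<sigma> where \<sigma>: "v \<longlonglongrightarrow> \<sigma>" using Cauchy_convergent_iff convergent_def by blast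
  have "\<bar>\<sigma> - g m\<bar> \<le> c m" if "m \<ge> 1" for m
  proof (rule field_le_epsilon)
    fix \<epsilon> :: real assume "\<epsilon> > 0"
    have "(\<lambda>n. \<bar>v n - g m\<bar>) \<longlonglongrightarrow> \<bar>\<sigma> - g m\<bar>" by (intro tendsto_intros \<sigma>)
    then show "\<bar>\<sigma> - g m\<bar> \<le> c m + \<epsilon>"
      by (rule tendsto_upperbound) (use approx[OF \<open>m \<ge> 1\<close> \<open>\<epsilon> > 0\<close>] in auto)
  qed
  then have "\<forall>\<^sub>F m in sequentially. norm (g m - \<sigma>) \<le> c m"
    by (auto simp: eventually_sequentially abs_minus_commute intro!: exI[of _ 1])
  then have "(\<lambda>m. g m - \<sigma>) \<longlonglongrightarrow> 0" by (rule Lim_null_comparison[OF _ c])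
  then have "g \<longlonglongrightarrow> \<sigma>" by (rule LIM_zero_cancel)
  with \<sigma> show ?thesis by (rule that)
qed

section \<open>Functions of finitely many terms of an independent sequence\<close>

text \<open>The double sum is arranged by rows: a bound on one row that is uniform in j gives a
  bound linear in k.\<close>

lemma (in prob_space) l2norm_sum_square:
  fixes X :: "nat \<Rightarrow> 'a \<Rightarrow> real"
  assumes "\<And>i. i < k \<Longrightarrow> sq_int M (X i)"
  shows "(l2norm M (\<lambda>\<omega>. \<Sum>i<k. X i \<omega>))\<^sup>2
    = (\<Sum>j<k. (l2norm M (X j))\<^sup>2 + 2 * (\<Sum>i<j. expectation (\<lambda>\<omega>. X i \<omega> * X j \<omega>)))"
  using assms
proof (induction k)
  case (Suc k)
  let ?Z = "\<lambda>\<omega>. \<Sum>i<k. X i \<omega>"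
  have Z: "sq_int M ?Z" by (rule sq_int_sum) (use Suc.prems in auto)
  have X: "sq_int M (X k)" using Suc.prems by simp
  have "(l2norm M (\<lambda>\<omega>. \<Sum>i<Suc k. X i \<omega>))\<^sup>2 = (\<integral>\<omega>. (?Z \<omega>)\<^sup>2 + (X k \<omega>)\<^sup>2 + 2 * (?Z \<omega> * X k \<omega>) \<partial>M)"
    unfolding l2norm_square
    by (intro Bochner_Integration.integral_cong) (auto simp: power2_sum mult.assoc)
  also have "\<dots> = (l2norm M ?Z)\<^sup>2 + (l2norm M (X k))\<^sup>2 + 2 * (\<integral>\<omega>. ?Z \<omega> * X k \<omega> \<partial>M)"
    using sq_int_mult_integrable[OF Z X] Z X by (simp add: l2norm_square sq_int_def)
  also have "(\<integral>\<omega>. ?Z \<omega> * X k \<omega> \<partial>M) = (\<Sum>i<k. expectation (\<lambda>\<omega>. X i \<omega> * X k \<omega>))"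
    unfolding sum_distrib_right
    by (rule Bochner_Integration.integral_sum) (use Suc.prems in \<open>auto intro: sq_int_mult_integrable\<close>)
  finally show ?case using Suc by simp
qed (simp add: l2norm_def)

locale indep_seq = prob_space M for M :: "'a measure" +
  fixes N :: "'b measure" and Y :: "nat \<Rightarrow> 'a \<Rightarrow> 'b"
  assumes indep_Y: "indep_vars (\<lambda>_. N) Y UNIV"
begin

text \<open>The sigma-algebra generated by the \<open>Y k\<close> with k in K. As a pullback of the
  product sigma-algebra it consists of preimages of measurable sets of tuples, which is the form in
  which independence of disjoint groups is available.\<close>

definition sig :: "nat set \<Rightarrow> 'a measure" where
  "sig K = vimage_algebra (space M) (\<lambda>\<omega>. \<lambda>k\<in>K. Y k \<omega>) (PiM K (\<lambda>_. N))"

lemma measurable_Y: "Y k \<in> measurable M N"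
  using indep_Y by (auto simp: indep_vars_def2)

lemma restrict_Y_measurable: "(\<lambda>\<omega>. \<lambda>k\<in>K. Y k \<omega>) \<in> measurable M (PiM K (\<lambda>_. N))"
  by (intro measurable_restrict measurable_Y)

lemma space_sig [simp]: "space (sig K) = space M"
  by (simp add: sig_def)

lemma sets_sig: "sets (sig K) = {(\<lambda>\<omega>. \<lambda>k\<in>K. Y k \<omega>) -` B \<inter> space M | B. B \<in> sets (PiM K (\<lambda>_. N))}"
  unfolding sig_def
  by (rule sets_vimage_algebra2) (use measurable_space[OF restrict_Y_measurable] in auto)

lemma measurable_sig_Y: "k \<in> K \<Longrightarrow> Y k \<in> measurable (sig K) N"
proof -
  assume k: "k \<in> K"
  have "(\<lambda>\<omega>. \<lambda>k\<in>K. Y k \<omega>) \<in> measurable (sig K) (PiM K (\<lambda>_. N))"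
    unfolding sig_def
    by (rule measurable_vimage_algebra1) (use measurable_space[OF restrict_Y_measurable] in auto)
  from measurable_compose[OF this measurable_component_singleton[OF k]]
  show ?thesis using k by simp
qed

lemma measurable_sigI:
  assumes "X \<in> measurable (sig K) L" shows "X \<in> measurable M L"
proof (rule measurableI)
  show "X \<omega> \<in> space L" if "\<omega> \<in> space M" for \<omega>
    using measurable_space[OF assms] that by simp
  fix B assume "B \<in> sets L"
  from measurable_sets[OF assms this] show "X -` B \<inter> space M \<in> sets M"
    unfolding sets_sig using measurable_sets[OF restrict_Y_measurable] by auto
qed

lemma measurable_sig_mono:
  assumes "X \<in> measurable (sig K) L" "K \<subseteq> K'" shows "X \<in> measurable (sig K') L"
proof (rule measurableI)
  show "X \<omega> \<in> space L" if "\<omega> \<in> space (sig K')" for \<omega>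
    using measurable_space[OF assms(1)] that by simp
  fix B assume "B \<in> sets L"
  from measurable_sets[OF assms(1) this] obtain E where E: "E \<in> sets (PiM K (\<lambda>_. N))"
    and eq: "X -` B \<inter> space M = (\<lambda>\<omega>. \<lambda>k\<in>K. Y k \<omega>) -` E \<inter> space M"
    unfolding sets_sig by auto
  have "(\<lambda>\<omega>. \<lambda>k\<in>K. Y k \<omega>) \<in> measurable (sig K') (PiM K (\<lambda>_. N))"
    by (intro measurable_restrict measurable_sig_Y) (use assms(2) in auto)
  from measurable_sets[OF this E] show "X -` B \<inter> space (sig K') \<in> sets (sig K')"
    by (simp add: eq)
qed

text \<open>Tuples of the \<open>Y k\<close> over disjoint index sets are independent, and every
  event of \<open>X j\<close> belongs to the sigma-algebra of its own tuple.\<close>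

lemma indep_vars_sig:
  assumes X: "\<And>j. j \<in> J \<Longrightarrow> X j \<in> measurable (sig (K j)) (L j)" and "disjoint_family_on K J"
  shows "indep_vars L X J"
proof -
  have "indep_vars (\<lambda>j. PiM (K j) (\<lambda>_. N)) (\<lambda>j \<omega>. \<lambda>k\<in>K j. Y k \<omega>) J"
    using indep_vars_restrict[OF indep_Y _ assms(2)] by simp
  then have "indep_sets (\<lambda>j. sets (sig (K j))) J"
    by (simp add: indep_vars_def2 sets_sig)
  then have "indep_sets (\<lambda>j. {X j -` B \<inter> space M | B. B \<in> sets (L j)}) J"
    by (rule indep_sets_mono_sets) (use measurable_sets[OF X] in auto)
  then show ?thesis using measurable_sigI[OF X] by (auto simp: indep_vars_def2)
qed

lemma expectation_mult_sig:
  fixes X Z :: "'a \<Rightarrow> real"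
  assumes "X \<in> borel_measurable (sig K)" "Z \<in> borel_measurable (sig L)" "K \<inter> L = {}"
    and "integrable M X" "integrable M Z"
  shows "expectation (\<lambda>\<omega>. X \<omega> * Z \<omega>) = expectation X * expectation Z"
proof -
  have "indep_vars (case_bool borel borel) (case_bool X Z) UNIV"
  proof (rule indep_vars_sig[where K = "case_bool K L"])
    show "disjoint_family_on (case_bool K L) UNIV"
      using assms(3) by (auto simp: disjoint_family_on_def split: bool.splits)
  qed (use assms in \<open>auto split: bool.splits\<close>)
  then have "indep_var borel X borel Z" by (simp add: indep_var_def)
  then show ?thesis using assms by (intro indep_var_lebesgue_integral) auto
qed

end

section \<open>A central limit theorem for almost additive processes\<close>

lemma char_distr_cmult:
  assumes "X \<in> borel_measurable M"
  shows "char (distr M borel (\<lambda>\<omega>. c * X \<omega>)) t = char (distr M borel X) (c * t)"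
  using assms by (simp add: char_def integral_distr mult_ac)

text \<open>Nothing of the (max,+) structure is kept. The interval {s..<t} in \<open>S_sig\<close>
  makes blocks over disjoint intervals independent, so stationarity is required only of the law of
  each single \<open>S s t\<close>. In \<open>defect_decay\<close> the summand \<open>S t u\<close>
  is kept on both sides to display a difference of two defects with the same t and u and different
  starts.\<close>

locale almost_additive = indep_seq M N Y
  for M :: "'a measure" and N :: "'b measure" and Y :: "nat \<Rightarrow> 'a \<Rightarrow> 'b" +
  fixes S :: "nat \<Rightarrow> nat \<Rightarrow> 'a \<Rightarrow> real" and C \<rho> :: real
  assumes S_sig: "s \<le> t \<Longrightarrow> S s t \<in> borel_measurable (sig {s..<t})"
    and S_refl: "S s s = (\<lambda>_. 0)"
    and S_sq: "s \<le> t \<Longrightarrow> sq_int M (S s t)"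
    and S_distr: "s \<le> t \<Longrightarrow> distr M borel (S s t) = distr M borel (S 0 (t - s))"
    and defect_bound: "s \<le> t \<Longrightarrow> t \<le> u \<Longrightarrow> l2norm M (\<lambda>\<omega>. S s t \<omega> + S t u \<omega> - S s u \<omega>) \<le> C"
    and defect_decay: "s \<le> s' \<Longrightarrow> s' \<le> t \<Longrightarrow> t \<le> u \<Longrightarrow>
      l2norm M (\<lambda>\<omega>. (S s t \<omega> + S t u \<omega> - S s u \<omega>) - (S s' t \<omega> + S t u \<omega> - S s' u \<omega>)) \<le> C * \<rho> ^ (t - s')"
    and \<rho>: "0 \<le> \<rho>" "\<rho> < 1"
begin

section \<open>Means and covariances of the defects\<close>

definition D :: "nat \<Rightarrow> nat \<Rightarrow> nat \<Rightarrow> 'a \<Rightarrow> real" where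
  "D s t u \<omega> = S s t \<omega> + S t u \<omega> - S s u \<omega>"

definition cD :: "nat \<Rightarrow> nat \<Rightarrow> nat \<Rightarrow> 'a \<Rightarrow> real" where
  "cD s t u \<omega> = D s t u \<omega> - expectation (D s t u)"

definition e :: "nat \<Rightarrow> real" where "e n = expectation (S 0 n)"

definition sd :: "nat \<Rightarrow> real" where "sd n = l2norm M (\<lambda>\<omega>. S 0 n \<omega> - e n)"

lemma C_nonneg: "0 \<le> C"
  using defect_bound[of 0 0 0] l2norm_nonneg order_trans by blast

lemma D_sq: "s \<le> t \<Longrightarrow> t \<le> u \<Longrightarrow> sq_int M (D s t u)"
  unfolding D_def[abs_def] by (intro sq_int_add sq_int_diff S_sq) auto

lemma D_sig: "s \<le> t \<Longrightarrow> t \<le> u \<Longrightarrow> D s t u \<in> borel_measurable (sig {s..<u})"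
  unfolding D_def[abs_def]
  by (intro borel_measurable_add borel_measurable_diff; rule measurable_sig_mono[OF S_sig]) auto

lemma cD_sq: "s \<le> t \<Longrightarrow> t \<le> u \<Longrightarrow> sq_int M (cD s t u)"
  unfolding cD_def[abs_def] by (intro sq_int_diff D_sq sq_int_const)

lemma cD_sig: "s \<le> t \<Longrightarrow> t \<le> u \<Longrightarrow> cD s t u \<in> borel_measurable (sig {s..<u})"
  unfolding cD_def[abs_def] by (intro borel_measurable_diff D_sig) auto

lemma l2norm_cD: "s \<le> t \<Longrightarrow> t \<le> u \<Longrightarrow> l2norm M (cD s t u) \<le> C"
  using l2norm_centered_le[OF D_sq, of s t u] defect_bound[of s t u]
  unfolding cD_def[abs_def] D_def[abs_def] by linarith

lemma expectation_cD: "s \<le> t \<Longrightarrow> t \<le> u \<Longrightarrow> expectation (cD s t u) = 0"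
  unfolding cD_def[abs_def] using sq_int_integrable[OF D_sq, of s t u] by (simp add: prob_space)

lemma expectation_S: "s \<le> t \<Longrightarrow> expectation (S s t) = e (t - s)"
proof -
  assume st: "s \<le> t"
  have "expectation (S s t) = (\<integral>x. x \<partial>distr M borel (S s t))"
    using S_sq[OF st] by (intro integral_distr[symmetric]) (auto simp: sq_int_def)
  also have "\<dots> = (\<integral>x. x \<partial>distr M borel (S 0 (t - s)))" using S_distr[OF st] by simp
  also have "\<dots> = e (t - s)" unfolding e_def
    using S_sq[of 0 "t - s"] by (intro integral_distr) (auto simp: sq_int_def)
  finally show ?thesis .
qed

lemma l2norm_S_diff:
  assumes "s \<le> t" shows "l2norm M (\<lambda>\<omega>. S s t \<omega> - c) = l2norm M (\<lambda>\<omega>. S 0 (t - s) \<omega> - c)"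
proof -
  have "(\<integral>\<omega>. (S s t \<omega> - c)\<^sup>2 \<partial>M) = (\<integral>x. (x - c)\<^sup>2 \<partial>distr M borel (S s t))"
    using S_sq[OF assms] by (intro integral_distr[symmetric]) (auto simp: sq_int_def)
  also have "\<dots> = (\<integral>x. (x - c)\<^sup>2 \<partial>distr M borel (S 0 (t - s)))" using S_distr[OF assms] by simp
  also have "\<dots> = (\<integral>\<omega>. (S 0 (t - s) \<omega> - c)\<^sup>2 \<partial>M)"
    using S_sq[of 0 "t - s"] by (intro integral_distr) (auto simp: sq_int_def)
  finally show ?thesis by (simp add: l2norm_def)
qed

lemma e_quasi_additive: "\<bar>e m + e n - e (m + n)\<bar> \<le> C"
proof -
  have "expectation (D 0 m (m + n)) = e m + e n - e (m + n)"
    unfolding D_def[abs_def]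
    using sq_int_integrable[OF S_sq] expectation_S[of m "m + n"] by (simp add: e_def)
  then show ?thesis
    using abs_expectation_le_l2norm[OF D_sq, of 0 m "m + n"] defect_bound[of 0 m "m + n"]
    unfolding D_def[abs_def] by simp
qed

text \<open>Replacing the start \<open>0\<close> of the later defect by the end of the earlier one makes the two
  independent at an exponentially small cost.\<close>

lemma covariance_defects:
  assumes "i < j" "m \<ge> 1"
  shows "\<bar>expectation (\<lambda>\<omega>. cD 0 (i * m) (i * m + m) \<omega> * cD 0 (j * m) (j * m + m) \<omega>)\<bar>
    \<le> C\<^sup>2 * \<rho> ^ (j - i - 1)"
proof -
  define p where "p = i * m + m"
  have p: "p \<le> j * m" "j * m - p = (j - i - 1) * m"
  proof -
    obtain d where "j = Suc i + d" using \<open>i < j\<close> by (metis Suc_leI le_iff_add)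
    then show "p \<le> j * m" "j * m - p = (j - i - 1) * m" by (simp_all add: p_def algebra_simps)
  qed
  define X where "X = cD 0 (i * m) p"
  define Z where "Z = D 0 (j * m) (j * m + m)"
  define Z' where "Z' = D p (j * m) (j * m + m)"
  have X: "sq_int M X" "X \<in> borel_measurable (sig {0..<p})" "l2norm M X \<le> C" "expectation X = 0"
    unfolding X_def p_def by (auto intro: cD_sq cD_sig l2norm_cD expectation_cD)
  have Z: "sq_int M Z" unfolding Z_def by (rule D_sq) auto
  have Z': "sq_int M Z'" "Z' \<in> borel_measurable (sig {p..<j * m + m})"
    unfolding Z'_def using p by (auto intro: D_sq D_sig)
  have "expectation (\<lambda>\<omega>. X \<omega> * Z' \<omega>) = expectation X * expectation Z'"
    by (rule expectation_mult_sig[OF X(2) Z'(2)]) (auto intro: sq_int_integrable X Z')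
  then have 0: "expectation (\<lambda>\<omega>. X \<omega> * Z' \<omega>) = 0" using X by simp
  \<comment> \<open>Since \<open>X\<close> has mean zero, the centering of \<open>Z\<close> is
    invisible, and \<open>Z'\<close> can be subtracted because it is uncorrelated with
    \<open>X\<close>.\<close>
  have "expectation (\<lambda>\<omega>. X \<omega> * (Z \<omega> - expectation Z)) = expectation (\<lambda>\<omega>. X \<omega> * Z \<omega>)"
    using sq_int_mult_integrable[OF X(1) Z] sq_int_integrable[OF X(1)] X(4)
    by (simp add: right_diff_distrib)
  also have "\<dots> = expectation (\<lambda>\<omega>. X \<omega> * (Z \<omega> - Z' \<omega>))"
    using sq_int_mult_integrable[OF X(1) Z] sq_int_mult_integrable[OF X(1) Z'(1)] 0
    by (simp add: right_diff_distrib)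
  finally have "\<bar>expectation (\<lambda>\<omega>. X \<omega> * (Z \<omega> - expectation Z))\<bar>
      \<le> l2norm M X * l2norm M (\<lambda>\<omega>. Z \<omega> - Z' \<omega>)"
    using l2norm_Cauchy_Schwarz[OF X(1) sq_int_diff[OF Z Z'(1)]] by simp
  also have "\<dots> \<le> C * (C * \<rho> ^ (j - i - 1))"
  proof (rule mult_mono)
    have "l2norm M (\<lambda>\<omega>. Z \<omega> - Z' \<omega>) \<le> C * \<rho> ^ (j * m - p)"
      unfolding Z_def Z'_def D_def using defect_decay[of 0 p "j * m" "j * m + m"] p by simp
    \<comment> \<open>The factor m in the exponent is given up to obtain a bound uniform in
      m.\<close>
    also have "\<rho> ^ (j * m - p) \<le> \<rho> ^ (j - i - 1)"
      unfolding p(2) using \<rho> \<open>m \<ge> 1\<close> by (intro power_decreasing) auto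
    finally show "l2norm M (\<lambda>\<omega>. Z \<omega> - Z' \<omega>) \<le> C * \<rho> ^ (j - i - 1)"
      using C_nonneg by (simp add: mult_left_mono)
  qed (use X C_nonneg in auto)
  finally show ?thesis
    by (simp add: X_def Z_def p_def cD_def[abs_def] power2_eq_square)
qed

text \<open>The square of C for the diagonal term of a row of covariances, plus twice a geometric
  series for the terms to its left.\<close>

definition C1 :: real where "C1 = C\<^sup>2 * (1 + 2 / (1 - \<rho>))"

lemma C1_nonneg: "0 \<le> C1"
  using \<rho> by (simp add: C1_def)

text \<open>Each row of the covariance matrix is dominated by the same geometric series for every m.
  Hence k defects contribute only the order of the square root of k, against the square root of k m
  by which the sum is finally divided; this is where long blocks gain.\<close>

lemma l2norm_sum_defects:
  assumes "m \<ge> 1"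
  shows "l2norm M (\<lambda>\<omega>. \<Sum>i<k. cD 0 (i * m) (i * m + m) \<omega>) \<le> sqrt (real k * C1)"
proof (rule real_le_rsqrt)
  let ?X = "\<lambda>i. cD 0 (i * m) (i * m + m)"
  have geo: "(\<Sum>i<j. \<rho> ^ (j - i - 1)) \<le> 1 / (1 - \<rho>)" for j
  proof -
    have "(\<Sum>i<j. \<rho> ^ (j - i - 1)) = (\<Sum>i<j. \<rho> ^ i)"
      by (rule sum.reindex_bij_witness[of _ "\<lambda>i. j - i - 1" "\<lambda>i. j - i - 1"]) auto
    also have "\<dots> = (1 - \<rho> ^ j) / (1 - \<rho>)" using \<rho> by (simp add: sum_gp_strict)
    also have "\<dots> \<le> 1 / (1 - \<rho>)" using \<rho> by (intro divide_right_mono) auto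
    finally show ?thesis .
  qed
  have "(l2norm M (\<lambda>\<omega>. \<Sum>i<k. ?X i \<omega>))\<^sup>2
      = (\<Sum>j<k. (l2norm M (?X j))\<^sup>2 + 2 * (\<Sum>i<j. expectation (\<lambda>\<omega>. ?X i \<omega> * ?X j \<omega>)))"
    by (rule l2norm_sum_square) (auto intro: cD_sq)
  also have "\<dots> \<le> (\<Sum>j<k. C1)"
  proof (rule sum_mono)
    fix j
    have "(\<Sum>i<j. expectation (\<lambda>\<omega>. ?X i \<omega> * ?X j \<omega>)) \<le> (\<Sum>i<j. C\<^sup>2 * \<rho> ^ (j - i - 1))"
      using covariance_defects[OF _ assms] by (intro sum_mono) (auto dest: abs_le_D1)
    also have "\<dots> \<le> C\<^sup>2 * (1 / (1 - \<rho>))"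
      unfolding sum_distrib_left[symmetric] by (intro mult_left_mono geo) auto
    finally have "2 * (\<Sum>i<j. expectation (\<lambda>\<omega>. ?X i \<omega> * ?X j \<omega>)) \<le> 2 * (C\<^sup>2 * (1 / (1 - \<rho>)))" by linarith
    moreover have "(l2norm M (?X j))\<^sup>2 \<le> C\<^sup>2" by (intro power_mono l2norm_cD) auto
    moreover have "C1 = C\<^sup>2 + 2 * (C\<^sup>2 * (1 / (1 - \<rho>)))" by (simp add: C1_def distrib_left)
    ultimately show "(l2norm M (?X j))\<^sup>2 + 2 * (\<Sum>i<j. expectation (\<lambda>\<omega>. ?X i \<omega> * ?X j \<omega>)) \<le> C1"
      by linarith
  qed
  finally show "(l2norm M (\<lambda>\<omega>. \<Sum>i<k. ?X i \<omega>))\<^sup>2 \<le> real k * C1" by simp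
qed

section \<open>Sums of independent blocks and comparison with the process\<close>

definition T :: "nat \<Rightarrow> nat \<Rightarrow> 'a \<Rightarrow> real" where
  "T m k \<omega> = (\<Sum>i<k. S (i * m) (i * m + m) \<omega> - e m)"

lemma block_sq: "sq_int M (\<lambda>\<omega>. S (i * m) (i * m + m) \<omega> - e m)"
  by (intro sq_int_diff S_sq sq_int_const) auto

lemma T_sq: "sq_int M (T m k)"
  unfolding T_def[abs_def] by (intro sq_int_sum block_sq)

lemma block_l2norm: "l2norm M (\<lambda>\<omega>. S (i * m) (i * m + m) \<omega> - e m) = sd m"
  using l2norm_S_diff[of "i * m" "i * m + m" "e m"] by (simp add: sd_def)

lemma block_expectation: "expectation (\<lambda>\<omega>. S (i * m) (i * m + m) \<omega> - e m) = 0"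
  using sq_int_integrable[OF S_sq] expectation_S[of "i * m" "i * m + m"] by (simp add: prob_space)

lemma block_sig: "(\<lambda>\<omega>. S (i * m) (i * m + m) \<omega> - e m) \<in> borel_measurable (sig {i * m..<i * m + m})"
  by (intro borel_measurable_diff S_sig) auto

lemma blocks_disjoint: "disjoint_family (\<lambda>i. {i * m..<i * m + (m::nat)})"
  unfolding disjoint_family_on_def
proof (intro ballI impI)
  have *: "{i * m..<i * m + m} \<inter> {j * m..<j * m + m} = {}" if "i < j" for i j
  proof -
    have "Suc i * m \<le> j * m" using that by (intro mult_le_mono1) simp
    then show ?thesis by auto
  qed
  fix i j :: nat assume "i \<noteq> j"
  then show "{i * m..<i * m + m} \<inter> {j * m..<j * m + m} = {}"
    using *[of i j] *[of j i] by (cases "i < j") auto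
qed

text \<open>Independent centered blocks are orthogonal, so this is Pythagoras.\<close>

lemma T_l2norm: "l2norm M (T m k) = sqrt (real k) * sd m"
proof -
  let ?X = "\<lambda>i \<omega>. S (i * m) (i * m + m) \<omega> - e m"
  have orth: "expectation (\<lambda>\<omega>. ?X i \<omega> * ?X j \<omega>) = 0" if "i < j" for i j
  proof -
    have "expectation (\<lambda>\<omega>. ?X i \<omega> * ?X j \<omega>) = expectation (?X i) * expectation (?X j)"
      using disjoint_family_onD[OF blocks_disjoint[of m], of i j] that
      by (intro expectation_mult_sig[OF block_sig block_sig] sq_int_integrable block_sq) auto
    then show ?thesis by (simp only: block_expectation)
  qed
  have "(l2norm M (T m k))\<^sup>2
      = (\<Sum>j<k. (l2norm M (?X j))\<^sup>2 + 2 * (\<Sum>i<j. expectation (\<lambda>\<omega>. ?X i \<omega> * ?X j \<omega>)))"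
    unfolding T_def[abs_def] by (rule l2norm_sum_square[OF block_sq])
  also have "\<dots> = (\<Sum>j<k. (sd m)\<^sup>2)"
    unfolding block_l2norm using orth by (intro sum.cong) auto
  also have "\<dots> = (sqrt (real k) * sd m)\<^sup>2" by (simp add: power_mult_distrib)
  finally show ?thesis
    by (rule power2_eq_imp_eq) (auto simp: sd_def)
qed

text \<open>Appending one block to \<open>S 0 (k * m)\<close> produces exactly the defect at time
  \<open>k * m\<close>; the means satisfy the same recursion, so the centered quantities do
  too.\<close>

lemma S_decompose:
  "S 0 (k * m) \<omega> - e (k * m) = T m k \<omega> - (\<Sum>i<k. cD 0 (i * m) (i * m + m) \<omega>)"
proof (induction k)
  case 0
  then show ?case by (simp add: T_def e_def S_refl)
next
  case (Suc k)
  have "expectation (D 0 (k * m) (k * m + m)) = e (k * m) + e m - e (k * m + m)"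
    unfolding D_def[abs_def]
    using sq_int_integrable[OF S_sq] expectation_S[of "k * m" "k * m + m"] by (simp add: e_def)
  then have "cD 0 (k * m) (k * m + m) \<omega> = (S 0 (k * m) \<omega> + S (k * m) (k * m + m) \<omega> - S 0 (k * m + m) \<omega>)
      - (e (k * m) + e m - e (k * m + m))"
    by (simp only: cD_def) (simp only: D_def)
  moreover have "T m (Suc k) \<omega> = T m k \<omega> + (S (k * m) (k * m + m) \<omega> - e m)" by (simp add: T_def)
  moreover have "Suc k * m = k * m + m" by simp
  ultimately show ?case using Suc by (simp only: sum.lessThan_Suc)
qed

text \<open>A common bound for the standard deviations of all incomplete blocks of length below m.
  Its size is irrelevant: it does not depend on n, so it vanishes after normalisation with m
  fixed.\<close>

definition L :: "nat \<Rightarrow> real" where "L m = (\<Sum>r<m. sd r)"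

text \<open>The three terms belong to the defects at the ends of the complete blocks, to the
  incomplete block from k m to n, and to the one defect created by attaching it.\<close>

lemma l2norm_S_minus_T:
  assumes "m \<ge> 1"
  shows "l2norm M (\<lambda>\<omega>. (S 0 n \<omega> - e n) - T m (n div m) \<omega>) \<le> sqrt (real (n div m) * C1) + L m + C"
proof -
  define k where "k = n div m"
  have kn: "k * m \<le> n" and r: "n - k * m < m"
    using assms by (auto simp: k_def minus_div_mult_eq_mod)
  let ?R = "\<lambda>\<omega>. \<Sum>i<k. cD 0 (i * m) (i * m + m) \<omega>"
  let ?B = "\<lambda>\<omega>. S (k * m) n \<omega> - e (n - k * m)"
  have "expectation (D 0 (k * m) n) = e (k * m) + e (n - k * m) - e n"
    unfolding D_def[abs_def] using kn
    using sq_int_integrable[OF S_sq] expectation_S[of "k * m" n] by (simp add: e_def)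
  then have "cD 0 (k * m) n \<omega> = (S 0 (k * m) \<omega> - e (k * m)) + ?B \<omega> - (S 0 n \<omega> - e n)" for \<omega>
    by (simp add: cD_def D_def)
  then have eq: "(S 0 n \<omega> - e n) - T m k \<omega> = (?B \<omega> - ?R \<omega>) - cD 0 (k * m) n \<omega>" for \<omega>
    using S_decompose[of k m \<omega>] by simp
  have sq: "sq_int M ?R" "sq_int M ?B" "sq_int M (cD 0 (k * m) n)"
    using kn by (auto intro!: sq_int_sum cD_sq sq_int_diff S_sq sq_int_const)
  have "l2norm M (\<lambda>\<omega>. (S 0 n \<omega> - e n) - T m k \<omega>) \<le> (l2norm M ?B + l2norm M ?R) + l2norm M (cD 0 (k * m) n)"
    unfolding eq using l2norm_triangle_diff[OF sq_int_diff[OF sq(2,1)] sq(3)] l2norm_triangle_diff[OF sq(2,1)]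
    by linarith
  moreover have "l2norm M ?B = sd (n - k * m)"
    using l2norm_S_diff[OF kn] by (simp add: sd_def)
  moreover have "sd (n - k * m) \<le> L m"
    unfolding L_def using r by (intro member_le_sum) (auto simp: sd_def)
  moreover have "l2norm M ?R \<le> sqrt (real k * C1)" by (rule l2norm_sum_defects[OF assms])
  moreover have "l2norm M (cD 0 (k * m) n) \<le> C" using kn by (intro l2norm_cD) auto
  ultimately show ?thesis by (simp add: k_def)
qed

text \<open>Degenerate blocks are treated apart because the classical theorem divides by their
  standard deviation; for them the normalised sum has L2 norm 0 and its characteristic function is
  1.\<close>

lemma T_char_limit:
  assumes "m \<ge> 1"
  shows "(\<lambda>k. char (distr M borel (\<lambda>\<omega>. T m k \<omega> / sqrt (real (k * m)))) t)
    \<longlonglongrightarrow> complex_of_real (exp (- (sd m / sqrt (real m) * t)\<^sup>2 / 2))"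
proof (cases "sd m = 0")
  case True
  have "char (distr M borel (\<lambda>\<omega>. T m k \<omega> / sqrt (real (k * m)))) t = 1" for k
  proof -
    have "l2norm M (\<lambda>\<omega>. T m k \<omega> / sqrt (real (k * m)) - 0) = 0"
      using l2norm_cmult[of M "1 / sqrt (real (k * m))" "T m k"] T_l2norm[of m k] True by simp
    moreover have "char (distr M borel (\<lambda>\<omega>. 0)) t = 1"
      unfolding char_def by (subst integral_distr) (auto simp: prob_space)
    moreover have "sq_int M (\<lambda>\<omega>. T m k \<omega> / sqrt (real (k * m)))"
      using sq_int_cmult[OF T_sq, of "1 / sqrt (real (k * m))"] by simp
    ultimately show ?thesis
      using char_distr_diff_le[of "\<lambda>\<omega>. T m k \<omega> / sqrt (real (k * m))" "\<lambda>\<omega>. 0" t] sq_int_const[of 0]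
      by simp
  qed
  then show ?thesis using True by simp
next
  case False
  then have pos: "sd m > 0" by (simp add: sd_def order_less_le)
  let ?X = "\<lambda>i \<omega>. S (i * m) (i * m + m) \<omega>"
  have X_sig: "?X i \<in> borel_measurable (sig {i * m..<i * m + m})" for i by (rule S_sig) simp
  have sq: "sq_int M (?X i)" for i by (rule S_sq) simp
  have mean: "expectation (?X i) = e m" for i using expectation_S[of "i * m" "i * m + m"] by simp
  have "weak_conv_m (\<lambda>k. distr M borel (\<lambda>\<omega>. (\<Sum>i<k. ?X i \<omega> - e m) / sqrt (real k * (sd m)\<^sup>2)))
      std_normal_distribution"
  proof (rule central_limit_theorem)
    show "indep_vars (\<lambda>i. borel) ?X UNIV"
      by (rule indep_vars_sig[OF X_sig blocks_disjoint])
    show "variance (?X i) = (sd m)\<^sup>2" for i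
      using block_l2norm[of i m] unfolding mean by (simp add: l2norm_square[symmetric])
    show "distr M borel (?X i) = distr M borel (S 0 m)" for i
      using S_distr[of "i * m" "i * m + m"] by simp
  qed (use mean pos sq_int_integrable_square[OF sq] in auto)
  then have "(\<lambda>k. char (distr M borel (\<lambda>\<omega>. T m k \<omega> / sqrt (real k * (sd m)\<^sup>2))) s)
      \<longlonglongrightarrow> char std_normal_distribution s" for s
  proof (intro levy_continuity1 real_dist_normal_dist real_distribution_distr)
    show "(\<lambda>\<omega>. T m k \<omega> / sqrt (real k * (sd m)\<^sup>2)) \<in> borel_measurable M" for k
      using T_sq[of m k] by (auto simp: sq_int_def)
  qed (simp add: T_def)
  \<comment> \<open>Evaluation at this point turns normalisation by \<open>sd m\<close> times the
    square root of k into normalisation by the square root of \<open>k * m\<close>.\<close>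
  from this[of "sd m / sqrt (real m) * t"]
  have "(\<lambda>k. char (distr M borel (\<lambda>\<omega>. T m k \<omega> / sqrt (real k * (sd m)\<^sup>2))) (sd m / sqrt (real m) * t))
      \<longlonglongrightarrow> complex_of_real (exp (- (sd m / sqrt (real m) * t)\<^sup>2 / 2))"
    by (simp add: char_std_normal_distribution)
  moreover have "char (distr M borel (\<lambda>\<omega>. T m k \<omega> / sqrt (real k * (sd m)\<^sup>2))) (sd m / sqrt (real m) * t)
      = char (distr M borel (\<lambda>\<omega>. T m k \<omega> / sqrt (real (k * m)))) t" for k
  proof -
    have "sd m / sqrt (real m) * (T m k \<omega> / sqrt (real k * (sd m)\<^sup>2)) = T m k \<omega> / sqrt (real (k * m))" for \<omega>
      using pos assms by (simp add: real_sqrt_mult field_simps)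
    moreover have "(\<lambda>\<omega>. T m k \<omega> / sqrt (real k * (sd m)\<^sup>2)) \<in> borel_measurable M"
      using T_sq[of m k] by (auto simp: sq_int_def)
    ultimately show ?thesis by (subst char_distr_cmult[symmetric]) auto
  qed
  ultimately show ?thesis by simp
qed

lemma l2norm_scaled_diff:
  assumes "m \<ge> 1" "n \<ge> m" and \<mu>: "\<bar>e n - real n * \<mu>\<bar> \<le> C"
  shows "l2norm M (\<lambda>\<omega>. (S 0 n \<omega> - real n * \<mu>) / sqrt (real n) - T m (n div m) \<omega> / sqrt (real (n div m * m)))
    \<le> sqrt (C1 / real m) + (L m + 2 * C) / sqrt (real n) + sd m * sqrt (real m) / real n"
proof -
  define k where "k = n div m"
  have k1: "k \<ge> 1" using assms by (simp add: k_def Suc_le_eq div_greater_zero_iff)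
  have kn: "k * m \<le> n" and r: "n \<le> k * m + m"
    using div_mult_mod_eq[of n m] mod_less_divisor[of m n] assms(1) unfolding k_def by linarith+
  have n0: "n > 0" using assms by simp
  have km0: "real (k * m) > 0" using k1 assms(1) by simp
  define a where "a = 1 / sqrt (real n)"
  define b where "b = 1 / sqrt (real (k * m))"
  have "real (k * m) \<le> real n" using kn by (simp only: of_nat_le_iff)
  then have "a \<le> b"
    unfolding a_def b_def using km0 by (intro frac_le real_sqrt_le_mono real_sqrt_gt_zero) simp_all
  moreover have "0 < a" unfolding a_def using n0 by simp
  ultimately have ab: "0 < a" "a \<le> b" by simp_all
  let ?P = "\<lambda>\<omega>. (S 0 n \<omega> - e n) - T m k \<omega>"
  have sqP: "sq_int M ?P" by (intro sq_int_diff S_sq sq_int_const T_sq) auto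
  \<comment> \<open>The two processes carry different factors a and b. Besides the comparison scaled
    by a and the bounded error of the mean, there remains (b - a) times the block sum.\<close>
  have "l2norm M (\<lambda>\<omega>. (S 0 n \<omega> - real n * \<mu>) / sqrt (real n) - T m k \<omega> / sqrt (real (k * m)))
     = l2norm M (\<lambda>\<omega>. (a * ?P \<omega> + a * (e n - real n * \<mu>)) - (b - a) * T m k \<omega>)"
    by (intro arg_cong[where f = "l2norm M"] ext) (simp add: a_def b_def left_diff_distrib right_diff_distrib diff_divide_distrib)
  also have "\<dots> \<le> (l2norm M (\<lambda>\<omega>. a * ?P \<omega>) + l2norm M (\<lambda>\<omega>. a * (e n - real n * \<mu>))) + l2norm M (\<lambda>\<omega>. (b - a) * T m k \<omega>)"
    using l2norm_triangle_diff[OF sq_int_add[OF sq_int_cmult[OF sqP] sq_int_const] sq_int_cmult[OF T_sq]]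
      l2norm_triangle[OF sq_int_cmult[OF sqP] sq_int_const]
    by (rule order_trans[OF _ add_right_mono])
  also have "\<dots> = a * l2norm M ?P + a * \<bar>e n - real n * \<mu>\<bar> + (b - a) * (sqrt (real k) * sd m)"
    using ab l2norm_cmult[of M a ?P] l2norm_cmult[of M "b - a" "T m k"]
      l2norm_const[of "a * (e n - real n * \<mu>)"]
    by (simp add: T_l2norm abs_mult)
  also have "\<dots> \<le> a * (sqrt (real k * C1) + L m + C) + a * C + (b - a) * (sqrt (real k) * sd m)"
    using l2norm_S_minus_T[OF assms(1), of n] \<mu> ab unfolding k_def
    by (intro add_mono mult_left_mono) auto
  also have "a * (sqrt (real k * C1) + L m + C) + a * C = a * sqrt (real k * C1) + (L m + 2 * C) / sqrt (real n)"
    by (simp add: a_def add_divide_distrib)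
  also have "a * sqrt (real k * C1) \<le> sqrt (C1 / real m)"
  proof -
    have "a * sqrt (real k * C1) = sqrt (real k * C1 / real n)" by (simp add: a_def real_sqrt_divide)
    also have "\<dots> \<le> sqrt (C1 / real m)"
    proof (rule real_sqrt_le_mono)
      have "real k * real m \<le> real n" using kn by (metis of_nat_le_iff of_nat_mult)
      then have "C1 * (real k * real m) \<le> C1 * real n" by (rule mult_left_mono[OF _ C1_nonneg])
      then show "real k * C1 / real n \<le> C1 / real m"
        using n0 assms(1) by (simp add: divide_simps mult_ac)
    qed
    finally show ?thesis .
  qed
  also have "(b - a) * (sqrt (real k) * sd m) \<le> sd m * sqrt (real m) / real n"
  proof -
    \<comment> \<open>The product of b - a and the square root of k is (1 - \<open>sqrt x\<close>) /
      \<open>sqrt m\<close>, and x in [0, 1] gives 1 - \<open>sqrt x\<close> \<le> 1 - x \<le> m /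
      n, because n exceeds k m by at most m.\<close>
    define x where "x = real (k * m) / real n"
    have x: "0 \<le> x" "x \<le> 1" using kn n0 by (auto simp: x_def divide_le_eq simp flip: of_nat_mult)
    have "x \<le> sqrt x" using x by (intro real_le_rsqrt) (simp add: power2_eq_square mult_left_le)
    have "1 - x = (real n - real (k * m)) / real n"
      using n0 unfolding x_def by (simp add: diff_divide_distrib)
    also have "\<dots> \<le> real m / real n" using r by (intro divide_right_mono) linarith+
    finally have "1 - x \<le> real m / real n" .
    have "(b - a) * sqrt (real k) = (1 - sqrt x) / sqrt (real m)"
      using k1 assms(1) n0 by (simp add: a_def b_def x_def real_sqrt_mult real_sqrt_divide field_simps)
    also have "\<dots> \<le> (real m / real n) / sqrt (real m)"
      using \<open>x \<le> sqrt x\<close> \<open>1 - x \<le> real m / real n\<close> by (intro divide_right_mono) auto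
    also have "\<dots> = (real m / sqrt (real m)) / real n" by simp
    also have "\<dots> = sqrt (real m) / real n" by (simp only: real_div_sqrt of_nat_0_le_iff)
    finally have "(b - a) * sqrt (real k) \<le> sqrt (real m) / real n" .
    then have "(b - a) * sqrt (real k) * sd m \<le> sqrt (real m) / real n * sd m"
      by (rule mult_right_mono) (simp add: sd_def)
    then show ?thesis by (simp add: mult_ac)
  qed
  finally show ?thesis by (simp add: k_def)
qed

text \<open>The block approximation has an asymptotic error \<open>sqrt (C1 / m)\<close> for fixed
  m. The reverse triangle inequality feeds it into \<open>approximate_limit\<close>, which yields
  \<sigma>; the Lipschitz bound for characteristic functions feeds it into a triangle inequality
  through the Gaussian limit of the blocks of length m.\<close>

theorem almost_additive_CLT:
  obtains \<mu> \<sigma> :: real where "0 \<le> \<sigma>"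
    and "\<And>n. \<bar>expectation (S 0 n) - real n * \<mu>\<bar> \<le> C"
    and "(\<lambda>n. l2norm M (\<lambda>\<omega>. (S 0 n \<omega> - real n * \<mu>) / sqrt (real n))) \<longlonglongrightarrow> \<sigma>"
    and "\<And>t. (\<lambda>n. char (distr M borel (\<lambda>\<omega>. (S 0 n \<omega> - real n * \<mu>) / sqrt (real n))) t)
           \<longlonglongrightarrow> complex_of_real (exp (- (\<sigma> * t)\<^sup>2 / 2))"
proof -
  obtain \<mu> where \<mu>: "\<And>n. \<bar>e n - real n * \<mu>\<bar> \<le> C"
    using quasi_additive_limit[of e C] e_quasi_additive by blast
  define W where "W n \<omega> = (S 0 n \<omega> - real n * \<mu>) / sqrt (real n)" for n \<omega>
  define G where "G m k \<omega> = T m k \<omega> / sqrt (real (k * m))" for m k \<omega>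
  define g where "g m = sd m / sqrt (real m)" for m
  have W_sq: "sq_int M (W n)" for n
    using sq_int_cmult[OF sq_int_diff[OF S_sq sq_int_const], of 0 n "1 / sqrt (real n)"]
    by (simp add: W_def[abs_def])
  have G_sq: "sq_int M (G m k)" for m k
    using sq_int_cmult[OF T_sq, of "1 / sqrt (real (k * m))"] by (simp add: G_def[abs_def])
  have G_norm: "l2norm M (G m k) = g m" if "k \<ge> 1" "m \<ge> 1" for m k
    using l2norm_cmult[of M "1 / sqrt (real (k * m))" "T m k"] that
    by (simp add: G_def[abs_def] g_def T_l2norm real_sqrt_mult)
  have close: "\<forall>\<^sub>F n in sequentially. l2norm M (\<lambda>\<omega>. W n \<omega> - G m (n div m) \<omega>) \<le> sqrt (C1 / real m) + \<epsilon>"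
    if "m \<ge> 1" "\<epsilon> > 0" for m \<epsilon>
  proof -
    have "(\<lambda>n. (L m + 2 * C) * (1 / sqrt (real n)) + (sd m * sqrt (real m)) / real n) \<longlonglongrightarrow> (L m + 2 * C) * 0 + 0"
      by (intro tendsto_intros lim_const_over_n tendsto_divide_0[OF tendsto_const]
          filterlim_at_top_imp_at_infinity filterlim_compose[OF sqrt_at_top filterlim_real_sequentially])
    then have "\<forall>\<^sub>F n in sequentially. (L m + 2 * C) * (1 / sqrt (real n)) + (sd m * sqrt (real m)) / real n < \<epsilon>"
      by (rule order_tendstoD) (use that in simp)
    moreover have "\<forall>\<^sub>F n in sequentially. n \<ge> m" by (rule eventually_ge_at_top)
    ultimately show ?thesis
    proof eventually_elim
      case (elim n)
      then show ?case
        using l2norm_scaled_diff[OF that(1) _ \<mu>[of n]] by (simp add: W_def G_def)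
    qed
  qed
  have err0: "(\<lambda>m. sqrt (C1 / real m)) \<longlonglongrightarrow> 0"
    using tendsto_real_sqrt[OF lim_const_over_n[of C1]] by simp
  obtain \<sigma> where \<sigma>: "(\<lambda>n. l2norm M (W n)) \<longlonglongrightarrow> \<sigma>" "g \<longlonglongrightarrow> \<sigma>"
  proof (rule approximate_limit[OF _ err0])
    fix m :: nat and \<epsilon> :: real assume m: "m \<ge> 1" and \<epsilon>: "\<epsilon> > 0"
    show "\<forall>\<^sub>F n in sequentially. \<bar>l2norm M (W n) - g m\<bar> \<le> sqrt (C1 / real m) + \<epsilon>"
      using close[OF m \<epsilon>] eventually_ge_at_top[of m]
    proof eventually_elim
      case (elim n)
      have "n div m \<ge> 1" using elim m by (simp add: Suc_le_eq div_greater_zero_iff)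
      then show ?case
        using l2norm_reverse_triangle[OF W_sq G_sq, of n m "n div m"] elim G_norm[OF _ m] by simp
    qed
  qed
  have "\<sigma> \<ge> 0" by (rule LIMSEQ_le_const[OF \<sigma>(1)]) simp
  have "(\<lambda>n. char (distr M borel (W n)) t) \<longlonglongrightarrow> complex_of_real (exp (- (\<sigma> * t)\<^sup>2 / 2))" for t
  proof (rule tendstoI)
    fix \<epsilon> :: real assume \<epsilon>: "\<epsilon> > 0"
    define E where "E m = complex_of_real (exp (- (g m * t)\<^sup>2 / 2))" for m
    define E0 where "E0 = complex_of_real (exp (- (\<sigma> * t)\<^sup>2 / 2))"
    have "E \<longlonglongrightarrow> E0" unfolding E_def[abs_def] E0_def by (intro tendsto_intros \<sigma>(2)) auto
    then have "\<forall>\<^sub>F m in sequentially. dist (E m) E0 < \<epsilon> / 4" using \<epsilon> by (intro tendstoD) auto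
    moreover have "(\<lambda>m. \<bar>t\<bar> * sqrt (C1 / real m)) \<longlonglongrightarrow> \<bar>t\<bar> * 0" by (intro tendsto_intros err0)
    then have "\<forall>\<^sub>F m in sequentially. \<bar>t\<bar> * sqrt (C1 / real m) < \<epsilon> / 4"
      by (rule order_tendstoD) (use \<epsilon> in simp)
    \<comment> \<open>Here m is fixed once and for all, good for both the Gaussian parameter and the
      block error; only n varies afterwards.\<close>
    ultimately have "\<forall>\<^sub>F m in sequentially. m \<ge> 1 \<and> dist (E m) E0 < \<epsilon> / 4 \<and> \<bar>t\<bar> * sqrt (C1 / real m) < \<epsilon> / 4"
      using eventually_ge_at_top[of 1] by eventually_elim auto
    then obtain m where m: "m \<ge> 1" "dist (E m) E0 < \<epsilon> / 4" "\<bar>t\<bar> * sqrt (C1 / real m) < \<epsilon> / 4"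
      by (auto simp: eventually_sequentially)
    have "filterlim (\<lambda>n. n div m) sequentially sequentially"
    proof (rule filterlim_at_top[THEN iffD2], rule allI)
      fix z show "\<forall>\<^sub>F n in sequentially. z \<le> n div m"
        using eventually_ge_at_top[of "z * m"]
        by eventually_elim (use m(1) in \<open>simp add: less_eq_div_iff_mult_less_eq\<close>)
    qed
    from filterlim_compose[OF T_char_limit[OF m(1)] this]
    have "(\<lambda>n. char (distr M borel (G m (n div m))) t) \<longlonglongrightarrow> E m"
      by (simp add: G_def[abs_def] E_def g_def)
    then have "\<forall>\<^sub>F n in sequentially. dist (char (distr M borel (G m (n div m))) t) (E m) < \<epsilon> / 4"
      using \<epsilon> by (intro tendstoD) auto
    \<comment> \<open>The summand 1 covers t = 0; multiplied by |t| this error stays below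
      \<epsilon> / 4.\<close>
    moreover have "\<epsilon> / (4 * (\<bar>t\<bar> + 1)) > 0" using \<epsilon> by simp
    note close[OF m(1) this]
    ultimately show "\<forall>\<^sub>F n in sequentially. dist (char (distr M borel (W n)) t) E0 < \<epsilon>"
    proof eventually_elim
      case (elim n)
      have "dist (char (distr M borel (W n)) t) (char (distr M borel (G m (n div m))) t)
          \<le> \<bar>t\<bar> * l2norm M (\<lambda>\<omega>. W n \<omega> - G m (n div m) \<omega>)"
        unfolding dist_norm by (rule char_distr_diff_le[OF W_sq G_sq])
      also have "\<dots> \<le> \<bar>t\<bar> * (sqrt (C1 / real m) + \<epsilon> / (4 * (\<bar>t\<bar> + 1)))"
        using elim by (intro mult_left_mono) auto
      also have "\<dots> \<le> \<bar>t\<bar> * sqrt (C1 / real m) + \<epsilon> / 4"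
      proof -
        have "\<bar>t\<bar> * (\<epsilon> / (4 * (\<bar>t\<bar> + 1))) = (\<bar>t\<bar> / (\<bar>t\<bar> + 1)) * (\<epsilon> / 4)" by simp
        also have "\<dots> \<le> 1 * (\<epsilon> / 4)" using \<epsilon> by (intro mult_right_mono) auto
        finally show ?thesis by (simp add: distrib_left)
      qed
      also have "\<dots> < \<epsilon> / 4 + \<epsilon> / 4" using m by simp
      finally have "dist (char (distr M borel (W n)) t) (char (distr M borel (G m (n div m))) t) < \<epsilon> / 2" by simp
      moreover have "dist (char (distr M borel (W n)) t) E0 \<le>
          dist (char (distr M borel (W n)) t) (char (distr M borel (G m (n div m))) t) +
          dist (char (distr M borel (G m (n div m))) t) (E m) + dist (E m) E0"
        by (rule order_trans[OF dist_triangle[of _ _ "E m"] add_right_mono[OF dist_triangle]])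
      ultimately show ?case using elim m by linarith
    qed
  qed
  then show ?thesis
    using \<open>\<sigma> \<ge> 0\<close> \<mu> \<sigma>(1) by (intro that[of \<sigma> \<mu>]) (auto simp: e_def W_def[abs_def])
qed

end

section \<open>(max,+) operators\<close>

lemma Max_range_attained:
  fixes f :: "'i::finite \<Rightarrow> 'b::linorder"
  obtains p where "Max (range f) = f p"
proof -
  have "Max (range f) \<in> range f" by (rule Max_in) auto
  then show ?thesis using that by blast
qed

section \<open>The largest coordinate and the action of one matrix\<close>

definition vmax :: "real^'d \<Rightarrow> real" where
  "vmax x = Max (range (\<lambda>i. x$i))"

lemma vmax_ge: "x$i \<le> vmax x"
  by (simp add: vmax_def)

lemma vmax_le_iff: "vmax x \<le> c \<longleftrightarrow> (\<forall>i. x$i \<le> c)"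
  by (auto simp: vmax_def)

lemma vmax_attained: obtains i where "vmax x = x$i"
  using Max_range_attained[of "\<lambda>i. x$i"] that unfolding vmax_def by blast

lemma vmax_0 [simp]: "vmax 0 = 0"
  by (simp add: vmax_def)

lemma vmax_add_const:
  assumes "\<And>i. x$i = y$i + c" shows "vmax x = vmax y + c"
proof (rule antisym)
  show "vmax x \<le> vmax y + c" by (simp add: vmax_le_iff assms vmax_ge)
  have "vmax y \<le> vmax x - c"
    unfolding vmax_le_iff using vmax_ge[of x] by (simp add: assms le_diff_eq)
  then show "vmax y + c \<le> vmax x" by simp
qed

lemma Max_plus_ereal_le_iff:
  fixes f :: "'i::finite \<Rightarrow> ereal"
  shows "Max (range f) + ereal x \<le> c \<longleftrightarrow> (\<forall>p. f p + ereal x \<le> c)"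
proof
  assume *: "Max (range f) + ereal x \<le> c"
  show "\<forall>p. f p + ereal x \<le> c"
  proof
    fix p
    have "f p + ereal x \<le> Max (range f) + ereal x" by (intro add_right_mono Max_ge) auto
    then show "f p + ereal x \<le> c" using * by (rule order_trans)
  qed
next
  assume *: "\<forall>p. f p + ereal x \<le> c"
  obtain p where "Max (range f) = f p" by (rule Max_range_attained)
  then show "Max (range f) + ereal x \<le> c" using * by simp
qed

text \<open>Validity makes each row maximum finite, so \<open>real_of_ereal\<close> never falls back
  on its default value 0.\<close>

lemma ereal_mp_apply:
  assumes "mp_valid A"
  shows "ereal (mp_apply A x $ i) = Max (range (\<lambda>j. A$i$j + ereal (x$j)))"
proof -
  let ?m = "Max (range (\<lambda>j. A$i$j + ereal (x$j)))"
  obtain j where j: "A$i$j \<noteq> -\<infinity>" "A$i$j \<noteq> \<infinity>" using assms unfolding mp_valid_def by blast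
  have "A$i$j + ereal (x$j) \<le> ?m" by (intro Max_ge) auto
  then have 1: "?m \<noteq> -\<infinity>" using j by (cases "A$i$j") auto
  obtain k where "?m = A$i$k + ereal (x$k)"
    by (rule Max_range_attained)
  then have 2: "?m \<noteq> \<infinity>" using assms by (auto simp: mp_valid_def)
  show ?thesis using 1 2 unfolding mp_apply_def by (cases ?m) auto
qed

text \<open>Residuation: an upper bound on a coordinate is a family of inequalities without maxima.
  Operators are mostly compared through their upper bounds in this form.\<close>

lemma mp_apply_le_iff:
  assumes "mp_valid A"
  shows "mp_apply A x $ i \<le> c \<longleftrightarrow> (\<forall>j. A$i$j + ereal (x$j) \<le> ereal c)"
  using ereal_mp_apply[OF assms, of x i] by (subst ereal_less_eq(3)[symmetric]) auto

lemma mp_apply_ge: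
  assumes "mp_valid A" shows "A$i$j + ereal (x$j) \<le> ereal (mp_apply A x $ i)"
  using mp_apply_le_iff[OF assms] by blast

text \<open>Isotonicity and homogeneity in one inequality. As c may have any sign, using it in both
  directions gives nonexpansiveness in the sup norm and preservation of a constant
  difference.\<close>

lemma mp_apply_mono_plus:
  assumes "mp_valid A" "\<And>i. x$i \<le> y$i + c"
  shows "mp_apply A x $ i \<le> mp_apply A y $ i + c"
  unfolding mp_apply_le_iff[OF assms(1)]
proof
  fix j
  have "A$i$j + ereal (x$j) \<le> A$i$j + ereal (y$j) + ereal c"
    using assms(2)[of j] by (cases "A$i$j") auto
  also have "\<dots> \<le> ereal (mp_apply A y $ i) + ereal c"
    by (intro add_right_mono mp_apply_ge assms)
  finally show "A$i$j + ereal (x$j) \<le> ereal (mp_apply A y $ i + c)" by simp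
qed

lemma mp_traj_mono_plus:
  assumes "\<And>k. k \<in> {1..n} \<Longrightarrow> mp_valid (B k)" "\<And>i. x$i \<le> y$i + c"
  shows "mp_traj B x n $ i \<le> mp_traj B y n $ i + c"
  using assms(1)
proof (induction n arbitrary: i)
  case (Suc n)
  then show ?case by (auto intro!: mp_apply_mono_plus)
qed (use assms(2) in auto)

lemma mp_traj_add_const:
  assumes "\<And>k. k \<in> {1..n} \<Longrightarrow> mp_valid (B k)" "\<And>i. x$i = y$i + c"
  shows "mp_traj B x n $ i = mp_traj B y n $ i + c"
  using mp_traj_mono_plus[of n B x y c i] mp_traj_mono_plus[of n B y x "- c" i] assms by fastforce

lemma mp_traj_shift: "mp_traj B x (s + n) = mp_traj (\<lambda>k. B (s + k)) (mp_traj B x s) n"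
  by (induction n) auto

lemma mp_traj_cong:
  "(\<And>k. k \<in> {1..n} \<Longrightarrow> B k = B' k) \<Longrightarrow> mp_traj B x n = mp_traj B' x n"
  by (induction n) auto

lemma vmax_mp_apply_le:
  assumes "mp_valid A" "\<bar>mp_maxentry A\<bar> \<noteq> \<infinity>"
  shows "vmax (mp_apply A x) \<le> vmax x + real_of_ereal (mp_maxentry A)"
  unfolding vmax_le_iff mp_apply_le_iff[OF assms(1)]
proof (intro allI)
  fix i j
  have "A$i$j \<le> mp_maxentry A"
    unfolding mp_maxentry_def by (intro Max_ge) (auto intro: range_eqI[of _ _ "(i, j)"])
  then have "A$i$j + ereal (x$j) \<le> mp_maxentry A + ereal (vmax x)"
    using vmax_ge[of x j] by (intro add_mono) auto
  also have "\<dots> = ereal (vmax x + real_of_ereal (mp_maxentry A))"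
    using assms(2) by (cases "mp_maxentry A") auto
  finally show "A$i$j + ereal (x$j) \<le> ereal (vmax x + real_of_ereal (mp_maxentry A))" .
qed

text \<open>In the column of a coordinate where x is maximal some entry is at least
  \<open>mp_minmax A\<close>, and the row of that entry receives the required value.\<close>

lemma vmax_mp_apply_ge:
  assumes "mp_valid A" "\<bar>mp_minmax A\<bar> \<noteq> \<infinity>"
  shows "vmax x + real_of_ereal (mp_minmax A) \<le> vmax (mp_apply A x)"
proof -
  obtain j where j: "vmax x = x$j" by (rule vmax_attained)
  have "mp_minmax A \<le> Max (range (\<lambda>i. A$i$j))"
    unfolding mp_minmax_def by (intro Min_le) auto
  moreover obtain i where "Max (range (\<lambda>i. A$i$j)) = A$i$j"
    by (rule Max_range_attained)
  ultimately have le: "mp_minmax A \<le> A$i$j" by simp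
  have "ereal (vmax x + real_of_ereal (mp_minmax A)) = mp_minmax A + ereal (x$j)"
    using assms(2) j by (cases "mp_minmax A") auto
  also have "\<dots> \<le> A$i$j + ereal (x$j)" by (intro add_right_mono le)
  also have "\<dots> \<le> ereal (mp_apply A x $ i)" by (rule mp_apply_ge[OF assms(1)])
  also have "\<dots> \<le> ereal (vmax (mp_apply A x))" by (simp add: vmax_ge)
  finally show ?thesis by simp
qed

section \<open>Matrix products as compositions of operators\<close>

lemma mp_valid_id: "mp_valid mp_id"
  by (auto simp: mp_valid_def mp_id_def)

lemma mp_valid_mult:
  assumes "mp_valid A" "mp_valid B" shows "mp_valid (mp_mult A B)"
  unfolding mp_valid_def
proof (intro conjI allI)
  fix i j
  obtain p where "Max (range (\<lambda>p. A$i$p + B$p$j)) = A$i$p + B$p$j"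
    by (rule Max_range_attained)
  then show "mp_mult A B $ i $ j \<noteq> \<infinity>" using assms by (auto simp: mp_mult_def mp_valid_def)
next
  fix i
  obtain p where p: "A$i$p \<noteq> -\<infinity>" "A$i$p \<noteq> \<infinity>" using assms(1) unfolding mp_valid_def by blast
  obtain j where j: "B$p$j \<noteq> -\<infinity>" "B$p$j \<noteq> \<infinity>" using assms(2) unfolding mp_valid_def by blast
  have "A$i$p + B$p$j \<le> mp_mult A B $ i $ j"
    unfolding mp_mult_def by (auto intro!: Max_ge)
  then show "\<exists>j. mp_mult A B $ i $ j \<noteq> -\<infinity>"
    using p j by (intro exI[of _ j]) (cases "A$i$p"; cases "B$p$j"; auto)
qed

text \<open>Two real numbers with the same upper bounds are equal, and by residuation both sides
  have the same ones.\<close>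

lemma mp_apply_mult:
  assumes "mp_valid A" "mp_valid B"
  shows "mp_apply (mp_mult A B) x = mp_apply A (mp_apply B x)"
proof -
  have *: "mp_apply (mp_mult A B) x $ i \<le> c \<longleftrightarrow> mp_apply A (mp_apply B x) $ i \<le> c" for i c
  proof -
    have "mp_apply (mp_mult A B) x $ i \<le> c \<longleftrightarrow> (\<forall>p. \<forall>j. A$i$p + B$p$j + ereal (x$j) \<le> ereal c)"
      unfolding mp_apply_le_iff[OF mp_valid_mult[OF assms]]
      by (auto simp: mp_mult_def Max_plus_ereal_le_iff)
    moreover have "(\<forall>j. A$i$p + B$p$j + ereal (x$j) \<le> ereal c)
        \<longleftrightarrow> A$i$p + ereal (mp_apply B x $ p) \<le> ereal c" for p
    proof (cases "A$i$p")
      case (real a)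
      have "A$i$p + ereal (mp_apply B x $ p) \<le> ereal c \<longleftrightarrow> mp_apply B x $ p \<le> c - a"
        using real by auto
      also have "\<dots> \<longleftrightarrow> (\<forall>j. B$p$j + ereal (x$j) \<le> ereal (c - a))"
        by (rule mp_apply_le_iff[OF assms(2)])
      also have "\<dots> \<longleftrightarrow> (\<forall>j. A$i$p + B$p$j + ereal (x$j) \<le> ereal c)"
      proof (intro all_cong1)
        fix j show "B$p$j + ereal (x$j) \<le> ereal (c - a) \<longleftrightarrow> A$i$p + B$p$j + ereal (x$j) \<le> ereal c"
          using real by (cases "B$p$j") auto
      qed
      finally show ?thesis by simp
    next
      case PInf
      then show ?thesis using assms(1) by (auto simp: mp_valid_def)
    next
      \<comment> \<open>In \<open>ereal\<close> the sum of -\<infinity> and \<infinity> is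
        \<infinity>, so the absence of \<infinity> among the entries of \<open>B\<close> matters
        here.\<close>
      case MInf
      have h1: "A$i$p + B$p$j + ereal (x$j) = -\<infinity>" for j
        unfolding MInf using assms(2) by (cases "B$p$j") (auto simp: mp_valid_def)
      have h2: "A$i$p + ereal (mp_apply B x $ p) = -\<infinity>" unfolding MInf by simp
      show ?thesis unfolding h1 h2 by simp
    qed
    ultimately show ?thesis by (simp only: mp_apply_le_iff[OF assms(1)])
  qed
  show ?thesis
    by (rule vec_eq_iff[THEN iffD2]) (meson * antisym order_refl)
qed

lemma mp_valid_prod:
  "(\<And>k. k \<in> {1..n} \<Longrightarrow> mp_valid (B k)) \<Longrightarrow> mp_valid (mp_prod B n)"
  by (induction n) (auto intro!: mp_valid_id mp_valid_mult)

lemma mp_apply_id: "mp_apply mp_id x = x"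
proof (rule vec_eq_iff[THEN iffD2], rule allI, rule antisym)
  fix i
  show "mp_apply mp_id x $ i \<le> x $ i"
    unfolding mp_apply_le_iff[OF mp_valid_id] by (auto simp: mp_id_def)
  show "x $ i \<le> mp_apply mp_id x $ i"
    using mp_apply_ge[OF mp_valid_id, of i i x] by (simp add: mp_id_def)
qed

lemma mp_apply_prod:
  "(\<And>k. k \<in> {1..n} \<Longrightarrow> mp_valid (B k)) \<Longrightarrow> mp_apply (mp_prod B n) x = mp_traj B x n"
proof (induction n)
  case (Suc n)
  have "mp_apply (mp_prod B n) x = mp_traj B x n" using Suc by simp
  moreover have "mp_valid (B (Suc n))" "mp_valid (mp_prod B n)"
    using Suc.prems by (auto intro!: mp_valid_prod)
  ultimately show ?case by (simp add: mp_apply_mult)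
qed (simp add: mp_apply_id)

text \<open>Applied to the zero vector, a matrix returns its row maxima. This identifies the
  quantity in (ii) with the scalar process.\<close>

lemma mp_maxentry_eq_vmax:
  assumes "mp_valid P" shows "mp_maxentry P = ereal (vmax (mp_apply P 0))"
proof (rule antisym)
  show "mp_maxentry P \<le> ereal (vmax (mp_apply P 0))"
    unfolding mp_maxentry_def
  proof (subst Max_le_iff, goal_cases)
    case 3
    have "P$i$j \<le> ereal (vmax (mp_apply P 0))" for i j
      using order_trans[OF mp_apply_ge[OF assms, of i j 0], of "ereal (vmax (mp_apply P 0))"]
        vmax_ge[of "mp_apply P 0" i] by (simp flip: zero_ereal_def)
    then show ?case by auto
  qed auto
  obtain i where i: "vmax (mp_apply P 0) = mp_apply P 0 $ i" by (rule vmax_attained)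
  have "Max (range (\<lambda>j. P$i$j + ereal ((0::real^'a)$j))) \<le> mp_maxentry P"
    unfolding mp_maxentry_def
    by (subst Max_le_iff) (auto intro!: Max_ge range_eqI[of _ _ "(i, j)" for j] simp flip: zero_ereal_def)
  then show "ereal (vmax (mp_apply P 0)) \<le> mp_maxentry P"
    unfolding i by (simp only: ereal_mp_apply[OF assms])
qed

lemma mp_maxentry_prod:
  assumes "\<And>k. k \<in> {1..n} \<Longrightarrow> mp_valid (B k)"
  shows "real_of_ereal (mp_maxentry (mp_prod B n)) = vmax (mp_traj B 0 n)"
  using mp_maxentry_eq_vmax[OF mp_valid_prod[OF assms]] mp_apply_prod[OF assms] by simp

text \<open>Rank one is tested on a countable dense set of vectors, which makes it a measurable event.\<close>

definition dense_vecs :: "(real^'d) set" where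
  "dense_vecs = (SOME Q. countable Q \<and> (\<forall>U. open U \<longrightarrow> U \<noteq> {} \<longrightarrow> (\<exists>q\<in>Q. q \<in> U)))"

lemma dense_vecs_props:
  "countable (dense_vecs :: (real^'d) set) \<and>
    (\<forall>U :: (real^'d) set. open U \<longrightarrow> U \<noteq> {} \<longrightarrow> (\<exists>q\<in>dense_vecs. q \<in> U))"
  unfolding dense_vecs_def by (rule someI_ex) (rule countable_dense_exists)

lemmas countable_dense_vecs = dense_vecs_props[THEN conjunct1]

lemma dense_vecs: "open U \<Longrightarrow> q \<in> U \<Longrightarrow> \<exists>q\<in>dense_vecs. q \<in> (U :: (real^'d) set)"
  using dense_vecs_props[THEN conjunct2, rule_format, of U] by blast

text \<open>Equality up to a constant vector is expressed by coordinate differences, compared with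
  those of the trajectory from 0. This removes the existential quantifier over a real constant and
  leaves a countable intersection of events.\<close>

definition forgets :: "(nat \<Rightarrow> ereal^'d^'d) \<Rightarrow> nat \<Rightarrow> bool" where
  "forgets B n \<longleftrightarrow> (\<forall>x\<in>dense_vecs. \<forall>i k. mp_traj B x n $ i - mp_traj B x n $ k = mp_traj B 0 n $ i - mp_traj B 0 n $ k)"

lemma forgets_cong:
  assumes "\<And>k. k \<in> {1..n} \<Longrightarrow> B k = B' k"
  shows "forgets B n = forgets B' n"
proof -
  have "mp_traj B x n = mp_traj B' x n" for x by (rule mp_traj_cong[OF assms])
  then show ?thesis by (simp add: forgets_def)
qed

lemma forgets_if_rank1:
  assumes "\<And>k. k \<in> {1..n} \<Longrightarrow> mp_valid (B k)" "mp_rank1 (mp_prod B n)"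
  shows "forgets B n"
  unfolding forgets_def
proof (intro ballI allI)
  fix x :: "real^'a" and i k
  obtain c where "\<And>i. mp_traj B x n $ i = mp_traj B 0 n $ i + c"
    using assms(2) mp_apply_prod[of n B, OF assms(1)] unfolding mp_rank1_def by metis
  then show "mp_traj B x n $ i - mp_traj B x n $ k = mp_traj B 0 n $ i - mp_traj B 0 n $ k" by simp
qed

text \<open>Trajectories are nonexpansive in the sup norm, so coordinate differences depend
  continuously on the initial vector and the identity passes from the dense set to all vectors. The
  constant is then read off at an arbitrary coordinate.\<close>

lemma forgetsD:
  fixes x y :: "real^'d"
  assumes valid: "\<And>k. k \<in> {1..n} \<Longrightarrow> mp_valid (B k)" and "forgets B n"
  obtains c where "\<And>i. mp_traj B x n $ i = mp_traj B y n $ i + c"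
proof -
  have *: "mp_traj B x n $ i - mp_traj B x n $ k = mp_traj B 0 n $ i - mp_traj B 0 n $ k" for x i k
  proof -
    have "\<bar>(mp_traj B x n $ i - mp_traj B x n $ k) - (mp_traj B 0 n $ i - mp_traj B 0 n $ k)\<bar> \<le> 0 + \<epsilon>" if "\<epsilon> > 0" for \<epsilon>
    proof -
      obtain q where q: "q \<in> dense_vecs" "q \<in> ball x (\<epsilon> / 2)"
        using dense_vecs[of "ball x (\<epsilon> / 2)" x] \<open>\<epsilon> > 0\<close> by auto
      have d: "\<bar>x$j - q$j\<bar> \<le> \<epsilon> / 2" for j
        using q(2) component_le_norm_cart[of "x - q" j] by (simp add: dist_norm)
      then have d': "x$j \<le> q$j + \<epsilon> / 2" "q$j \<le> x$j + \<epsilon> / 2" for j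
        using d[of j] by linarith+
      have "mp_traj B x n $ j \<le> mp_traj B q n $ j + \<epsilon> / 2" "mp_traj B q n $ j \<le> mp_traj B x n $ j + \<epsilon> / 2" for j
        using mp_traj_mono_plus[OF valid d'(1)] mp_traj_mono_plus[OF valid d'(2)] by simp_all
      from this[of i] this[of k]
      moreover have "mp_traj B q n $ i - mp_traj B q n $ k = mp_traj B 0 n $ i - mp_traj B 0 n $ k"
        using assms(2) q(1) unfolding forgets_def by blast
      ultimately show ?thesis by (smt (verit, ccfv_SIG) field_sum_of_halves)
    qed
    from field_le_epsilon[OF this] show ?thesis by simp
  qed
  obtain k :: 'd where True by simp
  show ?thesis
  proof (rule that)
    fix i
    show "mp_traj B x n $ i = mp_traj B y n $ i + (mp_traj B x n $ k - mp_traj B y n $ k)"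
      using *[of x i k] *[of y i k] by simp
  qed
qed

section \<open>Measurability of trajectories, entries and forgetting\<close>

lemma measurable_vec_nth: "f \<in> borel_measurable L \<Longrightarrow> (\<lambda>\<omega>. f \<omega> $ i) \<in> borel_measurable L"
  by (rule measurable_compose[where N = borel], assumption)
     (auto intro!: borel_measurable_continuous_onI tendsto_vec_nth tendsto_ident_at simp: continuous_on_def)

lemma measurable_vec:
  fixes f :: "'a \<Rightarrow> real^'d"
  assumes "\<And>i. (\<lambda>\<omega>. f \<omega> $ i) \<in> borel_measurable L"
  shows "f \<in> borel_measurable L"
  by (rule borel_measurable_euclidean_space[THEN iffD2]) (use assms in \<open>auto simp: Basis_vec_def inner_axis\<close>)

lemma measurable_vmax:
  assumes "\<And>i. (\<lambda>\<omega>. f \<omega> $ i) \<in> borel_measurable L"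
  shows "(\<lambda>\<omega>. vmax (f \<omega>)) \<in> borel_measurable L"
  unfolding vmax_def by (intro borel_measurable_Max assms) auto

text \<open>A sum over coordinates in place of the maximal difference: it still dominates each
  difference, and it is unchanged when a constant vector is added.\<close>

definition spread :: "real^'d \<Rightarrow> real" where
  "spread x = (\<Sum>i\<in>UNIV. vmax x - x$i)"

lemma spread_ge: "vmax x - x$i \<le> spread x"
  unfolding spread_def by (rule member_le_sum) (auto simp: vmax_ge)

lemma spread_measurable: "spread \<in> borel_measurable borel"
  unfolding spread_def[abs_def]
  by (intro borel_measurable_sum borel_measurable_diff measurable_vmax measurable_vec_nth) auto

lemma measurable_mp_apply:
  fixes A :: "'a \<Rightarrow> ereal^'d^'d"
  assumes "A \<in> borel_measurable L" "\<And>i. (\<lambda>\<omega>. x \<omega> $ i) \<in> borel_measurable L"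
  shows "(\<lambda>\<omega>. mp_apply (A \<omega>) (x \<omega>) $ i) \<in> borel_measurable L"
  unfolding mp_apply_def vec_lambda_beta
  by (intro borel_measurable_real_of_ereal borel_measurable_Max borel_measurable_ereal_add
      borel_measurable_ereal measurable_vec_nth assms) auto

lemma measurable_mp_traj:
  fixes B :: "'a \<Rightarrow> nat \<Rightarrow> ereal^'d^'d"
  assumes "\<And>k. k \<in> {1..n} \<Longrightarrow> (\<lambda>\<omega>. B \<omega> k) \<in> borel_measurable L"
    and "\<And>i. (\<lambda>\<omega>. x \<omega> $ i) \<in> borel_measurable L"
  shows "(\<lambda>\<omega>. mp_traj (B \<omega>) (x \<omega>) n $ i) \<in> borel_measurable L"
  using assms(1)
proof (induction n arbitrary: i)
  case (Suc n)
  then show ?case by (auto intro!: measurable_mp_apply)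
qed (use assms(2) in auto)

lemma measurable_forgets:
  fixes B :: "'a \<Rightarrow> nat \<Rightarrow> ereal^'d^'d"
  assumes "\<And>k. k \<in> {1..n} \<Longrightarrow> (\<lambda>\<omega>. B \<omega> k) \<in> borel_measurable L"
  shows "Measurable.pred L (\<lambda>\<omega>. forgets (B \<omega>) n)"
  unfolding forgets_def pred_def
proof (intro sets.sets_Collect_countable_All' countable_dense_vecs sets.sets_Collect_countable_All)
  fix x :: "real^'d" and i k
  have [measurable]: "(\<lambda>\<omega>. mp_traj (B \<omega>) y n $ j) \<in> borel_measurable L" for y j
    by (rule measurable_mp_traj[OF assms]) auto
  show "{\<omega> \<in> space L. mp_traj (B \<omega>) x n $ i - mp_traj (B \<omega>) x n $ k
      = mp_traj (B \<omega>) 0 n $ i - mp_traj (B \<omega>) 0 n $ k} \<in> sets L"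
    by measurable
qed

lemma measurable_mp_maxentry: "mp_maxentry \<in> borel_measurable (borel :: (ereal^'d^'d) measure)"
  unfolding mp_maxentry_def
  by (intro borel_measurable_Max) (auto intro!: measurable_vec_nth)

lemma measurable_mp_minmax: "mp_minmax \<in> borel_measurable (borel :: (ereal^'d^'d) measure)"
  unfolding mp_minmax_def
  by (intro borel_measurable_Min borel_measurable_Max) (auto intro!: measurable_vec_nth)

section \<open>Products with memory loss\<close>

lemma (in prob_space) prob_gt_tendsto_0:
  fixes Z :: "'a \<Rightarrow> real"
  assumes [measurable]: "Z \<in> borel_measurable M"
  shows "(\<lambda>n. prob {\<omega>\<in>space M. real n < Z \<omega>}) \<longlonglongrightarrow> 0"
proof -
  have "(\<lambda>n. prob {\<omega>\<in>space M. real n < Z \<omega>}) \<longlonglongrightarrow> prob (\<Inter>n. {\<omega>\<in>space M. real n < Z \<omega>})"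
    by (rule finite_Lim_measure_decseq) (auto simp: decseq_def intro: le_less_trans[OF of_nat_mono])
  moreover have "(\<Inter>n. {\<omega>\<in>space M. real n < Z \<omega>}) = {}"
  proof -
    have "\<exists>n. \<not> real n < Z \<omega>" for \<omega> using real_arch_simple[of "Z \<omega>"] by (simp add: not_less)
    then show ?thesis by blast
  qed
  ultimately show ?thesis by simp
qed

lemma (in prob_space) prob_gt_small:
  fixes Z :: "'a \<Rightarrow> real"
  assumes "Z \<in> borel_measurable M" "\<epsilon> > 0"
  obtains l :: nat where "prob {\<omega>\<in>space M. real l < Z \<omega>} < \<epsilon>"
  using order_tendstoD(2)[OF prob_gt_tendsto_0[OF assms(1)] assms(2)]
  by (auto simp: eventually_sequentially)

locale memory_loss = prob_space M for M :: "'a measure" +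
  fixes A :: "nat \<Rightarrow> 'a \<Rightarrow> ereal^'d^'d" and N :: nat
  assumes valid: "n \<ge> 1 \<Longrightarrow> \<omega> \<in> space M \<Longrightarrow> mp_valid (A n \<omega>)"
    and indep: "indep_vars (\<lambda>_. borel) A {1..}"
    and ident: "n \<ge> 1 \<Longrightarrow> distr M borel (A n) = distr M borel (A 1)"
    and N_pos: "N \<ge> 1"
    and rank1_pos: "prob {\<omega>\<in>space M. mp_rank1 (mp_prod (\<lambda>k. A k \<omega>) N)} > 0"
    and mom1: "finite_second_moment M (\<lambda>\<omega>. mp_maxentry (A 1 \<omega>))"
    and mom2: "finite_second_moment M (\<lambda>\<omega>. mp_minmax (A 1 \<omega>))"
begin

lemma A_measurable: "n \<ge> 1 \<Longrightarrow> A n \<in> borel_measurable M"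
  using indep by (auto simp: indep_vars_def2)

text \<open>The family is reindexed by viewing each variable as a tuple over a singleton index set
  and then evaluating that tuple.\<close>

lemma indep_shift: "indep_vars (\<lambda>_. borel) (\<lambda>k. A (s + Suc k)) UNIV"
proof -
  have "indep_vars (\<lambda>k. PiM {s + Suc k} (\<lambda>_. borel)) (\<lambda>k \<omega>. restrict (\<lambda>i. A i \<omega>) {s + Suc k}) UNIV"
    by (rule indep_vars_restrict[OF indep]) (auto simp: disjoint_family_on_def)
  from indep_vars_compose2[OF this, of "\<lambda>k f. f (s + Suc k)" "\<lambda>_. borel"]
  show ?thesis by simp
qed

end

text \<open>Index convention: with \<open>Y k\<close> equal to \<open>A (Suc k)\<close>, the
  interval {s..<t} carries the matrices with indices s + 1 to t, those that act between the times s
  and t.\<close>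

sublocale memory_loss \<subseteq> indep_seq M borel "\<lambda>k. A (Suc k)"
  using indep_shift[of 0] by unfold_locales simp

context memory_loss
begin

section \<open>Stationarity of the driving sequence\<close>

lemma shift_measurable: "(\<lambda>\<omega> k. A (s + Suc k) \<omega>) \<in> measurable M (PiM UNIV (\<lambda>_. borel))"
proof -
  have "(\<lambda>\<omega>. \<lambda>k\<in>UNIV. A (s + Suc k) \<omega>) \<in> measurable M (PiM UNIV (\<lambda>_. borel))"
    by (intro measurable_restrict A_measurable) simp
  then show ?thesis by (simp only: restrict_UNIV)
qed

text \<open>Every shifted sequence has the same product law on sequence space; a functional of the
  sequence inherits this.\<close>

lemma distr_shift:
  assumes "\<Phi> \<in> measurable (PiM UNIV (\<lambda>_. borel)) L"
  shows "distr M L (\<lambda>\<omega>. \<Phi> (\<lambda>k. A (s + Suc k) \<omega>)) = distr M L (\<lambda>\<omega>. \<Phi> (\<lambda>k. A (Suc k) \<omega>))"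
proof -
  have law: "distr M (PiM UNIV (\<lambda>_. borel)) (\<lambda>\<omega> k. A (s + Suc k) \<omega>)
      = PiM UNIV (\<lambda>_. distr M borel (A 1))" for s
  proof -
    have "distr M (PiM UNIV (\<lambda>_. borel)) (\<lambda>\<omega>. \<lambda>k\<in>UNIV. A (s + Suc k) \<omega>)
        = PiM UNIV (\<lambda>k. distr M borel (A (s + Suc k)))"
      using indep_vars_iff_distr_eq_PiM[where I = UNIV and M' = "\<lambda>_. borel" and X = "\<lambda>k. A (s + Suc k)"]
        indep_shift[of s] A_measurable[of "s + Suc k" for k] by simp
    moreover have "distr M borel (A (s + Suc k)) = distr M borel (A 1)" for k by (rule ident) simp
    ultimately show ?thesis by (simp only: restrict_UNIV)
  qed
  have "distr M L (\<lambda>\<omega>. \<Phi> (\<lambda>k. A (s + Suc k) \<omega>)) = distr (PiM UNIV (\<lambda>_. distr M borel (A 1))) L \<Phi>" for s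
    using distr_distr[OF assms shift_measurable[of s]] unfolding law comp_def by (rule sym)
  from this[of s] this[of 0] show ?thesis by (simp only: add_0)
qed

lemma expectation_shift:
  fixes \<Phi> :: "_ \<Rightarrow> real"
  assumes \<Phi>: "\<Phi> \<in> borel_measurable (PiM UNIV (\<lambda>_. borel))"
  shows "expectation (\<lambda>\<omega>. \<Phi> (\<lambda>k. A (s + Suc k) \<omega>)) = expectation (\<lambda>\<omega>. \<Phi> (\<lambda>k. A (Suc k) \<omega>))"
proof -
  have meas: "(\<lambda>\<omega>. \<Phi> (\<lambda>k. A (s + Suc k) \<omega>)) \<in> borel_measurable M" for s
    by (rule measurable_compose[OF shift_measurable \<Phi>])
  have "expectation (\<lambda>\<omega>. \<Phi> (\<lambda>k. A (s + Suc k) \<omega>)) = (\<integral>x. x \<partial>distr M borel (\<lambda>\<omega>. \<Phi> (\<lambda>k. A (s + Suc k) \<omega>)))" for s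
    by (intro integral_distr[symmetric] meas) auto
  from this[of s] this[of 0] distr_shift[OF \<Phi>, of s] show ?thesis by (simp only: add_0)
qed

lemma ident_sq_int:
  assumes f: "f \<in> borel_measurable borel" and "sq_int M (\<lambda>\<omega>. f (A 1 \<omega>))"
  shows "sq_int M (\<lambda>\<omega>. f (A (Suc k) \<omega>))" "l2norm M (\<lambda>\<omega>. f (A (Suc k) \<omega>)) = l2norm M (\<lambda>\<omega>. f (A 1 \<omega>))"
proof -
  have f2: "(\<lambda>x. (f x)\<^sup>2) \<in> borel_measurable borel" using f by simp
  have "integrable (distr M borel (A (Suc k))) (\<lambda>x. (f x)\<^sup>2)"
    using assms integrable_distr_eq[OF A_measurable[of 1] f2] ident[of "Suc k"] by (simp add: sq_int_def)
  then show "sq_int M (\<lambda>\<omega>. f (A (Suc k) \<omega>))"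
    using integrable_distr_eq[OF A_measurable[of "Suc k"] f2] measurable_compose[OF A_measurable[of "Suc k"] f]
    by (simp add: sq_int_def)
  show "l2norm M (\<lambda>\<omega>. f (A (Suc k) \<omega>)) = l2norm M (\<lambda>\<omega>. f (A 1 \<omega>))"
    using integral_distr[OF A_measurable[of "Suc k"] f2] integral_distr[OF A_measurable[of 1] f2] ident[of "Suc k"]
    by (simp add: l2norm_def)
qed

section \<open>Trajectories, one-step gaps and survival of memory\<close>

definition shifted :: "nat \<Rightarrow> 'a \<Rightarrow> nat \<Rightarrow> ereal^'d^'d" where
  "shifted s \<omega> k = A (s + k) \<omega>"

definition X :: "nat \<Rightarrow> nat \<Rightarrow> 'a \<Rightarrow> real^'d" where
  "X s t \<omega> = mp_traj (shifted s \<omega>) 0 (t - s)"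

definition S :: "nat \<Rightarrow> nat \<Rightarrow> 'a \<Rightarrow> real" where
  "S s t \<omega> = vmax (X s t \<omega>)"

definition up :: "nat \<Rightarrow> 'a \<Rightarrow> real" where
  "up k \<omega> = real_of_ereal (mp_maxentry (A (Suc k) \<omega>))"

definition lo :: "nat \<Rightarrow> 'a \<Rightarrow> real" where
  "lo k \<omega> = real_of_ereal (mp_minmax (A (Suc k) \<omega>))"

text \<open>The absolute value keeps this nonnegative even on the null event where
  \<open>mp_minmax\<close> is infinite and \<open>real_of_ereal\<close> replaces it by 0.\<close>

definition gap :: "nat \<Rightarrow> 'a \<Rightarrow> real" where
  "gap k \<omega> = \<bar>up k \<omega> - lo k \<omega>\<bar>"

definition loss :: "nat \<Rightarrow> 'a \<Rightarrow> bool" where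
  "loss s \<omega> \<longleftrightarrow> forgets (shifted s \<omega>) N"

definition surv :: "nat \<Rightarrow> nat \<Rightarrow> 'a \<Rightarrow> real" where
  "surv s j \<omega> = of_bool (\<forall>i<j. \<not> loss (s + i * N) \<omega>)"

definition H :: "nat \<Rightarrow> 'a \<Rightarrow> real" where
  "H s \<omega> = (\<Sum>k\<in>{s..<s + N}. gap k \<omega>)"

text \<open>Block j is counted if no earlier block has lost the memory, so the first losing block is
  still included. The indicator involves only the blocks before j, which makes it independent of the
  gaps in block j.\<close>

definition G :: "nat \<Rightarrow> nat \<Rightarrow> 'a \<Rightarrow> real" where
  "G s J \<omega> = (\<Sum>j<J. surv s j \<omega> * H (s + j * N) \<omega>)"

definition good :: "'a \<Rightarrow> bool" where
  "good \<omega> \<longleftrightarrow> \<omega> \<in> space M \<and> (\<forall>k. \<bar>mp_maxentry (A (Suc k) \<omega>)\<bar> \<noteq> \<infinity> \<and> \<bar>mp_minmax (A (Suc k) \<omega>)\<bar> \<noteq> \<infinity>)"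

lemma shifted_valid: "\<omega> \<in> space M \<Longrightarrow> k \<in> {1..n} \<Longrightarrow> mp_valid (shifted s \<omega> k)"
  using valid[of "s + k"] by (auto simp: shifted_def)

lemma shifted_sig:
  assumes "k \<in> {1..n}" shows "(\<lambda>\<omega>. shifted s \<omega> k) \<in> borel_measurable (sig {s..<s + n})"
proof -
  have "s + k = Suc (s + k - 1)" "s + k - 1 \<in> {s..<s + n}" using assms by auto
  then show ?thesis using measurable_sig_Y[of "s + k - 1" "{s..<s + n}"] by (simp add: shifted_def)
qed

lemma X_sig: "s \<le> t \<Longrightarrow> (\<lambda>\<omega>. X s t \<omega> $ i) \<in> borel_measurable (sig {s..<t})"
  using measurable_mp_traj[where L = "sig {s..<s + (t - s)}" and B = "shifted s" and x = "\<lambda>_. 0" and n = "t - s",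
      OF shifted_sig] by (simp add: X_def)

lemma S_sig: "s \<le> t \<Longrightarrow> S s t \<in> borel_measurable (sig {s..<t})"
  unfolding S_def[abs_def] by (intro measurable_vmax X_sig)

lemma loss_sig: "Measurable.pred (sig {s..<s + N}) (loss s)"
  unfolding loss_def[abs_def] by (rule measurable_forgets[OF shifted_sig])

lemma surv_sig: "surv s j \<in> borel_measurable (sig {s..<s + j * N})"
proof -
  have l: "Measurable.pred (sig {s..<s + j * N}) (loss (s + i * N))" if "i < j" for i
  proof (rule measurable_sig_mono[OF loss_sig])
    have "Suc i * N \<le> j * N" using that by (intro mult_le_mono1) simp
    then show "{s + i * N..<s + i * N + N} \<subseteq> {s..<s + j * N}" by auto
  qed
  have "Measurable.pred (sig {s..<s + j * N}) (\<lambda>\<omega>. \<forall>i\<in>{..<j}. \<not> loss (s + i * N) \<omega>)"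
    by (intro pred_intros_finite(3) pred_intros_logic(2) l) auto
  then show ?thesis
    unfolding surv_def[abs_def] Ball_def lessThan_iff by measurable
qed

lemma up_measurable: "(\<lambda>x. real_of_ereal (mp_maxentry x)) \<in> borel_measurable (borel :: (ereal^'d^'d) measure)"
  by (intro borel_measurable_real_of_ereal measurable_mp_maxentry)

lemma lo_measurable: "(\<lambda>x. real_of_ereal (mp_minmax x)) \<in> borel_measurable (borel :: (ereal^'d^'d) measure)"
  by (intro borel_measurable_real_of_ereal measurable_mp_minmax)

lemma up_sq: "sq_int M (up k)"
  unfolding up_def[abs_def] using mom1
  by (intro ident_sq_int up_measurable) (auto simp: sq_int_def finite_second_moment_def)

lemma lo_sq: "sq_int M (lo k)"
  unfolding lo_def[abs_def] using mom2
  by (intro ident_sq_int lo_measurable) (auto simp: sq_int_def finite_second_moment_def)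

lemma gap_sig: "gap k \<in> borel_measurable (sig {k})"
  unfolding gap_def[abs_def] up_def lo_def
  by (intro borel_measurable_abs borel_measurable_diff measurable_compose[OF measurable_sig_Y up_measurable]
      measurable_compose[OF measurable_sig_Y lo_measurable]) auto

lemma gap_sq: "sq_int M (gap k)"
  unfolding gap_def[abs_def] by (intro sq_int_abs sq_int_diff up_sq lo_sq)

lemma gap_l2norm: "l2norm M (gap k) = l2norm M (gap 0)"
proof -
  let ?f = "\<lambda>x. \<bar>real_of_ereal (mp_maxentry x) - real_of_ereal (mp_minmax x)\<bar>"
  have "?f \<in> borel_measurable (borel :: (ereal^'d^'d) measure)"
    by (intro borel_measurable_abs borel_measurable_diff up_measurable lo_measurable)
  from ident_sq_int(2)[OF this, of k] show ?thesis
    using gap_sq[of 0] by (simp add: gap_def[abs_def] up_def lo_def)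
qed

lemma H_sig: "H s \<in> borel_measurable (sig {s..<s + N})"
  unfolding H_def[abs_def] by (intro borel_measurable_sum measurable_sig_mono[OF gap_sig]) auto

lemma H_sq: "sq_int M (H s)"
  unfolding H_def[abs_def] by (intro sq_int_sum gap_sq)

lemma H_nonneg: "0 \<le> H s \<omega>"
  by (auto simp: H_def gap_def intro: sum_nonneg)

lemma H_l2norm: "l2norm M (H s) \<le> real N * l2norm M (gap 0)"
proof -
  have "l2norm M (H s) \<le> (\<Sum>k\<in>{s..<s + N}. l2norm M (gap k))"
    unfolding H_def[abs_def] by (rule l2norm_sum[OF gap_sq])
  also have "\<dots> = (\<Sum>k\<in>{s..<s + N}. l2norm M (gap 0))" by (intro sum.cong refl gap_l2norm)
  finally show ?thesis by simp
qed

section \<open>Geometric decay of the survival indicators\<close>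

definition q :: real where "q = expectation (surv 0 1)"

lemma surv_meas: "surv s j \<in> borel_measurable M"
  by (rule measurable_sigI[OF surv_sig])

lemma surv_range: "0 \<le> surv s j \<omega>" "surv s j \<omega> \<le> 1"
  by (auto simp: surv_def)

lemma surv_integrable: "integrable M (surv s j)"
  using surv_meas surv_range by (intro integrable_const_bound[where B = 1]) auto

lemma q_range: "0 \<le> q" "q < 1"
proof -
  show "0 \<le> q" unfolding q_def using surv_range by (intro integral_nonneg_AE) auto
  have loss_M: "Measurable.pred M (loss 0)" by (rule measurable_sigI[OF loss_sig])
  have "q = expectation (indicator {\<omega>\<in>space M. \<not> loss 0 \<omega>})"
    unfolding q_def by (intro Bochner_Integration.integral_cong) (auto simp: surv_def)
  then have q: "q = 1 - prob {\<omega>\<in>space M. loss 0 \<omega>}"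
    using prob_neg[of "loss 0"] loss_M by (simp add: pred_def Int_absorb2 Collect_mono_iff)
  have "prob {\<omega>\<in>space M. mp_rank1 (mp_prod (\<lambda>k. A k \<omega>) N)} \<le> prob {\<omega>\<in>space M. loss 0 \<omega>}"
  proof (rule finite_measure_mono)
    show "{\<omega>\<in>space M. mp_rank1 (mp_prod (\<lambda>k. A k \<omega>) N)} \<subseteq> {\<omega>\<in>space M. loss 0 \<omega>}"
      using valid by (auto simp: loss_def shifted_def[abs_def] intro!: forgets_if_rank1)
  qed (use loss_M in \<open>simp add: pred_def\<close>)
  then show "q < 1" using q rank1_pos by simp
qed

lemma expectation_surv_1: "expectation (surv s 1) = q"
proof -
  \<comment> \<open>Trajectories read indices from 1 on whereas u starts at 0, hence
    \<open>k - 1\<close>.\<close>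
  let ?\<Phi> = "\<lambda>u :: nat \<Rightarrow> ereal^'d^'d. of_bool (\<not> forgets (\<lambda>k. u (k - 1)) N) :: real"
  have [measurable]: "Measurable.pred (PiM UNIV (\<lambda>_. borel)) (\<lambda>u :: nat \<Rightarrow> ereal^'d^'d. forgets (\<lambda>k. u (k - 1)) N)"
    by (rule measurable_forgets) (rule measurable_component_singleton, simp)
  have \<Phi>: "?\<Phi> \<in> borel_measurable (PiM UNIV (\<lambda>_. borel))" by measurable
  have eq: "surv s 1 \<omega> = ?\<Phi> (\<lambda>k. A (s + Suc k) \<omega>)" for s \<omega>
  proof -
    have "forgets (shifted s \<omega>) N = forgets (\<lambda>k. A (s + Suc (k - 1)) \<omega>) N"
      by (rule forgets_cong) (auto simp: shifted_def)
    then show ?thesis by (simp add: surv_def loss_def)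
  qed
  show ?thesis unfolding q_def eq using expectation_shift[OF \<Phi>, of s] expectation_shift[OF \<Phi>, of 0] by simp
qed

lemma expectation_surv: "expectation (surv s j) = q ^ j"
proof (induction j)
  case 0
  then show ?case by (simp add: surv_def prob_space)
next
  case (Suc j)
  have "surv s (Suc j) = (\<lambda>\<omega>. surv s j \<omega> * surv (s + j * N) 1 \<omega>)"
    by (auto simp: surv_def less_Suc_eq fun_eq_iff)
  moreover have "expectation (\<lambda>\<omega>. surv s j \<omega> * surv (s + j * N) 1 \<omega>)
      = expectation (surv s j) * expectation (surv (s + j * N) 1)"
    by (rule expectation_mult_sig[OF surv_sig surv_sig]) (auto intro: surv_integrable)
  ultimately show ?case using Suc by (simp only: expectation_surv_1) simp
qed

text \<open>The square root appears because the L2 norm of an indicator is the square root of its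
  probability. The maximum with 1 / 2 keeps r positive, so that division by r is possible even when
  q = 0.\<close>

definition r :: real where "r = max (sqrt q) (1 / 2)"

lemma r_range: "0 < r" "r < 1"
  using q_range by (auto simp: r_def)

text \<open>The factor \<open>surv s j\<close> takes only the values 0 and 1, so it equals its
  square, and it is independent of \<open>Z\<close>; the second moment is therefore multiplied
  exactly by the probability \<open>q ^ j\<close>.\<close>

lemma surv_mult:
  assumes "Z \<in> borel_measurable (sig K)" "sq_int M Z" "{s..<s + j * N} \<inter> K = {}"
  shows "sq_int M (\<lambda>\<omega>. surv s j \<omega> * Z \<omega>)" "l2norm M (\<lambda>\<omega>. surv s j \<omega> * Z \<omega>) \<le> r ^ j * l2norm M Z"
proof -
  have [measurable]: "surv s j \<in> borel_measurable M" "Z \<in> borel_measurable M"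
    using surv_meas assms by (auto simp: sq_int_def)
  show "sq_int M (\<lambda>\<omega>. surv s j \<omega> * Z \<omega>)"
  proof (rule sq_int_AE_mono(1)[OF assms(2)])
    show "AE \<omega> in M. \<bar>surv s j \<omega> * Z \<omega>\<bar> \<le> \<bar>Z \<omega>\<bar>"
      using surv_range by (simp add: abs_mult mult_left_le_one_le)
  qed measurable
  have "(l2norm M (\<lambda>\<omega>. surv s j \<omega> * Z \<omega>))\<^sup>2 = expectation (\<lambda>\<omega>. surv s j \<omega> * (Z \<omega>)\<^sup>2)"
    unfolding l2norm_square by (intro Bochner_Integration.integral_cong) (auto simp: surv_def)
  also have "\<dots> = expectation (surv s j) * expectation (\<lambda>\<omega>. (Z \<omega>)\<^sup>2)"
    using assms by (intro expectation_mult_sig[OF surv_sig _ assms(3)] borel_measurable_power surv_integrable)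
      (auto simp: sq_int_def)
  also have "\<dots> = (sqrt q ^ j * l2norm M Z)\<^sup>2"
  proof -
    have "sqrt q ^ j * sqrt q ^ j = (sqrt q * sqrt q) ^ j" by (rule power_mult_distrib[symmetric])
    then have "(sqrt q ^ j)\<^sup>2 = q ^ j" using q_range by (simp add: power2_eq_square)
    then show ?thesis by (simp only: expectation_surv l2norm_square power_mult_distrib)
  qed
  finally have "l2norm M (\<lambda>\<omega>. surv s j \<omega> * Z \<omega>) = sqrt q ^ j * l2norm M Z"
    by (rule power2_eq_imp_eq) (use q_range in auto)
  also have "\<dots> \<le> r ^ j * l2norm M Z"
    using q_range by (intro mult_right_mono power_mono) (auto simp: r_def)
  finally show "l2norm M (\<lambda>\<omega>. surv s j \<omega> * Z \<omega>) \<le> r ^ j * l2norm M Z" .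
qed

text \<open>The geometric series in r with the norm bound of one block of N gaps as its first
  term.\<close>

definition C0 :: real where "C0 = real N * l2norm M (gap 0) / (1 - r)"

lemma G_sq: "sq_int M (G s J)"
  unfolding G_def[abs_def] by (intro sq_int_sum surv_mult[OF H_sig H_sq]) auto

lemma G_sig: "G s J \<in> borel_measurable (sig {s..<s + J * N})"
  unfolding G_def[abs_def]
proof (intro borel_measurable_sum borel_measurable_times)
  fix j assume "j \<in> {..<J}"
  then have "Suc j * N \<le> J * N" by (intro mult_le_mono1) simp
  then have *: "j * N + N \<le> J * N" by simp
  then have **: "j * N \<le> J * N" by linarith
  show "surv s j \<in> borel_measurable (sig {s..<s + J * N})"
    using ** by (intro measurable_sig_mono[OF surv_sig] ivl_subset[THEN iffD2] disjI2 conjI) linarith+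
  show "H (s + j * N) \<in> borel_measurable (sig {s..<s + J * N})"
    by (rule measurable_sig_mono[OF H_sig]) (use * in auto)
qed

lemma G_nonneg: "0 \<le> G s J \<omega>"
  unfolding G_def by (intro sum_nonneg mult_nonneg_nonneg surv_range H_nonneg)

lemma G_l2norm: "l2norm M (G s J) \<le> C0"
proof -
  let ?h = "real N * l2norm M (gap 0)"
  have "l2norm M (G s J) \<le> (\<Sum>j<J. l2norm M (\<lambda>\<omega>. surv s j \<omega> * H (s + j * N) \<omega>))"
    unfolding G_def[abs_def] by (intro l2norm_sum surv_mult[OF H_sig H_sq]) auto
  also have "\<dots> \<le> (\<Sum>j<J. r ^ j * ?h)"
  proof (rule sum_mono)
    fix j
    have "l2norm M (\<lambda>\<omega>. surv s j \<omega> * H (s + j * N) \<omega>) \<le> r ^ j * l2norm M (H (s + j * N))"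
      by (rule surv_mult[OF H_sig H_sq]) auto
    also have "\<dots> \<le> r ^ j * ?h" using r_range H_l2norm by (intro mult_left_mono) auto
    finally show "l2norm M (\<lambda>\<omega>. surv s j \<omega> * H (s + j * N) \<omega>) \<le> r ^ j * ?h" .
  qed
  also have "\<dots> = (\<Sum>j<J. r ^ j) * ?h" by (simp add: sum_distrib_right)
  also have "(\<Sum>j<J. r ^ j) \<le> 1 / (1 - r)"
    using r_range by (simp add: sum_gp_strict divide_right_mono)
  finally show ?thesis by (simp add: C0_def mult_right_mono)
qed

section \<open>Pathwise bounds on trajectories and defects\<close>

lemma AE_good: "AE \<omega> in M. good \<omega>"
proof -
  have "AE \<omega> in M. \<bar>f (A (Suc k) \<omega>)\<bar> \<noteq> \<infinity>"
    if f: "f \<in> borel_measurable borel" and 1: "AE \<omega> in M. \<bar>f (A 1 \<omega>)\<bar> \<noteq> \<infinity>"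
    for f :: "ereal^'d^'d \<Rightarrow> ereal" and k
  proof -
    have set: "{x \<in> space borel. \<bar>f x\<bar> \<noteq> \<infinity>} \<in> sets borel" using f by measurable
    have A: "A 1 \<in> borel_measurable M" "A (Suc k) \<in> borel_measurable M" by (auto intro: A_measurable)
    have eq: "distr M borel (A (Suc k)) = distr M borel (A 1)" by (rule ident) simp
    show ?thesis
      using 1 unfolding AE_distr_iff[OF A(1) set, symmetric] AE_distr_iff[OF A(2) set, symmetric] eq .
  qed
  from this[OF measurable_mp_maxentry] this[OF measurable_mp_minmax]
  have "AE \<omega> in M. \<bar>mp_maxentry (A (Suc k) \<omega>)\<bar> \<noteq> \<infinity> \<and> \<bar>mp_minmax (A (Suc k) \<omega>)\<bar> \<noteq> \<infinity>" for k
    using mom1 mom2 unfolding finite_second_moment_def by (intro AE_conjI) blast+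
  then have "AE \<omega> in M. \<forall>k. \<bar>mp_maxentry (A (Suc k) \<omega>)\<bar> \<noteq> \<infinity> \<and> \<bar>mp_minmax (A (Suc k) \<omega>)\<bar> \<noteq> \<infinity>"
    by (simp only: AE_all_countable) simp
  then show ?thesis unfolding good_def using AE_space by eventually_elim auto
qed

lemma traj_bounds:
  assumes "good \<omega>"
  shows "vmax x + (\<Sum>k\<in>{s..<s + n}. lo k \<omega>) \<le> vmax (mp_traj (shifted s \<omega>) x n)" (is ?lo)
    and "vmax (mp_traj (shifted s \<omega>) x n) \<le> vmax x + (\<Sum>k\<in>{s..<s + n}. up k \<omega>)" (is ?up)
proof -
  have "?lo \<and> ?up"
  proof (induction n)
    case (Suc n)
    have v: "mp_valid (A (Suc (s + n)) \<omega>)" using assms valid by (auto simp: good_def)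
    have f: "\<bar>mp_maxentry (A (Suc (s + n)) \<omega>)\<bar> \<noteq> \<infinity>" "\<bar>mp_minmax (A (Suc (s + n)) \<omega>)\<bar> \<noteq> \<infinity>"
      using assms by (auto simp: good_def)
    let ?x = "mp_traj (shifted s \<omega>) x n"
    have "vmax ?x + lo (s + n) \<omega> \<le> vmax (mp_apply (A (Suc (s + n)) \<omega>) ?x)"
      "vmax (mp_apply (A (Suc (s + n)) \<omega>) ?x) \<le> vmax ?x + up (s + n) \<omega>"
      unfolding lo_def up_def by (rule vmax_mp_apply_ge[OF v f(2)], rule vmax_mp_apply_le[OF v f(1)])
    moreover have "mp_traj (shifted s \<omega>) x (Suc n) = mp_apply (A (Suc (s + n)) \<omega>) ?x"
      by (simp add: shifted_def)
    moreover have "{s..<s + Suc n} = insert (s + n) {s..<s + n}" by auto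
    ultimately show ?case using Suc by simp
  qed simp
  then show ?lo ?up by auto
qed

lemma X_flow:
  assumes "s \<le> t" "t \<le> u" shows "X s u \<omega> = mp_traj (shifted t \<omega>) (X s t \<omega>) (u - t)"
proof -
  have "mp_traj (shifted s \<omega>) 0 ((t - s) + (u - t)) = mp_traj (\<lambda>k. shifted s \<omega> ((t - s) + k)) (X s t \<omega>) (u - t)"
    unfolding X_def by (rule mp_traj_shift)
  moreover have "(\<lambda>k. shifted s \<omega> ((t - s) + k)) = shifted t \<omega>"
    using assms by (simp add: shifted_def fun_eq_iff)
  ultimately show ?thesis using assms by (simp add: X_def)
qed

text \<open>After the losing block the two trajectories differ by a constant vector, and all later
  operators preserve this by homogeneity.\<close>

lemma loss_forgets:
  assumes "\<omega> \<in> space M" "loss v \<omega>" "N \<le> n"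
  obtains c where "\<And>i. mp_traj (shifted v \<omega>) x n $ i = mp_traj (shifted v \<omega>) y n $ i + c"
proof -
  obtain c where c: "mp_traj (shifted v \<omega>) x N $ i = mp_traj (shifted v \<omega>) y N $ i + c" for i
    using forgetsD[of N "shifted v \<omega>" x y] shifted_valid[OF assms(1)] assms(2) unfolding loss_def by blast
  have n: "n = N + (n - N)" using assms by simp
  have "mp_traj (shifted v \<omega>) x n $ i = mp_traj (shifted v \<omega>) y n $ i + c" for i
  proof -
    have "mp_valid (shifted v \<omega> (N + k))" if "k \<in> {1..n - N}" for k
      using that by (intro shifted_valid[OF assms(1), of _ n]) auto
    from mp_traj_add_const[of "n - N" "\<lambda>k. shifted v \<omega> (N + k)", OF this c] show ?thesis
      by (subst (1 2) n) (simp only: mp_traj_shift)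
  qed
  then show ?thesis by (rule that)
qed

text \<open>The different pasts only determine two different vectors at time v, and the block that
  starts there erases the difference up to a constant.\<close>

lemma loss_X:
  assumes "\<omega> \<in> space M" "loss v \<omega>" "s \<le> v" "s' \<le> v" "v + N \<le> t"
  obtains c where "\<And>i. X s t \<omega> $ i = X s' t \<omega> $ i + c"
proof -
  obtain c where "mp_traj (shifted v \<omega>) (X s v \<omega>) (t - v) $ i
      = mp_traj (shifted v \<omega>) (X s' v \<omega>) (t - v) $ i + c" for i
    by (rule loss_forgets[OF assms(1,2), of "t - v" "X s v \<omega>" "X s' v \<omega>"]) (use assms(5) in auto)
  then show ?thesis using assms by (intro that[of c]) (simp add: X_flow[of _ v t])
qed

definition defect :: "nat \<Rightarrow> nat \<Rightarrow> nat \<Rightarrow> 'a \<Rightarrow> real" where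
  "defect s t u \<omega> = S s t \<omega> + S t u \<omega> - S s u \<omega>"

text \<open>The vector \<open>X s t\<close> lies below the constant vector with entries
  \<open>S s t\<close>, and this comparison is transported from t to u.\<close>

lemma defect_nonneg:
  assumes "\<omega> \<in> space M" "s \<le> t" "t \<le> u" shows "0 \<le> defect s t u \<omega>"
proof -
  have "mp_traj (shifted t \<omega>) (X s t \<omega>) (u - t) $ i \<le> X t u \<omega> $ i + S s t \<omega>" for i
    unfolding X_def[of t u]
    using shifted_valid[OF assms(1)] by (intro mp_traj_mono_plus) (auto simp: S_def vmax_ge)
  then have "X s u \<omega> $ i \<le> X t u \<omega> $ i + S s t \<omega>" for i
    by (simp only: X_flow[OF assms(2,3), of \<omega>])
  moreover have "X t u \<omega> $ i \<le> S t u \<omega>" for i unfolding S_def by (rule vmax_ge)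
  ultimately have "X s u \<omega> $ i \<le> S t u \<omega> + S s t \<omega>" for i
    by (meson add_right_mono order_trans)
  then show ?thesis by (simp add: defect_def S_def[of s u] vmax_le_iff add.commute)
qed

text \<open>From t to u the largest coordinate moves by an amount between the sums of
  \<open>lo\<close> and \<open>up\<close>, whether the vector at time t is 0 or
  \<open>X s t\<close>. The resulting bound does not see the past before t.\<close>

lemma defect_le_gaps:
  assumes "good \<omega>" "s \<le> t" "t \<le> u" shows "defect s t u \<omega> \<le> (\<Sum>k\<in>{t..<u}. gap k \<omega>)"
proof -
  have "S t u \<omega> \<le> (\<Sum>k\<in>{t..<u}. up k \<omega>)"
    using traj_bounds(2)[OF assms(1), of t 0 "u - t"] assms(3) by (simp add: S_def X_def)
  moreover have "S s t \<omega> + (\<Sum>k\<in>{t..<u}. lo k \<omega>) \<le> S s u \<omega>"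
    using traj_bounds(1)[OF assms(1), of "X s t \<omega>" t "u - t"] assms
    by (simp add: S_def X_flow[of s t u])
  ultimately have "defect s t u \<omega> \<le> (\<Sum>k\<in>{t..<u}. up k \<omega>) - (\<Sum>k\<in>{t..<u}. lo k \<omega>)"
    by (simp add: defect_def)
  also have "\<dots> \<le> (\<Sum>k\<in>{t..<u}. gap k \<omega>)"
    unfolding sum_subtractf[symmetric] by (intro sum_mono) (simp add: gap_def)
  finally show ?thesis .
qed

lemma gaps_eq_H: "(\<Sum>k\<in>{t..<t + j * N}. gap k \<omega>) = (\<Sum>i<j. H (t + i * N) \<omega>)"
proof (induction j)
  case (Suc j)
  have "(\<Sum>k\<in>{t..<t + Suc j * N}. gap k \<omega>)
      = (\<Sum>k\<in>{t..<t + j * N}. gap k \<omega>) + (\<Sum>k\<in>{t + j * N..<t + Suc j * N}. gap k \<omega>)"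
    by (intro sum.atLeastLessThan_concat[symmetric]) auto
  then show ?case using Suc by (simp add: H_def algebra_simps)
qed simp

text \<open>Once a block after \<open>t\<close> has lost the memory, the defect no longer changes; before that it is
  bounded by the gaps accumulated since \<open>t\<close>.\<close>

lemma defect_le_G:
  assumes "good \<omega>" "s \<le> t" "t \<le> u"
  shows "defect s t u \<omega> \<le> G t (Suc ((u - t) div N)) \<omega>"
proof -
  \<comment> \<open>J blocks of length N starting at t cover {t..<u}. The last one always reaches
    beyond u, so exactly the first J - 1 are complete.\<close>
  define J where "J = Suc ((u - t) div N)"
  have J: "u \<le> t + J * N" "(J - 1) * N \<le> u - t"
  proof -
    have "u - t < N + (u - t) div N * N"
      using N_pos div_mult_mod_eq[of "u - t" N] mod_less_divisor[of N "u - t"] by linarith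
    then show "u \<le> t + J * N" unfolding J_def mult_Suc by linarith
    show "(J - 1) * N \<le> u - t" by (simp add: J_def)
  qed
  define P where "P j \<longleftrightarrow> t + Suc j * N \<le> u \<and> loss (t + j * N) \<omega>" for j
  have "\<omega> \<in> space M" using assms by (simp add: good_def)
  \<comment> \<open>The first j terms of \<open>G\<close> are all counted as soon as the first j - 1
    blocks survive, whence \<open>Suc i < j\<close>.\<close>
  have G_ge: "(\<Sum>i<j. H (t + i * N) \<omega>) \<le> G t J \<omega>"
    if "j \<le> J" "\<And>i. Suc i < j \<Longrightarrow> \<not> loss (t + i * N) \<omega>" for j
  proof -
    have "(\<Sum>i<j. H (t + i * N) \<omega>) = (\<Sum>i<j. surv t i \<omega> * H (t + i * N) \<omega>)"
      using that(2) by (intro sum.cong refl) (auto simp: surv_def)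
    also have "\<dots> \<le> G t J \<omega>"
      unfolding G_def using that(1) surv_range H_nonneg by (intro sum_mono2) auto
    finally show ?thesis .
  qed
  show ?thesis
  proof (cases "\<exists>j. P j")
    case True
    define j where "j = (LEAST j. P j)"
    have j: "P j" unfolding j_def using True by (rule LeastI_ex)
    have nl: "\<not> loss (t + i * N) \<omega>" if "i < j" for i
    proof -
      have "Suc i * N \<le> Suc j * N" using that by (intro mult_le_mono1) simp
      then have "t + Suc i * N \<le> u" using conjunct1[OF j[unfolded P_def]] by linarith
      moreover have "\<not> P i" using not_less_Least[of i P] that by (simp add: j_def)
      ultimately show ?thesis unfolding P_def by blast
    qed
    define v where "v = t + Suc j * N"
    have v: "t \<le> v" "v \<le> u" using j by (auto simp: v_def P_def)
    have jJ: "Suc j \<le> J"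
    proof (rule ccontr)
      assume "\<not> Suc j \<le> J"
      then have "Suc ((u - t) div N) \<le> j" by (simp add: J_def)
      then have "Suc (Suc ((u - t) div N)) * N \<le> Suc j * N" by (intro mult_le_mono1) simp
      then show False using j J N_pos by (simp add: P_def J_def)
    qed
    obtain c where c: "X s v \<omega> $ i = X t v \<omega> $ i + c" for i
      using loss_X[of \<omega> "t + j * N" s t v] j assms \<open>\<omega> \<in> space M\<close> by (auto simp: P_def v_def add_ac)
    have "mp_traj (shifted v \<omega>) (X s v \<omega>) (u - v) $ i = mp_traj (shifted v \<omega>) (X t v \<omega>) (u - v) $ i + c" for i
      using shifted_valid[OF \<open>\<omega> \<in> space M\<close>] c by (intro mp_traj_add_const) auto
    then have "X s u \<omega> $ i = X t u \<omega> $ i + c" for i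
      using v assms by (simp add: X_flow[of _ v u])
    then have "S s u \<omega> = S t u \<omega> + c" "S s v \<omega> = S t v \<omega> + c"
      using c unfolding S_def by (intro vmax_add_const; simp)+
    \<comment> \<open>The same c shifts both \<open>S s v\<close> and \<open>S s u\<close> relative
      to the start t, so it cancels and time u can be pulled back to v, the end of the first losing
      block.\<close>
    then have "defect s t u \<omega> = defect s t v \<omega>" by (simp add: defect_def)
    also have "\<dots> \<le> (\<Sum>i<Suc j. H (t + i * N) \<omega>)"
      using defect_le_gaps[OF assms(1,2) v(1)] unfolding v_def gaps_eq_H .
    also have "\<dots> \<le> G t J \<omega>" by (rule G_ge[OF jJ]) (use nl in auto)
    finally show ?thesis by (simp add: J_def)
  next
    case False
    have nl: "\<not> loss (t + i * N) \<omega>" if "Suc i < J" for i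
    proof -
      have "Suc i * N \<le> (J - 1) * N" using that by (intro mult_le_mono1) simp
      then have "t + Suc i * N \<le> u" using J(2) assms by linarith
      then show ?thesis using False by (auto simp: P_def)
    qed
    have "defect s t u \<omega> \<le> (\<Sum>k\<in>{t..<u}. gap k \<omega>)" by (rule defect_le_gaps[OF assms])
    also have "\<dots> \<le> (\<Sum>k\<in>{t..<t + J * N}. gap k \<omega>)"
      using J by (intro sum_mono2) (auto simp: gap_def)
    also have "\<dots> \<le> G t J \<omega>" unfolding gaps_eq_H by (rule G_ge) (use nl in auto)
    finally show ?thesis by (simp add: J_def)
  qed
qed

text \<open>Changing the start from s' to s adds the same constant c to the values at t and at u,
  and the defect contains them with opposite signs.\<close>

lemma defect_start:
  assumes "\<omega> \<in> space M" "s \<le> v" "s' \<le> v" "v + N \<le> t" "t \<le> u" "loss v \<omega>"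
  shows "defect s t u \<omega> = defect s' t u \<omega>"
proof -
  obtain c where c: "X s t \<omega> $ i = X s' t \<omega> $ i + c" for i
    using loss_X[OF assms(1,6,2,3,4)] by blast
  have "mp_traj (shifted t \<omega>) (X s t \<omega>) (u - t) $ i = mp_traj (shifted t \<omega>) (X s' t \<omega>) (u - t) $ i + c" for i
    using shifted_valid[OF assms(1)] c by (intro mp_traj_add_const) auto
  then have "X s u \<omega> $ i = X s' u \<omega> $ i + c" for i
    using assms by (simp add: X_flow[of _ t u])
  then have "S s u \<omega> = S s' u \<omega> + c" "S s t \<omega> = S s' t \<omega> + c"
    using c unfolding S_def by (intro vmax_add_const; simp)+
  then show ?thesis by (simp add: defect_def)
qed

text \<open>Without survival between s' and t the two defects agree; otherwise both lie in the
  interval from 0 to \<open>G\<close>. The two factors use matrices before and after t respectively,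
  so their L2 norm can be computed by independence.\<close>

lemma defect_diff_le:
  assumes "good \<omega>" "s \<le> s'" "s' \<le> t" "t \<le> u"
  shows "\<bar>defect s t u \<omega> - defect s' t u \<omega>\<bar> \<le> surv s' ((t - s') div N) \<omega> * G t (Suc ((u - t) div N)) \<omega>"
proof (cases "\<exists>i<(t - s') div N. loss (s' + i * N) \<omega>")
  case True
  then obtain i where i: "i < (t - s') div N" "loss (s' + i * N) \<omega>" by blast
  have "Suc i * N \<le> (t - s') div N * N" using i by (intro mult_le_mono1) simp
  also have "\<dots> \<le> t - s'" by (rule div_times_less_eq_dividend)
  finally have "s' + i * N + N \<le> t" using assms by simp
  then have "defect s t u \<omega> = defect s' t u \<omega>"
    using assms i by (intro defect_start[of _ _ "s' + i * N"]) (auto simp: good_def)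
  then show ?thesis using surv_range G_nonneg by simp
next
  case False
  have "0 \<le> defect s t u \<omega>" "0 \<le> defect s' t u \<omega>"
    using assms by (auto intro!: defect_nonneg simp: good_def)
  moreover have "defect s t u \<omega> \<le> G t (Suc ((u - t) div N)) \<omega>" "defect s' t u \<omega> \<le> G t (Suc ((u - t) div N)) \<omega>"
    using assms by (auto intro!: defect_le_G)
  moreover have "surv s' ((t - s') div N) \<omega> = 1" using False by (simp add: surv_def)
  ultimately show ?thesis by simp
qed

section \<open>Verification of the almost additive structure\<close>

lemma S_sq: "s \<le> t \<Longrightarrow> sq_int M (S s t)"
proof -
  assume st: "s \<le> t"
  let ?B = "\<lambda>\<omega>. \<Sum>k\<in>{s..<t}. \<bar>up k \<omega>\<bar> + \<bar>lo k \<omega>\<bar>"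
  have B: "sq_int M ?B" by (intro sq_int_sum sq_int_add sq_int_abs up_sq lo_sq)
  show ?thesis
  proof (rule sq_int_AE_mono(1)[OF B])
    show "S s t \<in> borel_measurable M" by (rule measurable_sigI[OF S_sig[OF st]])
    show "AE \<omega> in M. \<bar>S s t \<omega>\<bar> \<le> \<bar>?B \<omega>\<bar>"
      using AE_good
    proof eventually_elim
      case (elim \<omega>)
      have "(\<Sum>k\<in>{s..<t}. lo k \<omega>) \<le> S s t \<omega>" "S s t \<omega> \<le> (\<Sum>k\<in>{s..<t}. up k \<omega>)"
        using traj_bounds(1)[OF elim, of 0 s "t - s"] traj_bounds(2)[OF elim, of s 0 "t - s"] st
        by (simp_all add: S_def X_def)
      moreover have "(\<Sum>k\<in>{s..<t}. up k \<omega>) \<le> ?B \<omega>" by (intro sum_mono) simp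
      moreover have "- (\<Sum>k\<in>{s..<t}. lo k \<omega>) \<le> ?B \<omega>" unfolding sum_negf[symmetric] by (intro sum_mono) simp
      ultimately show ?case by linarith
    qed
  qed
qed

text \<open>Stated for a general f since it is needed both for \<open>vmax\<close> and for
  \<open>spread\<close>.\<close>

lemma distr_functional_X:
  assumes "f \<in> borel_measurable borel" "s \<le> t"
  shows "distr M borel (\<lambda>\<omega>. f (X s t \<omega>)) = distr M borel (\<lambda>\<omega>. f (X 0 (t - s) \<omega>))"
proof -
  let ?\<Phi> = "\<lambda>u :: nat \<Rightarrow> ereal^'d^'d. f (mp_traj (\<lambda>k. u (k - 1)) 0 (t - s))"
  have "(\<lambda>u :: nat \<Rightarrow> ereal^'d^'d. mp_traj (\<lambda>k. u (k - 1)) 0 (t - s)) \<in> borel_measurable (PiM UNIV (\<lambda>_. borel))"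
    by (intro measurable_vec measurable_mp_traj measurable_component_singleton) auto
  then have \<Phi>: "?\<Phi> \<in> borel_measurable (PiM UNIV (\<lambda>_. borel))"
    by (rule measurable_compose[OF _ assms(1)])
  have eq: "f (X v (v + (t - s)) \<omega>) = ?\<Phi> (\<lambda>k. A (v + Suc k) \<omega>)" for v \<omega>
  proof -
    have "mp_traj (shifted v \<omega>) 0 (t - s) = mp_traj (\<lambda>k. A (v + Suc (k - 1)) \<omega>) 0 (t - s)"
      by (rule mp_traj_cong) (auto simp: shifted_def)
    then show ?thesis unfolding X_def by simp
  qed
  show ?thesis
    using distr_shift[OF \<Phi>, of s] distr_shift[OF \<Phi>, of 0] eq[of s] eq[of 0] assms(2) by simp
qed

lemma almost_additive_S:
  obtains C \<rho> where "almost_additive M borel (\<lambda>k. A (Suc k)) S C \<rho>"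
proof -
  \<comment> \<open>A factor r per block of length N becomes a factor \<rho> per time step.\<close>
  define \<rho> where "\<rho> = root N r"
  have \<rho>: "0 < \<rho>" "\<rho> < 1" "\<rho> ^ N = r"
    using r_range N_pos by (auto simp: \<rho>_def real_root_pow_pos)
  have C0: "0 \<le> C0" using G_l2norm[of 0 0] l2norm_nonneg order_trans by blast
  \<comment> \<open>The division by r pays for rounding down in \<open>d div N\<close>: one more
    factor r is \<rho> to the power N, at most \<rho> to the power \<open>d mod N\<close>.\<close>
  have decay: "r ^ (d div N) * C0 \<le> C0 / r * \<rho> ^ d" for d
  proof -
    have "r * r ^ (d div N) = r ^ (d div N) * \<rho> ^ N" by (simp add: \<rho>)
    also have "\<dots> \<le> r ^ (d div N) * \<rho> ^ (d mod N)"
      using \<rho> r_range N_pos by (intro mult_left_mono power_decreasing) auto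
    also have "\<dots> = \<rho> ^ (N * (d div N) + d mod N)" by (simp only: power_add power_mult \<rho>(3))
    also have "\<dots> = \<rho> ^ d" by simp
    finally have "C0 * (r * r ^ (d div N)) \<le> C0 * \<rho> ^ d" by (rule mult_left_mono[OF _ C0])
    then show ?thesis using r_range by (simp add: field_simps)
  qed
  have defect_meas: "(\<lambda>\<omega>. defect s t u \<omega>) \<in> borel_measurable M" if "s \<le> t" "t \<le> u" for s t u
    unfolding defect_def using that by (intro borel_measurable_add borel_measurable_diff measurable_sigI[OF S_sig]) auto
  have "almost_additive M borel (\<lambda>k. A (Suc k)) S (C0 / r) \<rho>"
  proof (unfold_locales, unfold defect_def[symmetric])
    show "S s t \<in> borel_measurable (sig {s..<t})" if "s \<le> t" for s t by (rule S_sig[OF that])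
    show "S s s = (\<lambda>_. 0)" for s by (simp add: S_def X_def fun_eq_iff)
    show "sq_int M (S s t)" if "s \<le> t" for s t by (rule S_sq[OF that])
    show "distr M borel (S s t) = distr M borel (S 0 (t - s))" if "s \<le> t" for s t
    proof -
      have "vmax \<in> borel_measurable (borel :: (real^'d) measure)"
        by (intro measurable_vmax measurable_vec_nth) simp
      from distr_functional_X[OF this that] show ?thesis by (simp add: S_def[abs_def])
    qed
    show "l2norm M (\<lambda>\<omega>. defect s t u \<omega>) \<le> C0 / r" if "s \<le> t" "t \<le> u" for s t u
    proof -
      have "l2norm M (\<lambda>\<omega>. defect s t u \<omega>) \<le> l2norm M (G t (Suc ((u - t) div N)))"
      proof (rule sq_int_AE_mono(2)[OF G_sq defect_meas[OF that]])
        show "AE \<omega> in M. \<bar>defect s t u \<omega>\<bar> \<le> \<bar>G t (Suc ((u - t) div N)) \<omega>\<bar>"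
          using AE_good
        proof eventually_elim
          case (elim \<omega>)
          then show ?case
            using defect_nonneg[of \<omega> s t u] defect_le_G[OF elim that] that by (simp add: good_def)
        qed
      qed
      also have "\<dots> \<le> C0" by (rule G_l2norm)
      also have "\<dots> \<le> C0 / r" using C0 r_range by (simp add: field_simps mult_left_le)
      finally show ?thesis .
    qed
    show "l2norm M (\<lambda>\<omega>. defect s t u \<omega> - defect s' t u \<omega>) \<le> C0 / r * \<rho> ^ (t - s')"
      if "s \<le> s'" "s' \<le> t" "t \<le> u" for s s' t u
    proof -
      let ?K = "(t - s') div N" and ?G = "G t (Suc ((u - t) div N))"
      have "?K * N \<le> t - s'" by (rule div_times_less_eq_dividend)
      then have le: "s' + ?K * N \<le> t" using that by linarith
      have disj: "{s'..<s' + ?K * N} \<inter> {t..<t + Suc ((u - t) div N) * N} = {}"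
      proof (rule equals0I)
        fix x assume "x \<in> {s'..<s' + ?K * N} \<inter> {t..<t + Suc ((u - t) div N) * N}"
        then have "x < s' + ?K * N" "t \<le> x" by (simp_all only: Int_iff atLeastLessThan_iff)
        then show False using le by linarith
      qed
      note surv = surv_mult[OF G_sig G_sq disj]
      have "l2norm M (\<lambda>\<omega>. defect s t u \<omega> - defect s' t u \<omega>) \<le> l2norm M (\<lambda>\<omega>. surv s' ?K \<omega> * ?G \<omega>)"
      proof (rule sq_int_AE_mono(2)[OF surv(1)])
        show "(\<lambda>\<omega>. defect s t u \<omega> - defect s' t u \<omega>) \<in> borel_measurable M"
          using that by (intro borel_measurable_diff defect_meas) auto
        show "AE \<omega> in M. \<bar>defect s t u \<omega> - defect s' t u \<omega>\<bar> \<le> \<bar>surv s' ?K \<omega> * ?G \<omega>\<bar>"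
          using AE_good by eventually_elim (rule order_trans[OF defect_diff_le[OF _ that] abs_ge_self])
      qed
      also have "\<dots> \<le> r ^ ?K * l2norm M ?G" by (rule surv(2))
      also have "\<dots> \<le> r ^ ?K * C0" using r_range G_l2norm by (intro mult_left_mono) auto
      also have "\<dots> \<le> C0 / r * \<rho> ^ (t - s')" by (rule decay)
      finally show ?thesis .
    qed
  qed (use \<rho> in auto)
  then show ?thesis by (rule that)
qed

lemma X_measurable: "s \<le> t \<Longrightarrow> X s t \<in> borel_measurable M"
  by (intro measurable_vec measurable_sigI[OF X_sig])

text \<open>All coordinates stay within a tight distance of the maximum: if one of the last \<open>K\<close> blocks
  has lost the memory, then \<open>x(n, 0)\<close> differs by a constant vector from a trajectory of length
  \<open>K N\<close>.\<close>

lemma spread_tight: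
  assumes "\<epsilon> > 0"
  obtains l :: nat where "\<forall>\<^sub>F n in sequentially. prob {\<omega>\<in>space M. real l < spread (X 0 n \<omega>)} < \<epsilon>"
proof -
  have "(\<lambda>K. q ^ K) \<longlonglongrightarrow> 0" using q_range by (intro LIMSEQ_realpow_zero) auto
  then obtain K where K: "q ^ K < \<epsilon> / 2"
    using order_tendstoD(2)[of "\<lambda>K. q ^ K" 0 sequentially "\<epsilon> / 2"] assms by (auto simp: eventually_sequentially)
  have meas: "(\<lambda>\<omega>. spread (X s t \<omega>)) \<in> borel_measurable M" if "s \<le> t" for s t
    by (rule measurable_compose[OF X_measurable[OF that] spread_measurable])
  obtain l :: nat where l: "prob {\<omega>\<in>space M. real l < spread (X 0 (K * N) \<omega>)} < \<epsilon> / 2"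
    using prob_gt_small[OF meas[of 0 "K * N"], of "\<epsilon> / 2"] assms by auto
  have "prob {\<omega>\<in>space M. real l < spread (X 0 n \<omega>)} < \<epsilon>" if n: "n \<ge> K * N" for n
  proof -
    define s where "s = n - K * N"
    have s: "s \<le> n" "n - s = K * N" using n by (auto simp: s_def)
    have [measurable]: "(\<lambda>\<omega>. spread (X s n \<omega>)) \<in> borel_measurable M" "(\<lambda>\<omega>. spread (X 0 n \<omega>)) \<in> borel_measurable M"
      "(\<lambda>\<omega>. spread (X 0 (K * N) \<omega>)) \<in> borel_measurable M" "surv s K \<in> borel_measurable M"
      using meas s surv_meas by auto
    have sub: "{\<omega>\<in>space M. real l < spread (X 0 n \<omega>)}
        \<subseteq> {\<omega>\<in>space M. real l < spread (X s n \<omega>)} \<union> {\<omega>\<in>space M. surv s K \<omega> = 1}"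
    proof safe
      fix \<omega> assume \<omega>: "\<omega> \<in> space M" "real l < spread (X 0 n \<omega>)" "surv s K \<omega> \<noteq> 1"
      then obtain i where i: "i < K" "loss (s + i * N) \<omega>" by (auto simp: surv_def)
      have "Suc i * N \<le> K * N" using i by (intro mult_le_mono1) simp
      then have "s + i * N + N \<le> n" using n by (simp add: s_def)
      from loss_X[OF \<omega>(1) i(2), of 0 s n] this obtain c where c: "\<And>i. X 0 n \<omega> $ i = X s n \<omega> $ i + c" by auto
      have "spread (X 0 n \<omega>) = spread (X s n \<omega>)"
        unfolding spread_def vmax_add_const[OF c] by (simp add: c)
      then show "real l < spread (X s n \<omega>)" using \<omega> by simp
    qed
    have "prob {\<omega>\<in>space M. real l < spread (X 0 n \<omega>)}
        \<le> prob {\<omega>\<in>space M. real l < spread (X s n \<omega>)} + prob {\<omega>\<in>space M. surv s K \<omega> = 1}"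
      by (rule order_trans[OF finite_measure_mono[OF sub] measure_Un_le]) measurable
    also have "prob {\<omega>\<in>space M. surv s K \<omega> = 1} = q ^ K"
    proof -
      have "expectation (surv s K) = expectation (indicator {\<omega>\<in>space M. surv s K \<omega> = 1})"
        by (intro Bochner_Integration.integral_cong) (auto simp: surv_def)
      then show ?thesis by (simp add: expectation_surv Int_absorb2 Collect_mono_iff)
    qed
    also have "prob {\<omega>\<in>space M. real l < spread (X s n \<omega>)} = prob {\<omega>\<in>space M. real l < spread (X 0 (K * N) \<omega>)}"
    proof -
      have "prob {\<omega>\<in>space M. real l < spread (X v w \<omega>)} = measure (distr M borel (\<lambda>\<omega>. spread (X v w \<omega>))) {real l<..}"
        if "v \<le> w" for v w
        using meas[OF that] by (subst measure_distr) (auto intro!: arg_cong[where f = prob])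
      then show ?thesis using distr_functional_X[OF spread_measurable s(1)] s by simp
    qed
    finally show ?thesis using l K by simp
  qed
  then show ?thesis by (intro that[of l]) (auto simp: eventually_sequentially)
qed

end

section \<open>From the maximum to the whole vector\<close>

text \<open>Bounded normalised L2 norms force Z n / n to converge to \<mu> in L2, while almost
  surely it converges to \<gamma>. Truncating the squared distance at 1 makes both limits visible in
  one expectation, by dominated convergence on one side and a sandwich on the other.\<close>

lemma (in prob_space) limit_slope_unique:
  fixes Z :: "nat \<Rightarrow> 'a \<Rightarrow> real"
  assumes sq: "\<And>n. sq_int M (Z n)"
    and l2: "(\<lambda>n. l2norm M (\<lambda>\<omega>. (Z n \<omega> - real n * \<mu>) / sqrt (real n))) \<longlonglongrightarrow> \<sigma>"
    and ae: "AE \<omega> in M. (\<lambda>n. Z n \<omega> / real n) \<longlonglongrightarrow> \<gamma>"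
  shows "\<mu> = \<gamma>"
proof -
  let ?f = "\<lambda>n \<omega>. min 1 ((Z n \<omega> / real n - \<mu>)\<^sup>2)"
  have [measurable]: "Z n \<in> borel_measurable M" for n using sq by (simp add: sq_int_def)
  have "(\<lambda>n. expectation (?f n)) \<longlonglongrightarrow> expectation (\<lambda>_. min 1 ((\<gamma> - \<mu>)\<^sup>2))"
  proof (rule integral_dominated_convergence[where w = "\<lambda>_. 1"])
    show "AE \<omega> in M. (\<lambda>n. ?f n \<omega>) \<longlonglongrightarrow> min 1 ((\<gamma> - \<mu>)\<^sup>2)"
      using ae by eventually_elim (intro tendsto_intros)
  qed auto
  moreover have "(\<lambda>n. expectation (?f n)) \<longlonglongrightarrow> 0"
  proof (rule tendsto_sandwich[OF _ _ tendsto_const])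
    let ?W = "\<lambda>n \<omega>. (Z n \<omega> - real n * \<mu>) / sqrt (real n)"
    have W: "sq_int M (?W n)" for n
      using sq_int_cmult[OF sq_int_diff[OF sq sq_int_const], of "1 / sqrt (real n)"] by simp
    show "\<forall>\<^sub>F n in sequentially. expectation (?f n) \<le> (l2norm M (?W n))\<^sup>2 / real n"
      using eventually_gt_at_top[of 0]
    proof eventually_elim
      case (elim n)
      have eq: "(Z n \<omega> / real n - \<mu>)\<^sup>2 = (?W n \<omega>)\<^sup>2 / real n" for \<omega>
        using elim by (simp add: power_divide field_simps power2_eq_square)
      have "expectation (?f n) \<le> expectation (\<lambda>\<omega>. (?W n \<omega>)\<^sup>2 / real n)"
        unfolding eq
      proof (rule integral_mono)
        show "integrable M (\<lambda>\<omega>. min 1 ((?W n \<omega>)\<^sup>2 / real n))"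
          by (rule integrable_const_bound[where B = 1]) auto
        show "integrable M (\<lambda>\<omega>. (?W n \<omega>)\<^sup>2 / real n)"
          using sq_int_integrable_square[OF W[of n]] by (rule integrable_divide)
      qed simp
      then show ?case by (simp add: l2norm_square)
    qed
    have "(\<lambda>n. (l2norm M (?W n))\<^sup>2 * (1 / real n)) \<longlonglongrightarrow> \<sigma>\<^sup>2 * 0"
      by (intro tendsto_intros l2 lim_const_over_n)
    then show "(\<lambda>n. (l2norm M (?W n))\<^sup>2 / real n) \<longlonglongrightarrow> 0" by simp
  qed (auto intro!: always_eventually integral_nonneg_AE)
  ultimately have "expectation (\<lambda>_. min 1 ((\<gamma> - \<mu>)\<^sup>2)) = 0" by (rule LIMSEQ_unique)
  then show ?thesis by (auto simp: prob_space min_def split: if_splits)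
qed

text \<open>A bounded continuous f need not be uniformly continuous, so tightness of
  \<open>Z\<close> is used to work on a compact ball outside an event of small probability.\<close>

lemma (in prob_space) Slutsky_diagonal:
  fixes Z :: "nat \<Rightarrow> 'a \<Rightarrow> real" and W :: "nat \<Rightarrow> 'a \<Rightarrow> real^'d" and f :: "real^'d \<Rightarrow> real"
  assumes Z: "\<And>n. Z n \<in> borel_measurable M" and W: "\<And>n. W n \<in> borel_measurable M"
    and tight: "\<And>\<epsilon>. \<epsilon> > 0 \<Longrightarrow> \<exists>K. \<forall>\<^sub>F n in sequentially. prob {\<omega>\<in>space M. K < \<bar>Z n \<omega>\<bar>} < \<epsilon>"
    and close: "\<And>\<epsilon> \<delta>. \<epsilon> > 0 \<Longrightarrow> \<delta> > 0 \<Longrightarrow>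
      \<forall>\<^sub>F n in sequentially. prob {\<omega>\<in>space M. \<delta> < norm (W n \<omega> - (\<chi> i. Z n \<omega>))} < \<epsilon>"
    and f: "continuous_on UNIV f" "bounded (range f)"
  shows "(\<lambda>n. expectation (\<lambda>\<omega>. f (W n \<omega>)) - expectation (\<lambda>\<omega>. f (\<chi> i. Z n \<omega>))) \<longlonglongrightarrow> 0"
proof (rule LIMSEQ_I)
  fix \<epsilon> :: real assume \<epsilon>: "\<epsilon> > 0"
  obtain B where B: "B > 0" "\<And>x. \<bar>f x\<bar> \<le> B"
    using f(2) unfolding bounded_pos by auto
  have fm: "f \<in> borel_measurable borel" by (rule borel_measurable_continuous_onI[OF f(1)])
  have diag: "(\<lambda>\<omega>. \<chi> i. Z n \<omega>) \<in> borel_measurable M" for n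
    using Z by (intro measurable_vec) simp
  have [measurable]: "Z n \<in> borel_measurable M" "W n \<in> borel_measurable M"
    "(\<lambda>\<omega>. \<chi> i. Z n \<omega>) \<in> borel_measurable M"
    "(\<lambda>\<omega>. f (W n \<omega>)) \<in> borel_measurable M" "(\<lambda>\<omega>. f (\<chi> i. Z n \<omega>)) \<in> borel_measurable M" for n
    using Z W diag measurable_compose[OF W fm] measurable_compose[OF diag fm] by auto
  \<comment> \<open>Each of the two exceptional events costs at most 2 B \<eta> = \<epsilon> /
    4.\<close>
  define \<eta> where "\<eta> = \<epsilon> / (8 * B)"
  have \<eta>: "\<eta> > 0" using \<epsilon> B by (simp add: \<eta>_def)
  obtain K where K: "\<forall>\<^sub>F n in sequentially. prob {\<omega>\<in>space M. K < \<bar>Z n \<omega>\<bar>} < \<eta>"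
    using tight[OF \<eta>] by auto
  \<comment> \<open>Bounds the norm of a constant vector with entries at most |K| in absolute value;
    the added 1 absorbs the distance \<delta> \<le> 1, so that both arguments of f lie in the
    ball.\<close>
  define R where "R = real CARD('d) * \<bar>K\<bar> + 1"
  have "uniformly_continuous_on (cball 0 R) f"
    using f(1) by (intro compact_uniformly_continuous continuous_on_subset[OF f(1)]) auto
  then obtain \<delta>0 where \<delta>0: "\<delta>0 > 0"
    "\<And>x y. x \<in> cball 0 R \<Longrightarrow> y \<in> cball 0 R \<Longrightarrow> dist y x < \<delta>0 \<Longrightarrow> dist (f y) (f x) < \<epsilon> / 4"
    unfolding uniformly_continuous_on_def using \<epsilon> by (metis zero_less_divide_iff zero_less_numeral)
  define \<delta> where "\<delta> = min (\<delta>0 / 2) 1"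
  have \<delta>: "0 < \<delta>" "\<delta> \<le> 1" "\<delta> < \<delta>0" using \<delta>0(1) by (auto simp: \<delta>_def)
  have "\<forall>\<^sub>F n in sequentially.
      \<bar>expectation (\<lambda>\<omega>. f (W n \<omega>)) - expectation (\<lambda>\<omega>. f (\<chi> i. Z n \<omega>))\<bar> < \<epsilon>"
    using K close[OF \<eta> \<delta>(1)]
  proof eventually_elim
    case (elim n)
    define E1 where "E1 = {\<omega>\<in>space M. K < \<bar>Z n \<omega>\<bar>}"
    define E2 where "E2 = {\<omega>\<in>space M. \<delta> < norm (W n \<omega> - (\<chi> i. Z n \<omega>))}"
    have E: "E1 \<in> events" "E2 \<in> events" unfolding E1_def E2_def by measurable
    have int: "integrable M (\<lambda>\<omega>. f (W n \<omega>))" "integrable M (\<lambda>\<omega>. f (\<chi> i. Z n \<omega>))"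
      using B by (auto intro!: integrable_const_bound[where B = B])
    have "\<bar>expectation (\<lambda>\<omega>. f (W n \<omega>)) - expectation (\<lambda>\<omega>. f (\<chi> i. Z n \<omega>))\<bar>
        = \<bar>expectation (\<lambda>\<omega>. f (W n \<omega>) - f (\<chi> i. Z n \<omega>))\<bar>" using int by simp
    also have "\<dots> \<le> expectation (\<lambda>\<omega>. \<bar>f (W n \<omega>) - f (\<chi> i. Z n \<omega>)\<bar>)"
      by (rule integral_abs_bound)
    also have "\<dots> \<le> expectation (\<lambda>\<omega>. \<epsilon> / 4 + (2 * B * indicator E1 \<omega> + 2 * B * indicator E2 \<omega>))"
    proof (rule integral_mono)
      show "integrable M (\<lambda>\<omega>. \<epsilon> / 4 + (2 * B * indicator E1 \<omega> + 2 * B * indicator E2 \<omega>))"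
        using E by (auto simp: less_top[symmetric])
      fix \<omega> assume \<omega>: "\<omega> \<in> space M"
      show "\<bar>f (W n \<omega>) - f (\<chi> i. Z n \<omega>)\<bar> \<le> \<epsilon> / 4 + (2 * B * indicator E1 \<omega> + 2 * B * indicator E2 \<omega>)"
      proof (cases "\<omega> \<in> E1 \<union> E2")
        case True
        have "\<bar>f (W n \<omega>) - f (\<chi> i. Z n \<omega>)\<bar> \<le> 2 * B" using B(2)[of "W n \<omega>"] B(2)[of "\<chi> i. Z n \<omega>"] by linarith
        also have "\<dots> \<le> 2 * B * indicator E1 \<omega> + 2 * B * indicator E2 \<omega>"
          using True B by (auto simp: indicator_def)
        finally show ?thesis using \<epsilon> by simp
      next
        case False
        then have Zle: "\<bar>Z n \<omega>\<bar> \<le> \<bar>K\<bar>" and d: "norm (W n \<omega> - (\<chi> i. Z n \<omega>)) \<le> \<delta>"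
          using \<omega> by (auto simp: E1_def E2_def)
        have "norm (\<chi> i::'d. Z n \<omega>) \<le> (\<Sum>i\<in>(UNIV::'d set). \<bar>Z n \<omega>\<bar>)"
          using norm_le_l1_cart[of "\<chi> i::'d. Z n \<omega>"] by simp
        also have "\<dots> \<le> real CARD('d) * \<bar>K\<bar>" using Zle by (simp add: mult_left_mono)
        finally have n1: "norm (\<chi> i::'d. Z n \<omega>) \<le> real CARD('d) * \<bar>K\<bar>" .
        moreover have "norm (W n \<omega>) \<le> norm (\<chi> i::'d. Z n \<omega>) + norm (W n \<omega> - (\<chi> i. Z n \<omega>))"
          by (rule norm_triangle_sub)
        ultimately have "dist (f (W n \<omega>)) (f (\<chi> i. Z n \<omega>)) < \<epsilon> / 4"
          using d \<delta> by (intro \<delta>0(2)) (auto simp: R_def dist_norm)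
        then show ?thesis using B by (simp add: dist_norm add_nonneg_nonneg add_increasing2)
      qed
    qed (use int in auto)
    also have "\<dots> = \<epsilon> / 4 + (2 * B * prob E1 + 2 * B * prob E2)"
      using E by (simp add: prob_space less_top[symmetric])
    also have "\<dots> < \<epsilon>"
    proof -
      have "2 * B * prob E1 + 2 * B * prob E2 < 2 * B * \<eta> + 2 * B * \<eta>"
        using elim B by (intro add_strict_mono mult_strict_left_mono) (auto simp: E1_def E2_def)
      also have "\<dots> = \<epsilon> / 2" using B by (simp add: \<eta>_def)
      finally show ?thesis using \<epsilon> by simp
    qed
    finally show ?case .
  qed
  then show "\<exists>no. \<forall>n\<ge>no. norm (expectation (\<lambda>\<omega>. f (W n \<omega>)) - expectation (\<lambda>\<omega>. f (\<chi> i. Z n \<omega>)) - 0) < \<epsilon>"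
    by (simp add: eventually_sequentially)
qed

lemma normal_density_scale_std:
  assumes "\<sigma> > 0"
  shows "density lborel (normal_density 0 \<sigma>) = distr std_normal_distribution borel (\<lambda>z. \<sigma> * z)"
proof -
  interpret prob_space std_normal_distribution by (rule prob_space_normal_density) simp
  have "distributed std_normal_distribution lborel (\<lambda>z. z) (normal_density 0 1)"
    by (auto simp: distributed_def distr_id2)
  from normal_density_affine[OF this, of \<sigma> 0] assms
  have "distributed std_normal_distribution lborel (\<lambda>z. \<sigma> * z) (normal_density 0 \<sigma>)" by simp
  then have "distr std_normal_distribution lborel (\<lambda>z. \<sigma> * z) = density lborel (normal_density 0 \<sigma>)"
    by (simp add: distributed_def)
  moreover have "distr std_normal_distribution lborel (\<lambda>z. \<sigma> * z) = distr std_normal_distribution borel (\<lambda>z. \<sigma> * z)"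
    by (rule distr_cong) auto
  ultimately show ?thesis by simp
qed

text \<open>The target measure lives on the diagonal, so f composed with the diagonal embedding is a
  test function on the line. Division by \<sigma> reduces to the standard normal law, for which Levy
  continuity is applied.\<close>

lemma (in prob_space) diag_normal_limit:
  fixes Z :: "nat \<Rightarrow> 'a \<Rightarrow> real" and f :: "real^'d \<Rightarrow> real"
  assumes Z: "\<And>n. Z n \<in> borel_measurable M"
    and char: "\<And>t. (\<lambda>n. char (distr M borel (Z n)) t) \<longlonglongrightarrow> complex_of_real (exp (- (\<sigma> * t)\<^sup>2 / 2))"
    and \<sigma>: "\<sigma> > 0" and f: "continuous_on UNIV f" "bounded (range f)"
  shows "(\<lambda>n. expectation (\<lambda>\<omega>. f (\<chi> i. Z n \<omega>))) \<longlonglongrightarrow> integral\<^sup>L (diag_normal (\<sigma>\<^sup>2)) f"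
proof -
  have fm: "f \<in> borel_measurable borel" by (rule borel_measurable_continuous_onI[OF f(1)])
  let ?g = "\<lambda>z. f (\<chi> i. \<sigma> * z)"
  have cont: "continuous_on UNIV ?g"
    by (rule continuous_on_compose2[OF f(1)]) (auto intro!: continuous_intros)
  obtain B where B: "\<And>x. \<bar>f x\<bar> \<le> B" using f(2) unfolding bounded_pos by auto
  have Zm: "(\<lambda>\<omega>. 1 / \<sigma> * Z n \<omega>) \<in> borel_measurable M" for n using Z by simp
  have "weak_conv_m (\<lambda>n. distr M borel (\<lambda>\<omega>. 1 / \<sigma> * Z n \<omega>)) std_normal_distribution"
  proof (rule levy_continuity)
    show "(\<lambda>n. char (distr M borel (\<lambda>\<omega>. 1 / \<sigma> * Z n \<omega>)) t) \<longlonglongrightarrow> char std_normal_distribution t" for t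
      using char[of "1 / \<sigma> * t"] \<sigma>
      unfolding char_distr_cmult[OF Z] by (simp add: char_std_normal_distribution)
  qed (rule real_distribution_distr[OF Zm], rule real_dist_normal_dist)
  then have "(\<lambda>n. integral\<^sup>L (distr M borel (\<lambda>\<omega>. 1 / \<sigma> * Z n \<omega>)) ?g) \<longlonglongrightarrow> integral\<^sup>L std_normal_distribution ?g"
  proof (rule weak_conv_imp_integral_bdd_continuous_conv[OF real_distribution_distr[OF Zm] real_dist_normal_dist])
    show "isCont ?g x" for x using cont by (simp add: continuous_on_eq_continuous_at)
    show "norm (?g x) \<le> B" for x using B by simp
  qed
  moreover have "integral\<^sup>L (distr M borel (\<lambda>\<omega>. 1 / \<sigma> * Z n \<omega>)) ?g = expectation (\<lambda>\<omega>. f (\<chi> i. Z n \<omega>))" for n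
    using \<sigma> by (subst integral_distr[OF Zm borel_measurable_continuous_onI[OF cont]]) simp
  moreover have "integral\<^sup>L (diag_normal (\<sigma>\<^sup>2)) f = integral\<^sup>L std_normal_distribution ?g"
  proof -
    have diag: "(\<lambda>z::real. (\<chi> i. z) :: real^'d) \<in> borel_measurable borel"
      by (intro borel_measurable_continuous_onI continuous_intros)
    have sm: "(\<lambda>z. \<sigma> * z) \<in> borel_measurable std_normal_distribution" by simp
    have "(diag_normal (\<sigma>\<^sup>2) :: (real^'d) measure) = distr (density lborel (normal_density 0 \<sigma>)) borel (\<lambda>z. \<chi> i. z)"
      using \<sigma> by (simp add: diag_normal_def)
    also have "\<dots> = distr (distr std_normal_distribution borel (\<lambda>z. \<sigma> * z)) borel (\<lambda>z. \<chi> i. z)"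
      by (rule arg_cong[OF normal_density_scale_std[OF \<sigma>], of "\<lambda>m. distr m borel (\<lambda>z. \<chi> i. z)"])
    also have "\<dots> = distr std_normal_distribution borel (\<lambda>z. \<chi> i. \<sigma> * z)"
      using distr_distr[OF diag sm] unfolding comp_def .
    finally have eq: "(diag_normal (\<sigma>\<^sup>2) :: (real^'d) measure)
        = distr std_normal_distribution borel (\<lambda>z. \<chi> i. \<sigma> * z)" .
    have "(\<lambda>z. (\<chi> i. \<sigma> * z) :: real^'d) \<in> borel_measurable std_normal_distribution"
      by (intro measurable_vec) simp
    then show ?thesis unfolding eq by (rule integral_distr[OF _ fm])
  qed
  ultimately show ?thesis by simp
qed

theorem theorem2p7:
  fixes M :: "'a measure" and A :: "nat \<Rightarrow> 'a \<Rightarrow> ereal^'d^'d" and \<gamma> :: real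
  assumes "prob_space M"
    and valid: "\<forall>n\<ge>1. \<forall>\<omega>\<in>space M. mp_valid (A n \<omega>)"
    and indep: "prob_space.indep_vars M (\<lambda>_. borel) A {1..}"
    and ident: "\<forall>n\<ge>1. distr M borel (A n) = distr M borel (A 1)"
    and memloss: "\<exists>N\<ge>1. measure M {\<omega>\<in>space M. mp_rank1 (mp_prod (\<lambda>k. A k \<omega>) N)} > 0"
    and mom1: "finite_second_moment M (\<lambda>\<omega>. mp_maxentry (A 1 \<omega>))"
    and mom2: "finite_second_moment M (\<lambda>\<omega>. mp_minmax (A 1 \<omega>))"
    and lyap: "AE \<omega> in M. (\<lambda>n. (1 / real n) *\<^sub>R mp_traj (\<lambda>k. A k \<omega>) 0 n) \<longlonglongrightarrow> (\<chi> i. \<gamma>)"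
  shows "\<exists>\<sigma>2\<ge>0.
     (\<forall>X0 :: 'a \<Rightarrow> real^'d.
        X0 \<in> borel_measurable M \<longrightarrow>
        indep_rv M borel X0 borel (\<lambda>\<omega> n. A (Suc n) \<omega>) \<longrightarrow>
        weak_conv_vec
          (\<lambda>n. distr M borel (\<lambda>\<omega>. (1 / sqrt (real n)) *\<^sub>R
                 (mp_traj (\<lambda>k. A k \<omega>) (X0 \<omega>) n - (\<chi> i. real n * \<gamma>))))
          (diag_normal \<sigma>2))
     \<and> (\<forall>n\<ge>1. integrable M (\<lambda>\<omega>. (real_of_ereal (mp_maxentry (mp_prod (\<lambda>k. A k \<omega>) n)) - real n * \<gamma>)\<^sup>2))
     \<and> (\<lambda>n. (1 / real n) * (\<integral>\<omega>. (real_of_ereal (mp_maxentry (mp_prod (\<lambda>k. A k \<omega>) n)) - real n * \<gamma>)\<^sup>2 \<partial>M))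
          \<longlonglongrightarrow> \<sigma>2"
proof -
  obtain N where N: "N \<ge> 1" "measure M {\<omega>\<in>space M. mp_rank1 (mp_prod (\<lambda>k. A k \<omega>) N)} > 0"
    using memloss by blast
  interpret memory_loss M A N
  proof (rule memory_loss.intro[OF \<open>prob_space M\<close>], rule memory_loss_axioms.intro)
    show "distr M borel (A n) = distr M borel (A 1)" if "1 \<le> n" for n using ident that by blast
  qed (use valid indep N mom1 mom2 in blast)+
  obtain C \<rho> where "almost_additive M borel (\<lambda>k. A (Suc k)) S C \<rho>" by (rule almost_additive_S)
  then interpret aa: almost_additive M borel "\<lambda>k. A (Suc k)" S C \<rho> .
  obtain \<mu> \<sigma> where \<sigma>: "0 \<le> \<sigma>"
    and "\<And>n. \<bar>expectation (S 0 n) - real n * \<mu>\<bar> \<le> C"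
    and l2: "(\<lambda>n. l2norm M (\<lambda>\<omega>. (S 0 n \<omega> - real n * \<mu>) / sqrt (real n))) \<longlonglongrightarrow> \<sigma>"
    and char: "\<And>t. (\<lambda>n. char (distr M borel (\<lambda>\<omega>. (S 0 n \<omega> - real n * \<mu>) / sqrt (real n))) t)
           \<longlonglongrightarrow> complex_of_real (exp (- (\<sigma> * t)\<^sup>2 / 2))"
    by (rule aa.almost_additive_CLT) (rule that)
  have traj: "mp_traj (\<lambda>k. A k \<omega>) 0 n = X 0 n \<omega>" for n \<omega>
    by (simp add: X_def shifted_def[abs_def])
  have "AE \<omega> in M. (\<lambda>n. S 0 n \<omega> / real n) \<longlonglongrightarrow> \<gamma>"
    using lyap
  proof eventually_elim
    case (elim \<omega>)
    have "(\<lambda>n. X 0 n \<omega> $ i / real n) \<longlonglongrightarrow> \<gamma>" for i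
      using tendsto_vec_nth[OF elim, of i] by (simp add: traj)
    \<comment> \<open>The sum over coordinates dominates the deviation of the maximal one, whose
      index may change with n.\<close>
    then have "(\<lambda>n. \<Sum>i\<in>UNIV. \<bar>X 0 n \<omega> $ i / real n - \<gamma>\<bar>) \<longlonglongrightarrow> (\<Sum>i\<in>(UNIV::'d set). \<bar>\<gamma> - \<gamma>\<bar>)"
      by (intro tendsto_intros)
    then have lim: "(\<lambda>n. \<Sum>i\<in>UNIV. \<bar>X 0 n \<omega> $ i / real n - \<gamma>\<bar>) \<longlonglongrightarrow> 0" by simp
    have "norm (S 0 n \<omega> / real n - \<gamma>) \<le> (\<Sum>i\<in>UNIV. \<bar>X 0 n \<omega> $ i / real n - \<gamma>\<bar>)" for n
    proof -
      obtain i where "vmax (X 0 n \<omega>) = X 0 n \<omega> $ i" by (rule vmax_attained)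
      then show ?thesis by (auto simp: S_def intro!: member_le_sum[of i UNIV "\<lambda>i. \<bar>X 0 n \<omega> $ i / real n - \<gamma>\<bar>"])
    qed
    then have "(\<lambda>n. S 0 n \<omega> / real n - \<gamma>) \<longlonglongrightarrow> 0"
      by (intro Lim_null_comparison[OF _ lim] always_eventually) simp
    then show ?case by (rule LIM_zero_cancel)
  qed
  then have \<mu>: "\<mu> = \<gamma>" by (intro limit_slope_unique[OF S_sq l2]) auto
  define Z where "Z n \<omega> = (S 0 n \<omega> - real n * \<gamma>) / sqrt (real n)" for n \<omega>
  have Z_sq: "sq_int M (Z n)" for n
    using sq_int_cmult[OF sq_int_diff[OF S_sq sq_int_const], of 0 n "1 / sqrt (real n)"]
    by (simp add: Z_def[abs_def])
  then have Zm: "Z n \<in> borel_measurable M" for n by (simp add: sq_int_def)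
  have Z_l2: "(\<lambda>n. l2norm M (Z n)) \<longlonglongrightarrow> \<sigma>"
    using l2 by (simp add: Z_def[abs_def] \<mu>)
  have max: "real_of_ereal (mp_maxentry (mp_prod (\<lambda>k. A k \<omega>) n)) = S 0 n \<omega>" if "\<omega> \<in> space M" for n \<omega>
    using valid that by (subst mp_maxentry_prod) (auto simp: S_def traj)
  have tight: "\<exists>K. \<forall>\<^sub>F n in sequentially. prob {\<omega>\<in>space M. K < \<bar>Z n \<omega>\<bar>} < \<epsilon>" if \<epsilon>: "\<epsilon> > 0" for \<epsilon>
  proof -
    \<comment> \<open>Chebyshev's bound with second moments eventually below \<sigma> squared plus
      1; the 1 leaves room above the limit and keeps K positive when \<sigma> = 0.\<close>
    define K where "K = sqrt ((\<sigma>\<^sup>2 + 1) / \<epsilon>)"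
    have pos: "\<sigma>\<^sup>2 + 1 > 0" by (simp add: add_nonneg_pos)
    then have "(\<sigma>\<^sup>2 + 1) / \<epsilon> > 0" using \<epsilon> by simp
    then have K: "K > 0" "K\<^sup>2 = (\<sigma>\<^sup>2 + 1) / \<epsilon>" by (simp_all add: K_def)
    have "(\<lambda>n. (l2norm M (Z n))\<^sup>2) \<longlonglongrightarrow> \<sigma>\<^sup>2" by (intro tendsto_intros Z_l2)
    then have "\<forall>\<^sub>F n in sequentially. (l2norm M (Z n))\<^sup>2 < \<sigma>\<^sup>2 + 1" by (rule order_tendstoD) simp
    then have "\<forall>\<^sub>F n in sequentially. prob {\<omega>\<in>space M. K < \<bar>Z n \<omega>\<bar>} < \<epsilon>"
    proof eventually_elim
      case (elim n)
      have "prob {\<omega>\<in>space M. K < \<bar>Z n \<omega>\<bar>} \<le> prob {\<omega>\<in>space M. K \<le> \<bar>Z n \<omega>\<bar>}"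
        using Zm[of n] by (intro finite_measure_mono) auto
      also have "\<dots> \<le> (l2norm M (Z n))\<^sup>2 / K\<^sup>2" by (rule prob_abs_ge_le_l2norm[OF Z_sq K(1)])
      also have "\<dots> < (\<sigma>\<^sup>2 + 1) / K\<^sup>2" using elim K(1) by (intro divide_strict_right_mono) auto
      also have "\<dots> = \<epsilon>" using less_imp_neq[OF pos] by (simp add: K(2))
      finally show ?case .
    qed
    then show ?thesis ..
  qed
  have weak: "weak_conv_vec (\<lambda>n. distr M borel (\<lambda>\<omega>. (1 / sqrt (real n)) *\<^sub>R
        (mp_traj (\<lambda>k. A k \<omega>) (X0 \<omega>) n - (\<chi> i. real n * \<gamma>)))) (diag_normal (\<sigma>\<^sup>2))"
    if X0: "X0 \<in> borel_measurable M" for X0 :: "'a \<Rightarrow> real^'d"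
  proof -
    define W where "W n \<omega> = (1 / sqrt (real n)) *\<^sub>R (mp_traj (\<lambda>k. A k \<omega>) (X0 \<omega>) n - (\<chi> i. real n * \<gamma>))" for n \<omega>
    have W_nth: "W n \<omega> $ i = (mp_traj (\<lambda>k. A k \<omega>) (X0 \<omega>) n $ i - real n * \<gamma>) / sqrt (real n)" for n \<omega> i
      by (simp add: W_def)
    have Wm: "W n \<in> borel_measurable M" for n
    proof (rule measurable_vec)
      fix i
      have "(\<lambda>\<omega>. mp_traj (\<lambda>k. A k \<omega>) (X0 \<omega>) n $ i) \<in> borel_measurable M"
        by (rule measurable_mp_traj) (auto intro: A_measurable measurable_vec_nth[OF X0])
      then show "(\<lambda>\<omega>. W n \<omega> $ i) \<in> borel_measurable M" unfolding W_nth by measurable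
    qed
    \<comment> \<open>Replacing the initial vector by 0 costs its norm, replacing a coordinate by
      the largest one costs the spread; the dimension factor comes from passing to the sum
      norm.\<close>
    have diff: "norm (W n \<omega> - (\<chi> i. Z n \<omega>)) \<le> real CARD('d) * ((norm (X0 \<omega>) + spread (X 0 n \<omega>)) / sqrt (real n))"
      if \<omega>: "\<omega> \<in> space M" for n \<omega>
    proof -
      have "\<bar>(W n \<omega> - (\<chi> i. Z n \<omega>)) $ i\<bar> \<le> (norm (X0 \<omega>) + spread (X 0 n \<omega>)) / sqrt (real n)" for i
      proof -
        let ?y = "mp_traj (\<lambda>k. A k \<omega>) (X0 \<omega>) n $ i"
        have v: "\<And>k. k \<in> {1..n} \<Longrightarrow> mp_valid (A k \<omega>)" using valid \<omega> by auto
        have c: "\<bar>X0 \<omega> $ j\<bar> \<le> norm (X0 \<omega>)" for j by (rule component_le_norm_cart)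
        have c': "X0 \<omega> $ j \<le> norm (X0 \<omega>)" "0 \<le> X0 \<omega> $ j + norm (X0 \<omega>)" for j using c[of j] by linarith+
        have "?y \<le> X 0 n \<omega> $ i + norm (X0 \<omega>)" "X 0 n \<omega> $ i \<le> ?y + norm (X0 \<omega>)"
          unfolding traj[symmetric]
          using mp_traj_mono_plus[where B = "\<lambda>k. A k \<omega>" and x = "X0 \<omega>" and y = 0 and c = "norm (X0 \<omega>)", OF v]
            mp_traj_mono_plus[where B = "\<lambda>k. A k \<omega>" and y = "X0 \<omega>" and x = 0 and c = "norm (X0 \<omega>)", OF v] c'
          by simp_all
        moreover have "X 0 n \<omega> $ i \<le> S 0 n \<omega>" "S 0 n \<omega> - X 0 n \<omega> $ i \<le> spread (X 0 n \<omega>)"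
          unfolding S_def by (rule vmax_ge, rule spread_ge)
        ultimately have "\<bar>?y - S 0 n \<omega>\<bar> \<le> norm (X0 \<omega>) + spread (X 0 n \<omega>)" by linarith
        moreover have "(W n \<omega> - (\<chi> i. Z n \<omega>)) $ i = (?y - S 0 n \<omega>) / sqrt (real n)"
          by (simp add: W_nth Z_def diff_divide_distrib)
        ultimately show ?thesis by (simp add: abs_divide divide_right_mono)
      qed
      then have "(\<Sum>i\<in>UNIV. \<bar>(W n \<omega> - (\<chi> i. Z n \<omega>)) $ i\<bar>)
          \<le> (\<Sum>i\<in>(UNIV::'d set). (norm (X0 \<omega>) + spread (X 0 n \<omega>)) / sqrt (real n))"
        by (rule sum_mono)
      then show ?thesis using norm_le_l1_cart[of "W n \<omega> - (\<chi> i. Z n \<omega>)"] by simp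
    qed
    have spread_m: "(\<lambda>\<omega>. spread (X 0 n \<omega>)) \<in> borel_measurable M" for n
      by (rule measurable_compose[OF X_measurable spread_measurable]) simp
    have close: "\<forall>\<^sub>F n in sequentially. prob {\<omega>\<in>space M. \<delta> < norm (W n \<omega> - (\<chi> i. Z n \<omega>))} < \<epsilon>"
      if \<epsilon>: "\<epsilon> > 0" and \<delta>: "\<delta> > 0" for \<epsilon> \<delta>
    proof -
      have normm: "(\<lambda>\<omega>. norm (X0 \<omega>)) \<in> borel_measurable M" using X0 by simp
      obtain l1 :: nat where l1: "prob {\<omega>\<in>space M. real l1 < norm (X0 \<omega>)} < \<epsilon> / 2"
        using prob_gt_small[OF normm, of "\<epsilon> / 2"] \<epsilon> by auto
      obtain l2 :: nat where l2: "\<forall>\<^sub>F n in sequentially. prob {\<omega>\<in>space M. real l2 < spread (X 0 n \<omega>)} < \<epsilon> / 2"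
        using spread_tight[of "\<epsilon> / 2"] \<epsilon> by auto
      have "(\<lambda>n. real CARD('d) * ((real l1 + real l2) / sqrt (real n))) \<longlonglongrightarrow> real CARD('d) * 0"
        by (intro tendsto_intros tendsto_divide_0[OF tendsto_const] filterlim_at_top_imp_at_infinity
            filterlim_compose[OF sqrt_at_top filterlim_real_sequentially])
      then have "\<forall>\<^sub>F n in sequentially. real CARD('d) * ((real l1 + real l2) / sqrt (real n)) < \<delta>"
        by (rule order_tendstoD) (use \<delta> in simp)
      with l2 show ?thesis
      proof eventually_elim
        case (elim n)
        have "{\<omega>\<in>space M. \<delta> < norm (W n \<omega> - (\<chi> i. Z n \<omega>))}
            \<subseteq> {\<omega>\<in>space M. real l1 < norm (X0 \<omega>)} \<union> {\<omega>\<in>space M. real l2 < spread (X 0 n \<omega>)}"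
        proof (rule subsetI, rule ccontr)
          fix \<omega> assume *: "\<omega> \<in> {\<omega>\<in>space M. \<delta> < norm (W n \<omega> - (\<chi> i. Z n \<omega>))}"
            "\<omega> \<notin> {\<omega>\<in>space M. real l1 < norm (X0 \<omega>)} \<union> {\<omega>\<in>space M. real l2 < spread (X 0 n \<omega>)}"
          then have "norm (X0 \<omega>) + spread (X 0 n \<omega>) \<le> real l1 + real l2" by auto
          then have "real CARD('d) * ((norm (X0 \<omega>) + spread (X 0 n \<omega>)) / sqrt (real n))
              \<le> real CARD('d) * ((real l1 + real l2) / sqrt (real n))"
            by (intro mult_left_mono divide_right_mono) auto
          then show False using diff[of \<omega> n] * elim(2) by simp
        qed
        then have "prob {\<omega>\<in>space M. \<delta> < norm (W n \<omega> - (\<chi> i. Z n \<omega>))}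
            \<le> prob ({\<omega>\<in>space M. real l1 < norm (X0 \<omega>)} \<union> {\<omega>\<in>space M. real l2 < spread (X 0 n \<omega>)})"
          using normm spread_m[of n] by (intro finite_measure_mono sets.Un) simp_all
        also have "\<dots> \<le> prob {\<omega>\<in>space M. real l1 < norm (X0 \<omega>)} + prob {\<omega>\<in>space M. real l2 < spread (X 0 n \<omega>)}"
          using normm spread_m[of n] by (intro measure_Un_le) simp_all
        finally show ?case using l1 elim(1) by linarith
      qed
    qed
    show ?thesis
      unfolding weak_conv_vec_def W_def[symmetric]
    proof (intro allI impI)
      fix f :: "real^'d \<Rightarrow> real" assume f: "continuous_on UNIV f" "bounded (range f)"
      have fm: "f \<in> borel_measurable borel" by (rule borel_measurable_continuous_onI[OF f(1)])
      have "(\<lambda>n. expectation (\<lambda>\<omega>. f (W n \<omega>))) \<longlonglongrightarrow> integral\<^sup>L (diag_normal (\<sigma>\<^sup>2)) f"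
      proof (cases "\<sigma> = 0")
        case False
        then have "(\<lambda>n. expectation (\<lambda>\<omega>. f (\<chi> i. Z n \<omega>))) \<longlonglongrightarrow> integral\<^sup>L (diag_normal (\<sigma>\<^sup>2)) f"
          using char \<sigma> by (intro diag_normal_limit[OF Zm _ _ f]) (auto simp: Z_def[abs_def] \<mu>)
        from tendsto_add[OF Slutsky_diagonal[OF Zm Wm tight close f] this] show ?thesis by simp
      next
        case True
        \<comment> \<open>For \<sigma> = 0 the target is the Dirac measure at 0 and division by
          \<sigma> is impossible. The vanishing L2 norms give convergence of \<open>W n\<close> to 0
          in probability, which is the hypothesis of \<open>Slutsky_diagonal\<close> with the
          constant 0 as scalar process.\<close>
        have close0: "\<forall>\<^sub>F n in sequentially. prob {\<omega>\<in>space M. \<delta> < norm (W n \<omega> - (\<chi> i. 0))} < \<epsilon>"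
          if \<epsilon>: "\<epsilon> > 0" and \<delta>: "\<delta> > 0" for \<epsilon> \<delta>
        proof -
          \<comment> \<open>A constant vector with entries below \<eta> in absolute value has norm
            at most \<delta> / 2.\<close>
          define \<eta> where "\<eta> = \<delta> / (2 * real CARD('d))"
          have \<eta>: "\<eta> > 0" using \<delta> by (simp add: \<eta>_def)
          have "(\<lambda>n. (l2norm M (Z n))\<^sup>2 / \<eta>\<^sup>2) \<longlonglongrightarrow> 0\<^sup>2 / \<eta>\<^sup>2"
            using Z_l2 \<eta> unfolding True by (intro tendsto_intros) auto
          then have "\<forall>\<^sub>F n in sequentially. (l2norm M (Z n))\<^sup>2 / \<eta>\<^sup>2 < \<epsilon> / 2"
            by (rule order_tendstoD) (use \<epsilon> in simp)
          moreover have "\<forall>\<^sub>F n in sequentially. prob {\<omega>\<in>space M. \<delta> / 2 < norm (W n \<omega> - (\<chi> i. Z n \<omega>))} < \<epsilon> / 2"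
            by (rule close) (use \<epsilon> \<delta> in auto)
          ultimately show ?thesis
          proof eventually_elim
            case (elim n)
            let ?E1 = "{\<omega>\<in>space M. \<eta> \<le> \<bar>Z n \<omega>\<bar>}" and ?E2 = "{\<omega>\<in>space M. \<delta> / 2 < norm (W n \<omega> - (\<chi> i. Z n \<omega>))}"
            have [measurable]: "Z n \<in> borel_measurable M" "W n \<in> borel_measurable M"
              "(\<lambda>\<omega>. (\<chi> i. Z n \<omega>) :: real^'d) \<in> borel_measurable M"
              using Zm Wm by (auto intro!: measurable_vec)
            have "{\<omega>\<in>space M. \<delta> < norm (W n \<omega> - (\<chi> i. 0))} \<subseteq> ?E1 \<union> ?E2"
            proof (rule subsetI, rule ccontr)
              fix \<omega> assume *: "\<omega> \<in> {\<omega>\<in>space M. \<delta> < norm (W n \<omega> - (\<chi> i. 0))}" "\<omega> \<notin> ?E1 \<union> ?E2"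
              have "norm (\<chi> i::'d. Z n \<omega>) \<le> real CARD('d) * \<bar>Z n \<omega>\<bar>"
                using norm_le_l1_cart[of "\<chi> i::'d. Z n \<omega>"] by simp
              also have "\<dots> \<le> real CARD('d) * \<eta>" using * by (intro mult_left_mono) auto
              also have "\<dots> = \<delta> / 2" by (simp add: \<eta>_def)
              finally have "norm (\<chi> i::'d. Z n \<omega>) \<le> \<delta> / 2" .
              moreover have "norm (W n \<omega>) \<le> norm (\<chi> i::'d. Z n \<omega>) + norm (W n \<omega> - (\<chi> i. Z n \<omega>))"
                by (rule norm_triangle_sub)
              moreover have "(\<chi> i. 0) = (0 :: real^'d)" by (simp add: vec_eq_iff)
              ultimately show False using * by auto
            qed
            then have "prob {\<omega>\<in>space M. \<delta> < norm (W n \<omega> - (\<chi> i. 0))} \<le> prob (?E1 \<union> ?E2)"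
              by (rule finite_measure_mono) measurable
            also have "\<dots> \<le> prob ?E1 + prob ?E2" by (rule measure_Un_le) measurable
            finally show ?case
              using prob_abs_ge_le_l2norm[OF Z_sq \<eta>, of n] elim by linarith
          qed
        qed
        have "(\<lambda>n. expectation (\<lambda>\<omega>. f (W n \<omega>)) - expectation (\<lambda>\<omega>. f (\<chi> i. 0))) \<longlonglongrightarrow> 0"
          by (rule Slutsky_diagonal[OF _ Wm _ close0 f]) (auto intro!: exI[of _ 0])
        moreover have "integral\<^sup>L (diag_normal (\<sigma>\<^sup>2)) f = f (\<chi> i. 0)"
          using True fm by (simp add: diag_normal_def integral_return zero_vec_def)
        ultimately show ?thesis by (simp add: prob_space LIM_zero_cancel)
      qed
      then show "(\<lambda>n. integral\<^sup>L (distr M borel (W n)) f) \<longlonglongrightarrow> integral\<^sup>L (diag_normal (\<sigma>\<^sup>2)) f"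
        by (simp add: integral_distr[OF Wm fm])
    qed
  qed
  have int_eq: "integrable M (\<lambda>\<omega>. (real_of_ereal (mp_maxentry (mp_prod (\<lambda>k. A k \<omega>) n)) - real n * \<gamma>)\<^sup>2)
      \<longleftrightarrow> integrable M (\<lambda>\<omega>. (S 0 n \<omega> - real n * \<gamma>)\<^sup>2)" for n
    by (rule Bochner_Integration.integrable_cong) (auto simp: max)
  have exp_eq: "(\<integral>\<omega>. (real_of_ereal (mp_maxentry (mp_prod (\<lambda>k. A k \<omega>) n)) - real n * \<gamma>)\<^sup>2 \<partial>M)
      = (\<integral>\<omega>. (S 0 n \<omega> - real n * \<gamma>)\<^sup>2 \<partial>M)" for n
    by (rule Bochner_Integration.integral_cong) (auto simp: max)
  \<comment> \<open>For n = 0 both sides are 0, by the convention for division by zero.\<close>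
  have "(1 / real n) * (\<integral>\<omega>. (S 0 n \<omega> - real n * \<gamma>)\<^sup>2 \<partial>M) = (l2norm M (Z n))\<^sup>2" for n
    by (simp add: l2norm_square Z_def power_divide)
  moreover have "(\<lambda>n. (l2norm M (Z n))\<^sup>2) \<longlonglongrightarrow> \<sigma>\<^sup>2" by (intro tendsto_intros Z_l2)
  moreover have "integrable M (\<lambda>\<omega>. (S 0 n \<omega> - real n * \<gamma>)\<^sup>2)" for n
    by (rule sq_int_integrable_square) (intro sq_int_diff S_sq sq_int_const; simp)
  ultimately show ?thesis
    using weak by (intro exI[of _ "\<sigma>\<^sup>2"]) (auto simp: int_eq exp_eq)
qed

end
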